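(* For $n\geqslant 3$, let $S\in\{\mathcal{OP}_n,\mathcal{POPI}_n,\mathcal{POP}_n,\mathcal{OR}_n,\mathcal{PORI}_n,\mathcal{POR}_n\}$ and let $\phi:S\longrightarrow S$ be any mapping. Then $\phi$ is an endomorphism of the semigroup $S$ if and only if one of the following properties holds: 1. $\phi=\phi_S^\sigma$ for some $\sigma\in\mathcal{D}_{2n}\simeq \mathrm{Aut}(S)$, and so $\phi$ is an automorphism; 2. $S\in\{\mathcal{POPI}_n,\mathcal{POP}_n,\mathcal{PORI}_n,\mathcal{POR}_n\}$ and $\phi=\phi^S_\sigma$ for some $\sigma\in\mathcal{N}_n$; 3. there exist idempotents $e,f\in S$ with $e\neq f$ and $ef=fe=f$ such that $J_n^S\phi=\{e\}$ and $I_{n-1}^S\phi=\{f\}$; 4. $S\in\{\mathcal{POPI}_n,\mathcal{POP}_n\}$ and there exists a group-element $g_0$ in $S$ of order $p$, with $p$ a divisor of $n$ and $p>1$, such that $g^i\phi=g_0^{i+p}$ for $0\leqslant i\leqslant n-1$, and $I_{n-1}^S\phi=\{\emptyset\}$; 5. $S\in\{\mathcal{PORI}_n,\mathcal{POR}_n\}$ and there exist group-elements $h_0$ of order $2$ and $g_0$ of order $p$, with $p$ a divisor of $n$ and $p>1$, in some (common) maximal subgroup of $S$ such that $\langle g_0,h_0\rangle$ is a dihedral group of order $2p$, $g^i\phi=g_0^{i+p}$ and $(hg^i)\phi=h_0g_0^{i+p}$ for $0\leqslant i\leqslant n-1$, and $I_{n-1}^S\phi=\{\emptyset\}$; 6.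 $S\in\{\mathcal{OR}_n,\mathcal{PORI}_n,\mathcal{POR}_n\}$ and there exist a group-element $h_0$ in $S$ of order $2$ and an idempotent $f$ of $S$ with rank less than or equal to $2$ such that $h_0f=fh_0=f$, $I_{n-1}^S\phi=\{f\}$ and: (a) $g^i\phi=h_0^2$ and $(hg^i)\phi=h_0$ for $0\leqslant i\leqslant n-1$; or (b) $n$ is even and $g^i\phi=(hg^i)\phi=h_0^{i+2}$ for $0\leqslant i\leqslant n-1$; or (c) $n$ is even and $g^i\phi=h_0^{i+2}$ and $(hg^i)\phi=h_0^{i+1}$ for $0\leqslant i\leqslant n-1$; 7. $\phi$ is a constant mapping with idempotent value.
   Context: Maps are written on the right of their arguments and composed from left to right. Let $\Omega_n=\{1<2<\cdots<n\}$; $\mathcal{PT}_n$, $\mathcal{T}_n$, $\mathcal{I}_n$ and $\mathcal{S}_n$ denote, respectively, the monoid of all partial transformations, of all full transformations, of all partial permutations (injective partial maps), and the symmetric group, on $\Omega_n$. The empty map is $\emptyset$. The rank of $\alpha\in\mathcal{PT}_n$ is $|\mathrm{Im}(\alpha)|$. A sequence $(a_1,\ldots,a_t)$ ($t\geqslant0$) in $\Omega_n$ is cyclic [anti-cyclic] if there is at most one index $i\in\{1,\ldots,t\}$ with $a_i>a_{i+1}$ [$a_i<a_{i+1}$], where $a_{t+1}=a_1$. For $\alpha\in\mathcal{PT}_n$ with domain $\{a_1<\cdots<a_t\}$, $\alpha$ is orientation-preserving if $(a_1\alpha,\ldots,a_t\alpha)$ is cyclic, and oriented if this sequence is cyclic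 or anti-cyclic. $\mathcal{POP}_n$ [$\mathcal{POR}_n$] is the monoid of all orientation-preserving [oriented] elements of $\mathcal{PT}_n$; $\mathcal{OP}_n=\mathcal{POP}_n\cap\mathcal{T}_n$, $\mathcal{OR}_n=\mathcal{POR}_n\cap\mathcal{T}_n$, $\mathcal{POPI}_n=\mathcal{POP}_n\cap\mathcal{I}_n$, $\mathcal{PORI}_n=\mathcal{POR}_n\cap\mathcal{I}_n$. Let $g\in\mathcal{S}_n$ be the $n$-cycle $i\mapsto i+1$ ($1\leqslant i\leqslant n-1$), $n\mapsto 1$, and $h\in\mathcal{S}_n$ the permutation $i\mapsto n+1-i$. Then $\mathcal{D}_{2n}=\langle g,h\rangle=\{g^i,hg^i\mid 0\leqslant i\leqslant n-1\}$ is the dihedral group of order $2n$ and $\mathcal{C}_n=\langle g\rangle$. For a submonoid $S$ of $\mathcal{PT}_n$: $J_k^S=\{s\in S\mid \mathrm{rank}(s)=k\}$, $I_k^S=\{s\in S\mid \mathrm{rank}(s)\leqslant k\}$. Thus $J_n^S$ is the group of units of $S$; it equals $\mathcal{C}_n$ for $S\in\{\mathcal{OP}_n,\mathcal{POPI}_n,\mathcal{POP}_n\}$ and $\mathcal{D}_{2n}$ for $S\in\{\mathcal{OR}_n,\mathcal{PORI}_n,\mathcal{POR}_n\}$. A group-element of $S$ is an element lying in some subgroup of $S$; its order is its order in the maximal subgroup containing it. A dihedral group of order $4$ means a Klein four-group. For $\sigma\in\mathcal{S}_n$ with $\sigma^{-1}S\sigma\subseteq S$, $\phi_S^\sigma:S\to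 S$ is $s\mapsto\sigma^{-1}s\sigma$. Define $\phi_0:\mathcal{PT}_n\to\mathcal{PT}_n$ by: $s\phi_0=s$ if $s\in\mathcal{S}_n$; if $s$ is injective of rank $n-1$ with domain $\Omega_n\setminus\{i\}$ and image $\Omega_n\setminus\{j\}$, then $s\phi_0$ is the map with domain $\{i\}$ sending $i\mapsto j$; if $s$ is a full transformation of rank $n-1$ with image $\Omega_n\setminus\{k\}$ and unique non-singleton kernel class $\{i,j\}$ ($i\neq j$, $is=js$), then $s\phi_0$ is the map with domain $\{i,j\}$ sending $i,j\mapsto k$; and $s\phi_0=\emptyset$ if $\mathrm{rank}(s)\leqslant n-2$. For a natural number $m$, let $\overline{m}\in\Omega_n$ be such that $\overline{m}\equiv m \pmod n$. For $x,k\in\Omega_n$ with $\gcd(k,n)=1$, let $\sigma_{x,k}\in\mathcal{S}_n$ be $i\sigma_{x,k}=\overline{x+(i-1)k}$, and $\mathcal{N}_n=\{\sigma_{x,k}\mid x,k\in\Omega_n,\ \gcd(k,n)=1\}$. For $S\in\{\mathcal{POPI}_n,\mathcal{POP}_n,\mathcal{PORI}_n,\mathcal{POR}_n\}$ and $\sigma\in\mathcal{N}_n$ (which normalizes $J_n^S$ in $\mathcal{S}_n$), $\phi^S_\sigma:S\to S$ is the mapping $s\mapsto\sigma^{-1}(s\phi_0)\sigma$. *)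

theory Defs
  imports "HOL-Algebra.Algebra" "HOL-Algebra.Bij"
begin

text \<open>
  A partial transformation of \<open>{1..n}\<close> is a map \<open>nat \<rightharpoonup> nat\<close> whose domain and range lie in
  \<open>{1..n}\<close>.  Maps act on the right, so the product of \<open>\<alpha>\<close> and \<open>\<beta>\<close> is \<open>\<alpha>\<close> followed by \<open>\<beta>\<close>,
  that is \<open>\<beta> \<circ>\<^sub>m \<alpha>\<close>.
\<close>

type_synonym pmap = "nat \<rightharpoonup> nat"

definition \<Omega> :: "nat \<Rightarrow> nat set" where
  "\<Omega> n = {1..n}"

definition PT :: "nat \<Rightarrow> pmap set" where
  "PT n = {\<alpha>. dom \<alpha> \<subseteq> \<Omega> n \<and> ran \<alpha> \<subseteq> \<Omega> n}"

definition FT :: "nat \<Rightarrow> pmap set" where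
  "FT n = {\<alpha> \<in> PT n. dom \<alpha> = \<Omega> n}"

definition PI :: "nat \<Rightarrow> pmap set" where
  "PI n = {\<alpha> \<in> PT n. inj_on \<alpha> (dom \<alpha>)}"

definition Sym :: "nat \<Rightarrow> pmap set" where
  "Sym n = FT n \<inter> PI n"

definition rank :: "pmap \<Rightarrow> nat" where
  "rank \<alpha> = card (ran \<alpha>)"

definition full_map :: "nat \<Rightarrow> (nat \<Rightarrow> nat) \<Rightarrow> pmap" where
  "full_map n f = (\<lambda>i. if i \<in> \<Omega> n then Some (f i) else None)"

text \<open>
  The identity is a parameter because a subgroup of a semigroup of maps may have any idempotent as identity.
\<close>

definition comp_structure :: "pmap set \<Rightarrow> pmap \<Rightarrow> pmap monoid" where
  "comp_structure A e = \<lparr>carrier = A, monoid.mult = (\<lambda>\<alpha> \<beta>. \<beta> \<circ>\<^sub>m \<alpha>), one = e\<rparr>"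

definition Mon :: "nat \<Rightarrow> pmap set \<Rightarrow> pmap monoid" where
  "Mon n S = comp_structure S (full_map n (\<lambda>i. i))"

definition J_set :: "nat \<Rightarrow> pmap set \<Rightarrow> pmap set" where
  "J_set k S = {s \<in> S. rank s = k}"

definition I_set :: "nat \<Rightarrow> pmap set \<Rightarrow> pmap set" where
  "I_set k S = {s \<in> S. rank s \<le> k}"

definition idempotents :: "pmap set \<Rightarrow> pmap set" where
  "idempotents S = {e \<in> S. e \<circ>\<^sub>m e = e}"


text \<open>The successor of the last index of a sequence is its first index.\<close>

definition cyclic_seq :: "nat list \<Rightarrow> bool" where
  "cyclic_seq as \<longleftrightarrow>
     card {i. i < length as \<and> as ! i > as ! (Suc i mod length as)} \<le> 1"

definition anti_cyclic_seq :: "nat list \<Rightarrow> bool" where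
  "anti_cyclic_seq as \<longleftrightarrow>
     card {i. i < length as \<and> as ! i < as ! (Suc i mod length as)} \<le> 1"

definition image_seq :: "pmap \<Rightarrow> nat list" where
  "image_seq \<alpha> = map (\<lambda>a. the (\<alpha> a)) (sorted_list_of_set (dom \<alpha>))"

definition POP :: "nat \<Rightarrow> pmap set" where
  "POP n = {\<alpha> \<in> PT n. cyclic_seq (image_seq \<alpha>)}"

definition POR :: "nat \<Rightarrow> pmap set" where
  "POR n = {\<alpha> \<in> PT n. cyclic_seq (image_seq \<alpha>) \<or> anti_cyclic_seq (image_seq \<alpha>)}"

definition OP :: "nat \<Rightarrow> pmap set" where
  "OP n = POP n \<inter> FT n"

definition OR :: "nat \<Rightarrow> pmap set" where
  "OR n = POR n \<inter> FT n"

definition POPI :: "nat \<Rightarrow> pmap set" where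
  "POPI n = POP n \<inter> PI n"

definition PORI :: "nat \<Rightarrow> pmap set" where
  "PORI n = POR n \<inter> PI n"


definition gperm :: "nat \<Rightarrow> pmap" where
  "gperm n = full_map n (\<lambda>i. if i < n then i + 1 else 1)"

definition hperm :: "nat \<Rightarrow> pmap" where
  "hperm n = full_map n (\<lambda>i. n + 1 - i)"

definition Dih :: "nat \<Rightarrow> pmap set" where
  "Dih n = generate (Mon n (Sym n)) {gperm n, hperm n}"

text \<open>
  \<open>Dih n\<close> is the dihedral group of order \<open>2 * n\<close> only for \<open>n \<ge> 3\<close>; the dihedral group of order
  4 is the Klein four-group.  The predicate below says that \<open>G\<close> is dihedral of order \<open>2 * p\<close>.
\<close>

definition dihedral_of_order_2times :: "nat \<Rightarrow> pmap monoid \<Rightarrow> bool" where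
  "dihedral_of_order_2times p G \<longleftrightarrow>
     p = 2 \<and> G \<cong> integer_mod_group 2 \<times>\<times> integer_mod_group 2 \<or>
     p \<ge> 3 \<and> G \<cong> Mon p (Dih p)"


definition subgroup_of :: "pmap set \<Rightarrow> pmap set \<Rightarrow> pmap \<Rightarrow> bool" where
  "subgroup_of S G e \<longleftrightarrow> G \<subseteq> S \<and> group (comp_structure G e)"

definition maximal_subgroup_of :: "pmap set \<Rightarrow> pmap set \<Rightarrow> pmap \<Rightarrow> bool" where
  "maximal_subgroup_of S G e \<longleftrightarrow> subgroup_of S G e \<and>
     (\<forall>G' e'. subgroup_of S G' e' \<and> G \<subseteq> G' \<longrightarrow> G' = G)"

text \<open>The order of a group-element is its order in the maximal subgroup containing it.\<close>

definition group_element_of_order :: "pmap set \<Rightarrow> nat \<Rightarrow> pmap \<Rightarrow> bool" where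
  "group_element_of_order S p x \<longleftrightarrow>
     (\<exists>G e. maximal_subgroup_of S G e \<and> x \<in> G \<and> group.ord (comp_structure G e) x = p)"


text \<open>The map \<open>s \<mapsto> \<sigma>\<inverse> s \<sigma>\<close>, with \<open>\<sigma>\<inverse>\<close> taken in the symmetric group.\<close>

definition conj_by :: "nat \<Rightarrow> pmap \<Rightarrow> pmap \<Rightarrow> pmap" where
  "conj_by n \<sigma> s =
     inv\<^bsub>Mon n (Sym n)\<^esub> \<sigma> \<otimes>\<^bsub>Mon n (PT n)\<^esub> s \<otimes>\<^bsub>Mon n (PT n)\<^esub> \<sigma>"

text \<open>
  An element of rank \<open>n - 1\<close> is either injective with domain and image each missing one point,
  or full with image missing one point and exactly one non-singleton kernel class.
\<close>

definition phi0 :: "nat \<Rightarrow> pmap \<Rightarrow> pmap" where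
  "phi0 n s =
     (if s \<in> Sym n then s
      else if s \<in> PI n \<and> rank s = n - 1 then
        [(THE i. i \<in> \<Omega> n \<and> dom s = \<Omega> n - {i}) \<mapsto> (THE j. j \<in> \<Omega> n \<and> ran s = \<Omega> n - {j})]
      else if s \<in> FT n \<and> rank s = n - 1 then
        (\<lambda>i. if i \<in> \<Omega> n \<and> (\<exists>j \<in> \<Omega> n. j \<noteq> i \<and> s i = s j)
             then Some (THE k. k \<in> \<Omega> n \<and> ran s = \<Omega> n - {k}) else None)
      else Map.empty)"

definition residue :: "nat \<Rightarrow> nat \<Rightarrow> nat" where
  "residue n m = (THE r. r \<in> \<Omega> n \<and> r mod n = m mod n)"

definition sigma :: "nat \<Rightarrow> nat \<Rightarrow> nat \<Rightarrow> pmap" where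
  "sigma n x k = full_map n (\<lambda>i. residue n (x + (i - 1) * k))"

definition Nrm :: "nat \<Rightarrow> pmap set" where
  "Nrm n = {sigma n x k | x k. x \<in> \<Omega> n \<and> k \<in> \<Omega> n \<and> gcd k n = 1}"

end

theory Submission
  imports Defs
begin

text \<open>
  An element is orientation-preserving iff it is monotone from the order \<open>c < c + 1 < \<dots> < c - 1\<close>, for
  some cut \<open>c\<close>, to the usual one.  An orientation-preserving element of a subgroup with a fixed point
  is therefore idempotent, which rules out almost all common fixed points of images of units.

  If \<open>S\<close> consists of full maps, consider the images of the constant maps.  They either act as \<open>n\<close> distinct
  constant maps, and then \<open>\<phi>\<close> is a conjugation, or all coincide, and then \<open>\<phi>\<close> is constant on the non-units.
  If \<open>S\<close> contains the injective maps, let \<open>r < n\<close> be the least rank on which \<open>\<phi>\<close> differs from \<open>\<emptyset>\<phi>\<close>.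
  The partial identities of rank \<open>r\<close> are mapped to idempotents with products \<open>\<emptyset>\<phi>\<close>, whose images
  therefore are disjoint outside the image of \<open>\<emptyset>\<phi>\<close>; as there are \<open>n choose r\<close> of them,
  \<open>r\<close> is \<open>1\<close> (conjugation) or \<open>n - 1\<close> (\<open>\<phi>\<^sub>0\<close> followed by conjugation).  The conjugating permutation
  lies in the normalizer of the cycle \<open>g\<close>, and in the conjugation case even in the dihedral group,
  because an oriented map that moves a single point moves it to an adjacent one.
  What remains are endomorphisms constant on the non-units, which amount to homomorphic images of a
  cyclic or dihedral group of units.
\<close>

text \<open>Why a fixed point is so restrictive: a group element permutes its own image, and cutting
  the circle at the fixed point makes this permutation monotone on a finite chain, hence trivial.
  This decides the endomorphisms with a single value f on all non-units. Since f
  \<open>\<phi> s\<close> = f, each \<open>\<phi> s\<close> fixes the image of f pointwise. If f is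
  not empty, a unit whose image preserves orientation has a trivial image; as two reversing maps
  multiply to a preserving one, the units have at most two images. If f has rank 3 or more, three
  fixed points already force orientation to be preserved, and one image is left. Larger images of
  the unit group thus occur only with f empty, which is impossible among full maps. The count of
  idempotents is tight: n points must hold n choose r disjoint nonempty sets and the image of
  \<open>\<emptyset>\<phi>\<close>. Equality gives at once the two ranks,
  \<open>\<emptyset>\<phi> = \<emptyset>\<close> and a bijection from sets to points, which yields
  the conjugating permutation. Conjugation after \<open>\<phi>\<^sub>0\<close> need not be dihedral:
  non-units go to rank at most 1, where adjacency leaves no trace.\<close>

abbreviation pmult :: "pmap \<Rightarrow> pmap \<Rightarrow> pmap" (infixl "\<Zsemi>" 70) where
  "\<alpha> \<Zsemi> \<beta> \<equiv> \<beta> \<circ>\<^sub>m \<alpha>"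

abbreviation pid :: "nat \<Rightarrow> pmap" where
  "pid n \<equiv> full_map n (\<lambda>i. i)"

section \<open>Composition of partial maps acting on the right, injectivity and rank\<close>

lemma pmult_assoc: "\<alpha> \<Zsemi> \<beta> \<Zsemi> \<gamma> = \<alpha> \<Zsemi> (\<beta> \<Zsemi> \<gamma>)"
  by (rule ext) (auto simp: map_comp_def split: option.splits)

lemma PT_iff: "\<alpha> \<in> PT n \<longleftrightarrow> (\<forall>i j. \<alpha> i = Some j \<longrightarrow> i \<in> \<Omega> n \<and> j \<in> \<Omega> n)"
  unfolding PT_def dom_def ran_def by auto

lemma PT_D: "\<alpha> \<in> PT n \<Longrightarrow> \<alpha> i = Some j \<Longrightarrow> i \<in> \<Omega> n \<and> j \<in> \<Omega> n"
  by (simp add: PT_iff)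

lemma PT_mult: "\<alpha> \<in> PT n \<Longrightarrow> \<beta> \<in> PT n \<Longrightarrow> \<alpha> \<Zsemi> \<beta> \<in> PT n"
  unfolding PT_iff map_comp_Some_iff by blast

lemma full_map_simps [simp]:
  "i \<in> \<Omega> n \<Longrightarrow> full_map n f i = Some (f i)"
  "i \<notin> \<Omega> n \<Longrightarrow> full_map n f i = None"
  by (simp_all add: full_map_def)

lemma full_map_Some_iff: "full_map n f i = Some j \<longleftrightarrow> i \<in> \<Omega> n \<and> j = f i"
  by (auto simp: full_map_def)

lemma full_map_FT: "f \<in> \<Omega> n \<rightarrow> \<Omega> n \<Longrightarrow> full_map n f \<in> FT n"
  by (auto simp: FT_def PT_iff full_map_Some_iff)

lemma full_map_mult:
  "f \<in> \<Omega> n \<rightarrow> \<Omega> n \<Longrightarrow> full_map n f \<Zsemi> full_map n g = full_map n (\<lambda>i. g (f i))"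
  by (rule ext) (auto simp: full_map_def map_comp_def)

lemma full_map_cong: "(\<And>i. i \<in> \<Omega> n \<Longrightarrow> f i = g i) \<Longrightarrow> full_map n f = full_map n g"
  by (auto simp: full_map_def)

lemma pid_left [simp]: "\<alpha> \<in> PT n \<Longrightarrow> pid n \<Zsemi> \<alpha> = \<alpha>"
proof (rule ext)
  fix i assume "\<alpha> \<in> PT n" then show "(pid n \<Zsemi> \<alpha>) i = \<alpha> i"
    by (cases "\<alpha> i"; cases "i \<in> \<Omega> n") (auto simp: map_comp_def dest: PT_D)
qed

lemma pid_right [simp]: "\<alpha> \<in> PT n \<Longrightarrow> \<alpha> \<Zsemi> pid n = \<alpha>"
proof (rule ext)
  fix i assume "\<alpha> \<in> PT n" then show "(\<alpha> \<Zsemi> pid n) i = \<alpha> i"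
    by (cases "\<alpha> i") (auto simp: map_comp_def dest: PT_D)
qed

lemma FT_D: "\<alpha> \<in> FT n \<Longrightarrow> i \<in> \<Omega> n \<Longrightarrow> \<exists>j \<in> \<Omega> n. \<alpha> i = Some j"
  unfolding FT_def PT_iff dom_def by blast

lemma FT_PT: "\<alpha> \<in> FT n \<Longrightarrow> \<alpha> \<in> PT n"
  by (simp add: FT_def)

lemma FT_I: "\<alpha> \<in> PT n \<Longrightarrow> (\<And>i. i \<in> \<Omega> n \<Longrightarrow> \<exists>j. \<alpha> i = Some j) \<Longrightarrow> \<alpha> \<in> FT n"
  unfolding FT_def PT_def dom_def by blast

lemma FT_mult:
  assumes "\<alpha> \<in> FT n" "\<beta> \<in> FT n" shows "\<alpha> \<Zsemi> \<beta> \<in> FT n"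
proof (rule FT_I)
  show "\<alpha> \<Zsemi> \<beta> \<in> PT n" using assms by (intro PT_mult FT_PT)
next
  fix i assume "i \<in> \<Omega> n"
  then obtain j where j: "j \<in> \<Omega> n" "\<alpha> i = Some j" using FT_D[OF assms(1)] by blast
  then obtain k where "\<beta> j = Some k" using FT_D[OF assms(2)] by blast
  with j show "\<exists>k. (\<alpha> \<Zsemi> \<beta>) i = Some k" by simp
qed

lemma PI_PT: "\<alpha> \<in> PI n \<Longrightarrow> \<alpha> \<in> PT n"
  by (simp add: PI_def)

lemma PI_iff: "\<alpha> \<in> PI n \<longleftrightarrow> \<alpha> \<in> PT n \<and> (\<forall>i i' j. \<alpha> i = Some j \<longrightarrow> \<alpha> i' = Some j \<longrightarrow> i = i')"
  unfolding PI_def inj_on_def dom_def by fastforce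

lemma PI_mult: "\<alpha> \<in> PI n \<Longrightarrow> \<beta> \<in> PI n \<Longrightarrow> \<alpha> \<Zsemi> \<beta> \<in> PI n"
  unfolding PI_iff using PT_mult by (auto simp: map_comp_Some_iff)

lemma finite_PT: "finite (PT n)"
proof -
  have "PT n = {\<alpha>. dom \<alpha> \<subseteq> \<Omega> n \<and> ran \<alpha> \<subseteq> \<Omega> n}" by (simp add: PT_def)
  also have "\<dots> \<subseteq> (\<Union>A \<in> Pow (\<Omega> n). {\<alpha>. dom \<alpha> = A \<and> ran \<alpha> \<subseteq> \<Omega> n})" by auto
  finally show ?thesis
    by (rule finite_subset) (auto intro!: finite_UN_I finite_set_of_finite_maps simp: \<Omega>_def finite_subset)
qed

lemma finite_Omega [simp]: "finite (\<Omega> n)" and card_Omega [simp]: "card (\<Omega> n) = n"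
  by (simp_all add: \<Omega>_def)

lemma finite_ran: "\<alpha> \<in> PT n \<Longrightarrow> finite (ran \<alpha>)"
  unfolding PT_def by (auto intro: finite_subset[OF _ finite_Omega])

lemma ran_mult: "ran (\<alpha> \<Zsemi> \<beta>) \<subseteq> ran \<beta>"
  by (auto simp: ran_def map_comp_Some_iff)

lemma rank_mult_le2: "\<beta> \<in> PT n \<Longrightarrow> rank (\<alpha> \<Zsemi> \<beta>) \<le> rank \<beta>"
  unfolding rank_def by (intro card_mono finite_ran ran_mult)

lemma rank_mult_le1: 
  assumes "\<alpha> \<in> PT n" shows "rank (\<alpha> \<Zsemi> \<beta>) \<le> rank \<alpha>"
proof -
  have "ran (\<alpha> \<Zsemi> \<beta>) \<subseteq> (\<lambda>j. the (\<beta> j)) ` ran \<alpha>"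
  proof
    fix k assume "k \<in> ran (\<alpha> \<Zsemi> \<beta>)"
    then obtain i where "(\<alpha> \<Zsemi> \<beta>) i = Some k" by (auto simp: ran_def)
    then obtain j where "\<alpha> i = Some j" "\<beta> j = Some k" unfolding map_comp_Some_iff by blast
    then show "k \<in> (\<lambda>j. the (\<beta> j)) ` ran \<alpha>" by (intro image_eqI[of _ _ j]) (auto simp: ran_def)
  qed
  then have "card (ran (\<alpha> \<Zsemi> \<beta>)) \<le> card ((\<lambda>j. the (\<beta> j)) ` ran \<alpha>)"
    by (intro card_mono) (auto simp: finite_ran[OF assms])
  also have "\<dots> \<le> card (ran \<alpha>)" by (intro card_image_le finite_ran[OF assms])
  finally show ?thesis by (simp add: rank_def)
qed

lemma rank_le: "\<alpha> \<in> PT n \<Longrightarrow> rank \<alpha> \<le> n"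
  unfolding rank_def PT_def by (metis (no_types, lifting) card_Omega card_mono finite_Omega mem_Collect_eq)

lemma rank_full_iff:
  assumes "\<alpha> \<in> PT n"
  shows "rank \<alpha> = n \<longleftrightarrow> \<alpha> \<in> Sym n"
proof -
  have ran: "ran \<alpha> \<subseteq> \<Omega> n" and dom: "dom \<alpha> \<subseteq> \<Omega> n" using assms by (auto simp: PT_def)
  have im: "ran \<alpha> = (\<lambda>i. the (\<alpha> i)) ` dom \<alpha>" by (force simp: ran_def dom_def)
  have fin: "finite (dom \<alpha>)" using dom finite_subset finite_Omega by blast
  have inj: "inj_on (\<lambda>i. the (\<alpha> i)) (dom \<alpha>) = inj_on \<alpha> (dom \<alpha>)"
    by (auto simp: inj_on_def dom_def)
  show ?thesis
  proof
    assume r: "rank \<alpha> = n"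
    then have "ran \<alpha> = \<Omega> n" using ran by (metis card_Omega card_subset_eq finite_Omega rank_def)
    have "n \<le> card (dom \<alpha>)" using r im card_image_le[OF fin] by (metis rank_def)
    then have d: "dom \<alpha> = \<Omega> n" using dom by (metis card_Omega card_mono card_subset_eq finite_Omega le_antisym)
    then have "inj_on (\<lambda>i. the (\<alpha> i)) (dom \<alpha>)" using r im by (simp add: eq_card_imp_inj_on rank_def)
    with d inj assms show "\<alpha> \<in> Sym n" by (simp add: Sym_def FT_def PI_def)
  next
    assume "\<alpha> \<in> Sym n"
    then have "dom \<alpha> = \<Omega> n" "inj_on \<alpha> (dom \<alpha>)" by (auto simp: Sym_def FT_def PI_def)
    then show "rank \<alpha> = n" using inj im by (simp add: rank_def card_image)
  qed
qed

section \<open>Maps that are monotone up to cuts of the circle\<close>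

text \<open>\<open>cut_key n c\<close> orders \<open>{1..n}\<close> as \<open>c, c + 1, \<dots>, n, 1, \<dots>, c - 1\<close>; the cut \<open>c = 0\<close> gives the usual order.\<close>

definition cut_key :: "nat \<Rightarrow> nat \<Rightarrow> nat \<Rightarrow> nat" where
  "cut_key n c x = (if x < c then x + n else x)"

definition cut_mono :: "nat \<Rightarrow> nat \<Rightarrow> nat \<Rightarrow> pmap \<Rightarrow> bool" where
  "cut_mono n c d \<alpha> \<longleftrightarrow> (\<forall>x y u v. \<alpha> x = Some u \<longrightarrow> \<alpha> y = Some v \<longrightarrow>
     cut_key n c x \<le> cut_key n c y \<longrightarrow> cut_key n d u \<le> cut_key n d v)"

lemma cut_monoD: "cut_mono n c d \<alpha> \<Longrightarrow> \<alpha> x = Some u \<Longrightarrow> \<alpha> y = Some v \<Longrightarrow>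
     cut_key n c x \<le> cut_key n c y \<Longrightarrow> cut_key n d u \<le> cut_key n d v"
  unfolding cut_mono_def by blast

lemma cut_key_0 [simp]: "cut_key n 0 x = x"
  by (simp add: cut_key_def)

lemma cut_key_inj: "x \<in> \<Omega> n \<Longrightarrow> y \<in> \<Omega> n \<Longrightarrow> cut_key n c x = cut_key n c y \<longleftrightarrow> x = y"
  by (auto simp: cut_key_def \<Omega>_def)

text \<open>The middle cut has to be the same in both factors. This is why the property records a
  cut on each side, and why \<open>cut_mono_recut\<close> must be able to move the target
  cut.\<close>

lemma cut_mono_mult: "cut_mono n c d \<alpha> \<Longrightarrow> cut_mono n d e \<beta> \<Longrightarrow> cut_mono n c e (\<alpha> \<Zsemi> \<beta>)"
  unfolding cut_mono_def map_comp_Some_iff by blast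

text \<open>Cutting the values at \<open>d'\<close> instead of \<open>d\<close> moves a final block
  of them to the front. The points with values in that block form a final segment of the order cut
  at \<open>c\<close>, so cutting the domain at the first of these points moves them to the front as
  well.\<close>

lemma cut_mono_recut_pos:
  assumes "\<alpha> \<in> PT n" "cut_mono n c d \<alpha>" "1 \<le> d'" "d' \<le> n + 1"
  shows "\<exists>c'. cut_mono n c' d' \<alpha>"
proof -
  \<comment> \<open>This is \<open>cut_key n d d'\<close>: the values with key at least
    \<open>T\<close> precede all others in the order cut at \<open>d'\<close>.\<close>
  define T where "T = (if d' < d then d' + n else d')"
  define Lt where "Lt = {x. \<exists>u. \<alpha> x = Some u \<and> T \<le> cut_key n d u}"
  have late: "cut_key n d' u \<le> cut_key n d' v \<longleftrightarrow> cut_key n d u \<le> cut_key n d v"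
    if "u \<in> \<Omega> n" "v \<in> \<Omega> n" "T \<le> cut_key n d u \<longleftrightarrow> T \<le> cut_key n d v" for u v
    using that assms(3,4) by (auto simp: T_def cut_key_def \<Omega>_def split: if_splits)
  have early: "cut_key n d' u \<le> cut_key n d' v"
    if "u \<in> \<Omega> n" "v \<in> \<Omega> n" "T \<le> cut_key n d u" "cut_key n d v < T" for u v
    using that assms(3,4) unfolding T_def cut_key_def \<Omega>_def atLeastAtMost_iff
    by (cases "d' < d"; cases "u < d"; cases "v < d"; cases "u < d'"; cases "v < d'"; simp)
  show ?thesis
  proof (cases "Lt = {}")
    case True
    have "cut_mono n c d' \<alpha>"
      unfolding cut_mono_def
    proof (intro allI impI)
      fix x y u v
      assume a: "\<alpha> x = Some u" "\<alpha> y = Some v" "cut_key n c x \<le> cut_key n c y"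
      have "\<not> T \<le> cut_key n d u" "\<not> T \<le> cut_key n d v" using True a unfolding Lt_def by auto
      then show "cut_key n d' u \<le> cut_key n d' v"
        using late[of u v] PT_D[OF assms(1)] a cut_monoD[OF assms(2) a] by blast
    qed
    then show ?thesis by blast
  next
    case False
    then obtain x0 where x0: "x0 \<in> Lt" "\<And>y. y \<in> Lt \<Longrightarrow> cut_key n c x0 \<le> cut_key n c y"
      using ex_has_least_nat[of "\<lambda>x. x \<in> Lt" _ "cut_key n c"] by blast
    have Lt_iff: "x \<in> Lt \<longleftrightarrow> cut_key n c x0 \<le> cut_key n c x" if "\<alpha> x = Some u" for x u
    proof
      assume "cut_key n c x0 \<le> cut_key n c x"
      moreover obtain u0 where "\<alpha> x0 = Some u0" "T \<le> cut_key n d u0" using x0 by (auto simp: Lt_def)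
      ultimately show "x \<in> Lt" using that cut_monoD[OF assms(2), of x0 u0 x u] unfolding Lt_def by auto
    qed (use x0 in blast)
    have x0n: "x0 \<in> \<Omega> n" using x0(1) PT_D[OF assms(1)] unfolding Lt_def by blast
    have "cut_mono n x0 d' \<alpha>"
      unfolding cut_mono_def
    proof (intro allI impI)
      fix x y u v
      assume a: "\<alpha> x = Some u" "\<alpha> y = Some v" and le: "cut_key n x0 x \<le> cut_key n x0 y"
      have xy: "x \<in> \<Omega> n" "y \<in> \<Omega> n" "u \<in> \<Omega> n" "v \<in> \<Omega> n" using a PT_D[OF assms(1)] by blast+
      have Xx: "x \<in> Lt \<longleftrightarrow> T \<le> cut_key n d u" "y \<in> Lt \<longleftrightarrow> T \<le> cut_key n d v" using a by (auto simp: Lt_def)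
      have nrev: "\<not> (x \<notin> Lt \<and> y \<in> Lt)"
        unfolding Lt_iff[OF a(1)] Lt_iff[OF a(2)] using le xy x0n by (auto simp: cut_key_def \<Omega>_def split: if_splits)
      have same: "cut_key n c x \<le> cut_key n c y" if "x \<in> Lt \<longleftrightarrow> y \<in> Lt"
        using that le xy x0n unfolding Lt_iff[OF a(1)] Lt_iff[OF a(2)] by (auto simp: cut_key_def \<Omega>_def split: if_splits)
      show "cut_key n d' u \<le> cut_key n d' v"
      proof (cases "x \<in> Lt \<longleftrightarrow> y \<in> Lt")
        case True
        then show ?thesis using late[of u v] xy Xx cut_monoD[OF assms(2) a] same by blast
      next
        case False
        then show ?thesis using early[of u v] xy Xx nrev by auto
      qed
    qed
    then show ?thesis by blast
  qed
qed

lemma cut_mono_recut: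
  assumes "\<alpha> \<in> PT n" "cut_mono n c d \<alpha>"
  shows "\<exists>c'. cut_mono n c' d' \<alpha>"
proof -
  \<comment> \<open>On {1..n} the cuts 0 and 1 give the same order, and so do all cuts from n + 1
    on.\<close>
  define d2 where "d2 = (if d' = 0 then 1 else min d' (n + 1))"
  obtain c' where c': "cut_mono n c' d2 \<alpha>"
    using cut_mono_recut_pos[OF assms, of d2] unfolding d2_def by fastforce
  have "cut_key n d2 u \<le> cut_key n d2 v \<longleftrightarrow> cut_key n d' u \<le> cut_key n d' v"
    if "u \<in> \<Omega> n" "v \<in> \<Omega> n" for u v
    using that by (auto simp: cut_key_def d2_def \<Omega>_def split: if_splits)
  then have "cut_mono n c' d' \<alpha>"
    using c' PT_D[OF assms(1)] unfolding cut_mono_def by blast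
  then show ?thesis by blast
qed

text \<open>A cyclic sequence has at most one descent, counted around the circle; cutting the domain
  right after it leaves a non-decreasing sequence. Conversely, with a cut given, a descent can only
  occur across the cut, and two descents would need two cuts.\<close>

lemma cyclic_seq_map_iff:
  assumes "sorted_wrt (<) xs" "set xs \<subseteq> \<Omega> n"
  shows "cyclic_seq (map f xs) \<longleftrightarrow>
    (\<exists>c. \<forall>x \<in> set xs. \<forall>y \<in> set xs. cut_key n c x \<le> cut_key n c y \<longrightarrow> f x \<le> f y)"
proof -
  define t where "t = length xs"
  define D where "D = {i. i < t \<and> f (xs ! i) > f (xs ! (Suc i mod t))}"
  have cyc: "cyclic_seq (map f xs) \<longleftrightarrow> (\<forall>i \<in> D. \<forall>j \<in> D. i = j)"
  proof -
    have "{i. i < length (map f xs) \<and> map f xs ! i > map f xs ! (Suc i mod length (map f xs))} = D"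
      by (auto simp: D_def t_def, (metis gr_implies_not0 mod_less_divisor neq0_conv nth_map)+)
    moreover have "finite D" by (simp add: D_def)
    ultimately show ?thesis unfolding cyclic_seq_def by (simp add: card_le_Suc0_iff_eq)
  qed
  have less: "xs ! i < xs ! j" if "i < j" "j < t" for i j
    using assms(1) that by (simp add: sorted_wrt_nth_less t_def)
  have le: "xs ! i \<le> xs ! j" if "i \<le> j" "j < t" for i j
    using less[of i j] that by (cases "i = j") auto
  have in_n: "1 \<le> xs ! i" "xs ! i \<le> n" if "i < t" for i
    using assms(2) that nth_mem[of i xs] unfolding t_def \<Omega>_def by (meson atLeastAtMost_iff subsetD)+
  show ?thesis
  proof
    assume "\<exists>c. \<forall>x \<in> set xs. \<forall>y \<in> set xs. cut_key n c x \<le> cut_key n c y \<longrightarrow> f x \<le> f y"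
    then obtain c where c: "\<And>i j. i < t \<Longrightarrow> j < t \<Longrightarrow> cut_key n c (xs ! i) \<le> cut_key n c (xs ! j) \<Longrightarrow> f (xs ! i) \<le> f (xs ! j)"
      unfolding t_def by (metis nth_mem)
    have A: "xs ! i < c \<and> c \<le> xs ! Suc i" if "i \<in> D" "Suc i < t" for i
    proof -
      have "\<not> cut_key n c (xs ! i) \<le> cut_key n c (xs ! Suc i)"
        using c[of i "Suc i"] that by (auto simp: D_def)
      then show ?thesis using that less[of i "Suc i"] in_n[of i] in_n[of "Suc i"]
        by (auto simp: cut_key_def split: if_splits)
    qed
    have B: "\<not> (c \<le> xs ! i \<and> xs ! 0 < c)" if "i \<in> D" "Suc i = t" for i
    proof
      assume "c \<le> xs ! i \<and> xs ! 0 < c"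
      then have "f (xs ! i) \<le> f (xs ! 0)" using that in_n[of i] in_n[of 0] 
        by (intro c) (auto simp: D_def cut_key_def)
      then show False using that by (simp add: D_def)
    qed
    have C: "False" if "i \<in> D" "j \<in> D" "i < j" for i j
    proof -
      have j: "j < t" using that by (simp add: D_def)
      then have a: "xs ! i < c" "c \<le> xs ! Suc i" using A[of i] that by auto
      show False
      proof (cases "Suc j = t")
        case True
        then show False using B[of j] that a le[of 0 i] le[of "Suc i" j] j by auto
      next
        case False
        then show False using A[of j] that a le[of "Suc i" j] j by auto
      qed
    qed
    show "cyclic_seq (map f xs)" unfolding cyc using C by (metis linorder_neqE_nat)
  next
    assume D1: "cyclic_seq (map f xs)"
    obtain i0 where i0: "D \<subseteq> {i0}" using D1 unfolding cyc by (metis subset_singleton_iff subsetI singletonI all_not_in_conv)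
    \<comment> \<open>If \<open>i0\<close> is not inside the list, the only possible descent is the
      step from the last entry back to the first, and the usual order (cut 0) is already
      right.\<close>
    define c where "c = (if Suc i0 < t then xs ! Suc i0 else 0)"
    have nondesc: "f (xs ! i) \<le> f (xs ! Suc i)" if "Suc i < t" "i \<noteq> i0" for i
    proof -
      have "i \<notin> D" using that i0 by blast
      then show ?thesis using that by (auto simp: D_def)
    qed
    have wrap: "f (xs ! (t - 1)) \<le> f (xs ! 0)" if "Suc i0 < t"
    proof -
      have "t - 1 \<notin> D" using that i0 by auto
      then show ?thesis using that by (auto simp: D_def)
    qed
    have chain: "f (xs ! i) \<le> f (xs ! j)" if "i \<le> j" "j < t" "j \<le> i0 \<or> i0 < i" for i j
      using that
    proof (induction j rule: dec_induct)
      case (step k)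
      have "f (xs ! k) \<le> f (xs ! Suc k)" by (rule nondesc) (use step in auto)
      with step show ?case by auto
    qed simp
    have "f (xs ! i) \<le> f (xs ! j)" if ij: "i < t" "j < t" and k: "cut_key n c (xs ! i) \<le> cut_key n c (xs ! j)" for i j
    proof (cases "Suc i0 < t")
      case False
      then have "xs ! i \<le> xs ! j" using k by (simp add: c_def)
      then have "i \<le> j" using less[of j i] ij by (meson leD leI)
      then show ?thesis using chain[of i j] ij False by simp
    next
      case True
      have lt: "xs ! m < c \<longleftrightarrow> m \<le> i0" if "m < t" for m
        using True that less[of m "Suc i0"] le[of "Suc i0" m] by (cases "m \<le> i0") (auto simp: c_def not_less_eq_eq leD)
      consider "i \<le> j" "j \<le> i0 \<or> i0 < i" | "i0 < i" "j \<le> i0"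
        using k ij lt[of i] lt[of j] less[of j i] in_n[of i] in_n[of j] unfolding cut_key_def
        by (cases "i \<le> i0"; cases "j \<le> i0"; cases "i \<le> j") auto
      then show ?thesis
      proof cases
        case 1
        then show ?thesis using chain ij by blast
      next
        case 2
        have "f (xs ! i) \<le> f (xs ! (t - 1))" using 2 ij by (intro chain) auto
        also have "\<dots> \<le> f (xs ! 0)" by (rule wrap[OF True])
        also have "\<dots> \<le> f (xs ! j)" using 2 ij by (intro chain) auto
        finally show ?thesis .
      qed
    qed
    then show "\<exists>c. \<forall>x \<in> set xs. \<forall>y \<in> set xs. cut_key n c x \<le> cut_key n c y \<longrightarrow> f x \<le> f y"
      unfolding t_def by (intro exI[of _ c]) (metis in_set_conv_nth)
  qed
qed

lemma finite_dom_PT: "\<alpha> \<in> PT n \<Longrightarrow> finite (dom \<alpha>)"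
  unfolding PT_def by (auto intro: finite_subset[OF _ finite_Omega])

lemma POP_iff: "\<alpha> \<in> POP n \<longleftrightarrow> \<alpha> \<in> PT n \<and> (\<exists>c. cut_mono n c 0 \<alpha>)"
proof (cases "\<alpha> \<in> PT n")
  case True
  let ?xs = "sorted_list_of_set (dom \<alpha>)"
  have fin: "finite (dom \<alpha>)" using True by (rule finite_dom_PT)
  have "cyclic_seq (image_seq \<alpha>) \<longleftrightarrow>
    (\<exists>c. \<forall>x \<in> dom \<alpha>. \<forall>y \<in> dom \<alpha>. cut_key n c x \<le> cut_key n c y \<longrightarrow> the (\<alpha> x) \<le> the (\<alpha> y))"
    unfolding image_seq_def using cyclic_seq_map_iff[of ?xs n] fin True
    by (simp add: PT_def)
  also have "\<dots> \<longleftrightarrow> (\<exists>c. cut_mono n c 0 \<alpha>)"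
    unfolding cut_mono_def by (intro arg_cong[where f=Ex] ext) (auto simp: dom_def, fastforce)
  finally show ?thesis using True by (simp add: POP_def)
qed (simp add: POP_def)

lemma POP_PT: "\<alpha> \<in> POP n \<Longrightarrow> \<alpha> \<in> PT n"
  by (simp add: POP_def)

lemma POP_cut: "\<alpha> \<in> POP n \<Longrightarrow> \<exists>c. cut_mono n c d \<alpha>"
  using POP_iff cut_mono_recut by blast

lemma POP_I: "\<alpha> \<in> PT n \<Longrightarrow> cut_mono n c d \<alpha> \<Longrightarrow> \<alpha> \<in> POP n"
  using POP_iff cut_mono_recut by blast

lemma POP_mult: "\<alpha> \<in> POP n \<Longrightarrow> \<beta> \<in> POP n \<Longrightarrow> \<alpha> \<Zsemi> \<beta> \<in> POP n"
  by (meson POP_I POP_PT POP_cut PT_mult cut_mono_mult)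

section \<open>The reversal h and oriented maps\<close>

lemma hperm_simps [simp]: "i \<in> \<Omega> n \<Longrightarrow> hperm n i = Some (n + 1 - i)" "i \<notin> \<Omega> n \<Longrightarrow> hperm n i = None"
  by (simp_all add: hperm_def)

lemma hperm_FT: "hperm n \<in> FT n"
  unfolding hperm_def by (rule full_map_FT) (auto simp: \<Omega>_def)

lemma hperm_PT: "hperm n \<in> PT n"
  by (rule FT_PT[OF hperm_FT])

lemma hperm_hperm [simp]: "hperm n \<Zsemi> hperm n = pid n"
proof -
  have "(\<lambda>i. n + 1 - i) \<in> \<Omega> n \<rightarrow> \<Omega> n" by (auto simp: \<Omega>_def)
  then show ?thesis unfolding hperm_def by (subst full_map_mult) (auto intro!: full_map_cong simp: \<Omega>_def)
qed

lemma hperm_Some_iff: "hperm n i = Some j \<longleftrightarrow> i \<in> \<Omega> n \<and> j \<in> \<Omega> n \<and> i + j = n + 1"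
  unfolding hperm_def full_map_Some_iff by (auto simp: \<Omega>_def)

text \<open>Following a map by the reversal exchanges the ascents and the descents of its value
  sequence. Questions on oriented maps are thereby reduced to orientation-preserving ones, where
  cuts are available.\<close>

lemma POR_iff: "\<alpha> \<in> POR n \<longleftrightarrow> \<alpha> \<in> PT n \<and> (\<alpha> \<in> POP n \<or> \<alpha> \<Zsemi> hperm n \<in> POP n)"
proof (cases "\<alpha> \<in> PT n")
  case True
  let ?xs = "sorted_list_of_set (dom \<alpha>)"
  have fin: "finite (dom \<alpha>)" using True by (rule finite_dom_PT)
  have dom: "dom (\<alpha> \<Zsemi> hperm n) = dom \<alpha>"
    using PT_D[OF True] by (auto simp: dom_def map_comp_Some_iff)
  have val: "the ((\<alpha> \<Zsemi> hperm n) x) = n + 1 - the (\<alpha> x)" "the (\<alpha> x) \<le> n" if "x \<in> dom \<alpha>" for x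
    using that PT_D[OF True] by (auto simp: \<Omega>_def)
  have img: "image_seq (\<alpha> \<Zsemi> hperm n) = map (\<lambda>a. n + 1 - the (\<alpha> a)) ?xs"
    unfolding image_seq_def dom using fin val by (auto intro!: map_cong)
  have "anti_cyclic_seq (image_seq \<alpha>) \<longleftrightarrow> cyclic_seq (image_seq (\<alpha> \<Zsemi> hperm n))"
  proof -
    have v: "the (\<alpha> (?xs ! i)) \<le> n" if "i < length ?xs" for i
      using val(2) nth_mem[OF that] fin by simp
    have rev: "the (\<alpha> (?xs ! i)) < the (\<alpha> (?xs ! j)) \<longleftrightarrow> n + 1 - the (\<alpha> (?xs ! j)) < n + 1 - the (\<alpha> (?xs ! i))"
      if "i < length ?xs" "j < length ?xs" for i j
      using v[OF that(1)] v[OF that(2)] by auto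
    have "i < length ?xs \<and> map (\<lambda>a. the (\<alpha> a)) ?xs ! i < map (\<lambda>a. the (\<alpha> a)) ?xs ! (Suc i mod length ?xs) \<longleftrightarrow>
      i < length ?xs \<and> map (\<lambda>a. n + 1 - the (\<alpha> a)) ?xs ! i > map (\<lambda>a. n + 1 - the (\<alpha> a)) ?xs ! (Suc i mod length ?xs)" for i
    proof (cases "i < length ?xs")
      case True
      then have "Suc i mod length ?xs < length ?xs" by (intro mod_less_divisor) simp
      with True show ?thesis using rev[of i "Suc i mod length ?xs"] by (simp del: length_sorted_list_of_set)
    qed simp
    then have "{i. i < length (image_seq \<alpha>) \<and> image_seq \<alpha> ! i < image_seq \<alpha> ! (Suc i mod length (image_seq \<alpha>))}
      = {i. i < length (image_seq (\<alpha> \<Zsemi> hperm n)) \<and> image_seq (\<alpha> \<Zsemi> hperm n) ! i > image_seq (\<alpha> \<Zsemi> hperm n) ! (Suc i mod length (image_seq (\<alpha> \<Zsemi> hperm n)))}"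
      unfolding img unfolding image_seq_def length_map by (rule Collect_cong)
    then show ?thesis unfolding cyclic_seq_def anti_cyclic_seq_def by simp
  qed
  then show ?thesis using True by (simp add: POR_def POP_def PT_mult hperm_PT)
qed (simp add: POR_def)

lemma hperm_conj_POP:
  assumes "\<alpha> \<in> POP n" shows "hperm n \<Zsemi> \<alpha> \<Zsemi> hperm n \<in> POP n"
proof -
  obtain c where c: "cut_mono n c 0 \<alpha>" and PT: "\<alpha> \<in> PT n" using assms POP_iff by blast
  \<comment> \<open>For a cut inside the range, the last point of the domain is c - 1, which the
    reversal sends to n + 2 - c; this becomes the first point.\<close>
  have "cut_mono n (n + 2 - c) 0 (hperm n \<Zsemi> \<alpha> \<Zsemi> hperm n)"
    unfolding cut_mono_def
  proof (intro allI impI)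
    fix x y u v
    assume a: "(hperm n \<Zsemi> \<alpha> \<Zsemi> hperm n) x = Some u" "(hperm n \<Zsemi> \<alpha> \<Zsemi> hperm n) y = Some v"
      and le: "cut_key n (n + 2 - c) x \<le> cut_key n (n + 2 - c) y"
    obtain x' u' where 1: "x \<in> \<Omega> n" "x' \<in> \<Omega> n" "x + x' = n + 1" "\<alpha> x' = Some u'" "u' \<in> \<Omega> n" "u \<in> \<Omega> n" "u' + u = n + 1"
      using a(1) unfolding map_comp_Some_iff hperm_Some_iff by blast
    obtain y' v' where 2: "y \<in> \<Omega> n" "y' \<in> \<Omega> n" "y + y' = n + 1" "\<alpha> y' = Some v'" "v' \<in> \<Omega> n" "v \<in> \<Omega> n" "v' + v = n + 1"
      using a(2) unfolding map_comp_Some_iff hperm_Some_iff by blast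
    have "cut_key n c y' \<le> cut_key n c x'"
      using le 1 2 by (auto simp: cut_key_def \<Omega>_def split: if_splits)
    from cut_monoD[OF c 2(4) 1(4) this] show "cut_key n 0 u \<le> cut_key n 0 v"
      using 1 2 by simp
  qed
  then show ?thesis by (rule POP_I[rotated]) (intro PT_mult hperm_PT PT)
qed

lemma POP_subset_POR: "POP n \<subseteq> POR n"
  using POR_iff POP_PT by blast

lemma POR_PT: "\<alpha> \<in> POR n \<Longrightarrow> \<alpha> \<in> PT n"
  by (simp add: POR_def)

lemma hperm_mult_POP_iff:
  assumes "\<alpha> \<in> PT n"
  shows "hperm n \<Zsemi> \<alpha> \<in> POP n \<longleftrightarrow> \<alpha> \<Zsemi> hperm n \<in> POP n"
proof -
  have "hperm n \<Zsemi> (hperm n \<Zsemi> \<alpha>) \<Zsemi> hperm n = \<alpha> \<Zsemi> hperm n"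
    by (metis assms hperm_hperm pid_left pmult_assoc)
  moreover have "hperm n \<Zsemi> (\<alpha> \<Zsemi> hperm n) \<Zsemi> hperm n = hperm n \<Zsemi> \<alpha>"
    by (metis assms hperm_hperm pid_right pmult_assoc PT_mult hperm_PT)
  ultimately show ?thesis by (metis hperm_conj_POP)
qed

lemma POR_rev_mult:
  assumes "\<alpha> \<in> PT n" "\<beta> \<in> PT n" "\<alpha> \<Zsemi> hperm n \<in> POP n" "\<beta> \<Zsemi> hperm n \<in> POP n"
  shows "\<alpha> \<Zsemi> \<beta> \<in> POP n"
proof -
  have "\<alpha> \<Zsemi> hperm n \<Zsemi> (hperm n \<Zsemi> \<beta>) = \<alpha> \<Zsemi> \<beta>"
    by (metis assms(1) hperm_hperm pid_right pmult_assoc)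
  then show ?thesis by (metis POP_mult assms(2-4) hperm_mult_POP_iff)
qed

lemma POR_mult:
  assumes "\<alpha> \<in> POR n" "\<beta> \<in> POR n" shows "\<alpha> \<Zsemi> \<beta> \<in> POR n"
proof -
  have PT: "\<alpha> \<in> PT n" "\<beta> \<in> PT n" "\<alpha> \<Zsemi> \<beta> \<in> PT n" using assms POR_PT PT_mult by blast+
  consider "\<alpha> \<in> POP n" "\<beta> \<in> POP n" | "\<alpha> \<in> POP n" "\<beta> \<Zsemi> hperm n \<in> POP n" 
    | "\<alpha> \<Zsemi> hperm n \<in> POP n" "\<beta> \<in> POP n" | "\<alpha> \<Zsemi> hperm n \<in> POP n" "\<beta> \<Zsemi> hperm n \<in> POP n"
    using assms POR_iff by blast
  then show ?thesis
  proof cases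
    case 1
    then show ?thesis using POP_mult POP_subset_POR by blast
  next
    case 2
    then have "\<alpha> \<Zsemi> (\<beta> \<Zsemi> hperm n) \<in> POP n" by (rule POP_mult)
    then show ?thesis using PT by (simp add: POR_iff pmult_assoc)
  next
    case 3
    then have "hperm n \<Zsemi> \<alpha> \<Zsemi> \<beta> \<in> POP n" using POP_mult hperm_mult_POP_iff PT by blast
    then show ?thesis using PT by (metis POR_iff hperm_mult_POP_iff pmult_assoc)
  next
    case 4
    then show ?thesis using POR_rev_mult PT POP_subset_POR by blast
  qed
qed

subsection \<open>Powers\<close>

text \<open>\<open>Some\<close> is a two-sided unit for all partial maps, so these powers do not depend on \<open>n\<close>.\<close>

primrec ppow :: "pmap \<Rightarrow> nat \<Rightarrow> pmap" where
  "ppow \<alpha> 0 = Some"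
| "ppow \<alpha> (Suc k) = ppow \<alpha> k \<Zsemi> \<alpha>"

lemma Some_mult [simp]: "Some \<Zsemi> \<alpha> = \<alpha>" "\<alpha> \<Zsemi> Some = \<alpha>"
  by (rule ext, simp add: map_comp_def split: option.split)+

lemma ppow_defined: "ppow \<alpha> k y = Some z \<Longrightarrow> j \<le> k \<Longrightarrow> \<exists>u. ppow \<alpha> j y = Some u"
proof (induction k arbitrary: z)
  case (Suc k)
  then obtain w where "ppow \<alpha> k y = Some w" by (auto simp: map_comp_Some_iff)
  with Suc show ?case by (cases "j = Suc k") auto
qed auto

lemma comp_structure_simps [simp]:
  "carrier (comp_structure A e) = A" "monoid.mult (comp_structure A e) \<alpha> \<beta> = \<alpha> \<Zsemi> \<beta>" "one (comp_structure A e) = e"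
  by (simp_all add: comp_structure_def)

lemma Mon_simps [simp]:
  "carrier (Mon n A) = A" "monoid.mult (Mon n A) \<alpha> \<beta> = \<alpha> \<Zsemi> \<beta>" "one (Mon n A) = pid n"
  by (simp_all add: Mon_def)

lemma comp_structure_pow:
  "comp_structure A e = G \<Longrightarrow> e \<Zsemi> \<alpha> = \<alpha> \<Longrightarrow> k > 0 \<Longrightarrow> \<alpha> [^]\<^bsub>G\<^esub> (k::nat) = ppow \<alpha> k"
proof (induction k)
  case (Suc k)
  then show ?case by (cases k) (auto simp: nat_pow_def)
qed simp

lemma Mon_pow: "\<alpha> \<in> PT n \<Longrightarrow> k > 0 \<Longrightarrow> \<alpha> [^]\<^bsub>Mon n A\<^esub> (k::nat) = ppow \<alpha> k"
  by (rule comp_structure_pow) (auto simp: Mon_def)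

subsection \<open>Partial identities and inverses\<close>

definition rid :: "nat set \<Rightarrow> pmap" where
  "rid A = (\<lambda>x. if x \<in> A then Some x else None)"

lemma rid_Some_iff [simp]: "rid A x = Some y \<longleftrightarrow> x \<in> A \<and> y = x"
  by (auto simp: rid_def)

lemma rid_mult: "rid A \<Zsemi> rid B = rid (A \<inter> B)"
  by (rule ext) (auto simp: rid_def map_comp_def)

lemma dom_rid [simp]: "dom (rid A) = A" and ran_rid [simp]: "ran (rid A) = A"
  by (auto simp: rid_def dom_def ran_def split: if_splits)

lemma rid_Omega: "rid (\<Omega> n) = pid n"
  by (simp add: rid_def full_map_def)

lemma rid_empty: "rid {} = Map.empty"
  by (simp add: rid_def)

lemma rank_rid [simp]: "rank (rid A) = card A"
  by (simp add: rank_def)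

lemma pmap_eqI: "(\<And>x y. \<alpha> x = Some y \<longleftrightarrow> \<beta> x = Some y) \<Longrightarrow> \<alpha> = (\<beta> :: pmap)"
  by (rule ext) (metis not_None_eq)

lemma rid_left: "dom \<alpha> \<subseteq> A \<Longrightarrow> rid A \<Zsemi> \<alpha> = \<alpha>"
  by (rule pmap_eqI) (auto simp: map_comp_Some_iff)

lemma rid_right: "ran \<alpha> \<subseteq> A \<Longrightarrow> \<alpha> \<Zsemi> rid A = \<alpha>"
  by (rule pmap_eqI) (auto simp: map_comp_Some_iff ran_def)

text \<open>The inverse in the symmetric inverse monoid. For a map that is not injective the
  definite description has no meaning, so all facts below assume membership in
  \<open>PI n\<close>.\<close>

definition pinv :: "pmap \<Rightarrow> pmap" where
  "pinv \<alpha> = (\<lambda>y. if \<exists>x. \<alpha> x = Some y then Some (THE x. \<alpha> x = Some y) else None)"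

lemma pinv_Some_iff:
  assumes "\<alpha> \<in> PI n"
  shows "pinv \<alpha> y = Some x \<longleftrightarrow> \<alpha> x = Some y"
proof -
  have "(THE x. \<alpha> x = Some y) = x" if "\<alpha> x = Some y" for x
    using that assms unfolding PI_iff by blast
  then show ?thesis by (auto simp: pinv_def)
qed

lemma pinv_PI: "\<alpha> \<in> PI n \<Longrightarrow> pinv \<alpha> \<in> PI n"
  unfolding PI_iff[of "pinv \<alpha>"] PT_iff pinv_Some_iff by (auto simp: PI_iff PT_iff)

lemma pinv_right: "\<alpha> \<in> PI n \<Longrightarrow> \<alpha> \<Zsemi> pinv \<alpha> = rid (dom \<alpha>)"
  by (rule pmap_eqI) (auto simp: map_comp_Some_iff pinv_Some_iff PI_iff)

lemma pinv_left: "\<alpha> \<in> PI n \<Longrightarrow> pinv \<alpha> \<Zsemi> \<alpha> = rid (ran \<alpha>)"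
  by (rule pmap_eqI) (auto simp: map_comp_Some_iff pinv_Some_iff PI_iff ran_def)

text \<open>A monotone injection between linear orders also reflects the order, so the two cuts just
  change places.\<close>

lemma POP_pinv:
  assumes "\<alpha> \<in> POP n" "\<alpha> \<in> PI n" shows "pinv \<alpha> \<in> POP n"
proof -
  obtain c where c: "cut_mono n c 0 \<alpha>" and PT: "\<alpha> \<in> PT n" using assms POP_iff by blast
  have "cut_mono n 0 c (pinv \<alpha>)"
    unfolding cut_mono_def pinv_Some_iff[OF assms(2)]
  proof (intro allI impI)
    fix x y u v assume a: "\<alpha> u = Some x" "\<alpha> v = Some y" "cut_key n 0 x \<le> cut_key n 0 y"
    show "cut_key n c u \<le> cut_key n c v"
    proof (rule ccontr)
      assume "\<not> ?thesis"
      then have "cut_key n c v \<le> cut_key n c u" by simp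
      from cut_monoD[OF c a(2,1) this] a have "x = y" by simp
      then have "u = v" using a assms(2) by (auto simp: PI_iff)
      with \<open>\<not> ?thesis\<close> show False by simp
    qed
  qed
  then show ?thesis using POP_I pinv_PI[OF assms(2)] PI_PT by blast
qed

lemma hperm_PI: "hperm n \<in> PI n"
  using hperm_PT by (auto simp: PI_iff hperm_Some_iff)

lemma POR_pinv:
  assumes "\<alpha> \<in> POR n" "\<alpha> \<in> PI n" shows "pinv \<alpha> \<in> POR n"
proof (cases "\<alpha> \<in> POP n")
  case True
  then show ?thesis using POP_pinv assms POP_subset_POR by blast
next
  case False
  then have "\<alpha> \<Zsemi> hperm n \<in> POP n" using assms POR_iff by blast
  moreover have PI: "\<alpha> \<Zsemi> hperm n \<in> PI n" using assms hperm_PI PI_mult by blast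
  ultimately have "pinv (\<alpha> \<Zsemi> hperm n) \<in> POP n" by (rule POP_pinv)
  moreover have "pinv (\<alpha> \<Zsemi> hperm n) = hperm n \<Zsemi> pinv \<alpha>"
    by (rule pmap_eqI) (auto simp: pinv_Some_iff[OF PI] pinv_Some_iff[OF assms(2)] map_comp_Some_iff hperm_Some_iff)
  ultimately show ?thesis using hperm_mult_POP_iff POR_iff pinv_PI[OF assms(2)] PI_PT by metis
qed

lemma rid_PI: "A \<subseteq> \<Omega> n \<Longrightarrow> rid A \<in> PI n"
  by (auto simp: PI_iff PT_iff)

lemma rid_POP: "A \<subseteq> \<Omega> n \<Longrightarrow> rid A \<in> POP n"
  by (rule POP_I[of _ _ 0 0]) (auto simp: cut_mono_def PT_iff)

lemma pid_POP: "pid n \<in> POP n"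
  using rid_POP[of "\<Omega> n" n] by (simp add: rid_Omega)

lemma Sym_dom: "\<alpha> \<in> Sym n \<Longrightarrow> dom \<alpha> = \<Omega> n"
  by (simp add: Sym_def FT_def)

lemma Sym_ran:
  assumes "\<alpha> \<in> Sym n" shows "ran \<alpha> = \<Omega> n"
proof (rule card_subset_eq[OF finite_Omega])
  have PT: "\<alpha> \<in> PT n" using assms by (simp add: Sym_def FT_def)
  then show "ran \<alpha> \<subseteq> \<Omega> n" by (simp add: PT_def)
  show "card (ran \<alpha>) = card (\<Omega> n)" using rank_full_iff[OF PT] assms by (simp add: rank_def)
qed

lemma Sym_PT: "\<alpha> \<in> Sym n \<Longrightarrow> \<alpha> \<in> PT n" and Sym_PI: "\<alpha> \<in> Sym n \<Longrightarrow> \<alpha> \<in> PI n"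
  and Sym_FT: "\<alpha> \<in> Sym n \<Longrightarrow> \<alpha> \<in> FT n"
  by (auto simp: Sym_def FT_def)

lemma Sym_mult: "\<alpha> \<in> Sym n \<Longrightarrow> \<beta> \<in> Sym n \<Longrightarrow> \<alpha> \<Zsemi> \<beta> \<in> Sym n"
  using FT_mult PI_mult by (auto simp: Sym_def)

lemma pinv_Sym:
  assumes "\<alpha> \<in> Sym n" shows "pinv \<alpha> \<in> Sym n"
proof -
  have "dom (pinv \<alpha>) = ran \<alpha>"
    by (auto simp: dom_def ran_def pinv_Some_iff[OF Sym_PI[OF assms]])
  then show ?thesis using pinv_PI[OF Sym_PI[OF assms]] Sym_ran[OF assms] PI_PT by (simp add: Sym_def FT_def)
qed

lemma pinv_Sym_right: "\<alpha> \<in> Sym n \<Longrightarrow> \<alpha> \<Zsemi> pinv \<alpha> = pid n"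
  using pinv_right Sym_PI Sym_dom rid_Omega by metis

lemma pinv_Sym_left: "\<alpha> \<in> Sym n \<Longrightarrow> pinv \<alpha> \<Zsemi> \<alpha> = pid n"
  using pinv_left Sym_PI Sym_ran rid_Omega by metis

lemma pid_Sym: "pid n \<in> Sym n"
  using rid_PI[of "\<Omega> n" n] full_map_FT[of "\<lambda>i. i" n] by (simp add: Sym_def rid_Omega)

lemma group_Sym: "group (Mon n (Sym n))"
proof (rule groupI)
  fix \<alpha> assume "\<alpha> \<in> carrier (Mon n (Sym n))"
  then show "\<exists>\<beta> \<in> carrier (Mon n (Sym n)). \<beta> \<otimes>\<^bsub>Mon n (Sym n)\<^esub> \<alpha> = \<one>\<^bsub>Mon n (Sym n)\<^esub>"
    using pinv_Sym[of \<alpha> n] pinv_Sym_left[of \<alpha> n] by auto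
qed (auto simp: Sym_mult pid_Sym pmult_assoc Sym_PT)

lemma inv_Sym: "\<alpha> \<in> Sym n \<Longrightarrow> inv\<^bsub>Mon n (Sym n)\<^esub> \<alpha> = pinv \<alpha>"
  by (rule group.inv_equality[OF group_Sym]) (simp_all add: pinv_Sym pinv_Sym_left)

lemma finite_Sym: "finite (Sym n)"
  using finite_subset[OF _ finite_PT[of n]] Sym_PT by blast

lemma Sym_pow:
  assumes "\<alpha> \<in> Sym n" shows "\<exists>k>0. ppow \<alpha> k = pid n"
proof -
  interpret group "Mon n (Sym n)" by (rule group_Sym)
  have "order (Mon n (Sym n)) > 0" using finite_Sym order_gt_0_iff_finite by simp
  moreover have "\<alpha> [^]\<^bsub>Mon n (Sym n)\<^esub> order (Mon n (Sym n)) = pid n"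
    using pow_order_eq_1[of \<alpha>] assms by simp
  ultimately show ?thesis using Mon_pow[OF Sym_PT[OF assms]] by metis
qed

subsection \<open>Orientation-preserving group elements with a fixed point\<close>

text \<open>The hypothesis on \<open>ppow\<close> makes \<open>\<alpha>\<close> permute its image,
  with k-th power the identity there. Once both orders are cut at the fixed point, this is a
  monotone permutation of a finite chain, so every image point is fixed.\<close>

lemma POP_fixpoint_idempotent:
  assumes POP: "\<alpha> \<in> POP n" and fix_a: "\<alpha> a = Some a" and per: "\<alpha> \<Zsemi> ppow \<alpha> k = \<alpha>" and k: "k > 0"
  shows "\<alpha> \<Zsemi> \<alpha> = \<alpha>"
proof -
  have PT: "\<alpha> \<in> PT n" using POP by (rule POP_PT)
  obtain c where c: "cut_mono n c a \<alpha>" using POP_cut POP by blast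
  define Y where "Y = ran \<alpha>"
  have Yn: "y \<in> \<Omega> n" if "y \<in> Y" for y using that PT_D[OF PT] by (auto simp: Y_def ran_def)
  have per_Y: "ppow \<alpha> k y = Some y" if "y \<in> Y" for y
  proof -
    from that have "\<exists>x. \<alpha> x = Some y" by (simp add: Y_def ran_def)
    then obtain x where x: "\<alpha> x = Some y" by blast
    then have "(\<alpha> \<Zsemi> ppow \<alpha> k) x = Some y" using per by simp
    with x show ?thesis by (simp add: map_comp_Some_iff)
  qed
  have tot: "\<exists>u \<in> Y. \<alpha> y = Some u" if "y \<in> Y" for y
    using ppow_defined[OF per_Y[OF that], of "Suc 0"] k by (auto simp: Y_def ran_def)
  define f where "f y = the (\<alpha> y)" for y
  have f: "\<alpha> y = Some (f y)" "f y \<in> Y" if "y \<in> Y" for y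
    using tot[OF that] by (auto simp: f_def)
  have ppow_f: "ppow \<alpha> j y = Some ((f ^^ j) y) \<and> (f ^^ j) y \<in> Y" if "y \<in> Y" for j y
    using that by (induction j) (auto simp: f)
  have f_per: "(f ^^ k) y = y" if "y \<in> Y" for y
    using per_Y[OF that] ppow_f[OF that, of k] by simp
  have inj: "y = z" if "y \<in> Y" "z \<in> Y" "f y = f z" for y z
  proof -
    obtain j where "k = Suc j" using k gr0_implies_Suc by blast
    then have "(f ^^ k) y = (f ^^ k) z" using that(3) by (simp only: \<open>k = Suc j\<close> funpow_Suc_right o_apply)
    then show ?thesis using f_per that by simp
  qed
  have aY: "a \<in> Y" using fix_a by (auto simp: Y_def ran_def)
  have fa: "f a = a" using fix_a by (simp add: f_def)
  \<comment> \<open>The least point of \<open>Y\<close> goes to a value not after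
    \<open>f a = a\<close>, which is the first point in the order cut at a. So
    \<open>f m = a\<close>, injectivity gives \<open>m = a\<close>, and on \<open>Y\<close> the cut
    c may be replaced by a.\<close>
  obtain m where m: "m \<in> Y" "\<And>y. y \<in> Y \<Longrightarrow> cut_key n c m \<le> cut_key n c y"
    using ex_has_least_nat[of "\<lambda>x. x \<in> Y" a "cut_key n c"] aY by blast
  have "cut_key n a (f m) \<le> cut_key n a a"
    using cut_monoD[OF c f(1)[OF m(1)] fix_a m(2)[OF aY]] .
  then have "f m = a" using Yn[OF f(2)[OF m(1)]] Yn[OF aY] by (auto simp: cut_key_def \<Omega>_def split: if_splits)
  then have "m = a" using inj[OF m(1) aY] fa by simp
  have mono: "cut_key n a (f y) \<le> cut_key n a (f z)" if "y \<in> Y" "z \<in> Y" "cut_key n a y \<le> cut_key n a z" for y z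
  proof (rule cut_monoD[OF c f(1)[OF that(1)] f(1)[OF that(2)]])
    show "cut_key n c y \<le> cut_key n c z"
      using m(2)[OF that(1)] m(2)[OF that(2)] Yn[OF that(1)] Yn[OF that(2)] Yn[OF aY] that(3) unfolding \<open>m = a\<close>
      by (auto simp: cut_key_def \<Omega>_def split: if_splits)
  qed
  \<comment> \<open>By monotonicity the iterates of y keep moving in one direction; as they return
    after k steps, they do not move at all.\<close>
  have f_id: "f y = y" if y: "y \<in> Y" for y
  proof -
    have Yj: "(f ^^ j) y \<in> Y" for j using ppow_f[OF y] by blast
    obtain j where j: "k = Suc j" using k gr0_implies_Suc by blast
    have "cut_key n a (f y) = cut_key n a y"
    proof (cases "cut_key n a y \<le> cut_key n a (f y)")
      case True
      have "cut_key n a ((f ^^ i) y) \<le> cut_key n a ((f ^^ Suc i) y)" for i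
        by (induction i) (use True mono Yj f(2)[OF Yj] in auto)
      then have "cut_key n a ((f ^^ 1) y) \<le> cut_key n a ((f ^^ Suc j) y)"
        by (rule lift_Suc_mono_le[of "\<lambda>i. cut_key n a ((f ^^ i) y)"]) auto
      then show ?thesis using True f_per[OF y] j by simp
    next
      case False
      have "cut_key n a ((f ^^ Suc i) y) \<le> cut_key n a ((f ^^ i) y)" for i
        by (induction i) (use False mono Yj f(2)[OF Yj] in auto)
      then have "cut_key n a ((f ^^ Suc j) y) \<le> cut_key n a ((f ^^ 1) y)"
        by (rule lift_Suc_antimono_le[of "\<lambda>i. cut_key n a ((f ^^ i) y)"]) auto
      then show ?thesis using False f_per[OF y] j by simp
    qed
    then show ?thesis using cut_key_inj[OF Yn[OF f(2)[OF y]] Yn[OF y]] by simp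
  qed
  show ?thesis
  proof (rule pmap_eqI)
    fix x y
    show "(\<alpha> \<Zsemi> \<alpha>) x = Some y \<longleftrightarrow> \<alpha> x = Some y"
      using f f_id unfolding map_comp_Some_iff by (metis Y_def option.inject ranI)
  qed
qed

subsection \<open>Rotations and the dihedral group\<close>

text \<open>The power \<open>g^i\<close> in closed form (see \<open>gperm_pow\<close>); the shifts
  by 1 pass between {1..n} and residues modulo n.\<close>

definition rot :: "nat \<Rightarrow> nat \<Rightarrow> pmap" where
  "rot n i = full_map n (\<lambda>x. (x - 1 + i) mod n + 1)"

lemma rot_simps [simp]: "x \<in> \<Omega> n \<Longrightarrow> rot n i x = Some ((x - 1 + i) mod n + 1)"
  by (simp add: rot_def)

lemma rot_fun: "(\<lambda>x. (x - 1 + i) mod n + 1) \<in> \<Omega> n \<rightarrow> \<Omega> n"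
  by (auto simp: \<Omega>_def Suc_le_eq)

lemma rot_FT: "rot n i \<in> FT n"
  unfolding rot_def by (rule full_map_FT[OF rot_fun])

lemma rot_PT: "rot n i \<in> PT n"
  by (rule FT_PT[OF rot_FT])

lemma rot_mult: "rot n i \<Zsemi> rot n j = rot n (i + j)"
  unfolding rot_def by (subst full_map_mult[OF rot_fun]) (auto intro!: full_map_cong simp: mod_add_left_eq add.assoc)

lemma rot_mod: "rot n (i mod n) = rot n i"
  unfolding rot_def by (intro full_map_cong) (simp add: mod_add_right_eq)

lemma rot_0 [simp]: "rot n 0 = pid n"
  unfolding rot_def by (intro full_map_cong) (auto simp: \<Omega>_def)

lemma rot_n [simp]: "rot n n = pid n"
  using rot_mod[of n n] by simp

lemma rot_cong: "i mod n = j mod n \<Longrightarrow> rot n i = rot n j"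
  by (metis rot_mod)

lemma gperm_rot: "gperm n = rot n 1"
  unfolding gperm_def rot_def by (intro full_map_cong) (auto simp: \<Omega>_def)

lemma rot_Sym: "rot n i \<in> Sym n"
proof -
  \<comment> \<open>The exponent \<open>n * i - i\<close> is a natural number congruent to
    -i.\<close>
  have "rot n i \<Zsemi> rot n (n * i - i) = pid n" if "n > 0"
  proof -
    have "i + (n * i - i) = n * i" using that by (cases n) auto
    then show ?thesis by (metis mod_mult_self1_is_0 rot_0 rot_mod rot_mult)
  qed
  moreover have "rot n i \<in> PI n" if "rot n i \<Zsemi> \<beta> = pid n" for \<beta>
    unfolding PI_iff
  proof (intro conjI allI impI rot_PT)
    fix x y j assume a: "rot n i x = Some j" "rot n i y = Some j"
    then have "(rot n i \<Zsemi> \<beta>) x = (rot n i \<Zsemi> \<beta>) y" by (simp add: map_comp_def)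
    with that a PT_D[OF rot_PT] show "x = y" by (metis full_map_simps(1) option.inject)
  qed
  ultimately have "rot n i \<in> PI n" if "n > 0" using that by blast
  moreover have "rot n i \<in> PI n" if "n = 0" using that by (simp add: rot_def PI_iff PT_iff full_map_def \<Omega>_def)
  ultimately show ?thesis using rot_FT by (auto simp: Sym_def)
qed

lemma rot_POP: "rot n i \<in> POP n"
proof -
  have "rot n i \<in> POP n" if i: "i < n" for i
  proof (rule POP_I[OF rot_PT])
    \<comment> \<open>For 0 < i < n the point n - i + 1 is the one that is sent to 1.\<close>
    show "cut_mono n (n - i + 1) 0 (rot n i)"
      unfolding cut_mono_def
    proof (intro allI impI)
      fix x y u v assume a: "rot n i x = Some u" "rot n i y = Some v"
        and le: "cut_key n (n - i + 1) x \<le> cut_key n (n - i + 1) y"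
      have xy: "x \<in> \<Omega> n" "y \<in> \<Omega> n" using a PT_D[OF rot_PT] by blast+
      have val: "(z - 1 + i) mod n + 1 = (if z < n - i + 1 then z + i else z + i - n)" if "z \<in> \<Omega> n" for z
      proof (cases "z < n - i + 1")
        case True
        then have "z - 1 + i < n" using that i unfolding \<Omega>_def atLeastAtMost_iff by linarith
        then show ?thesis using True that by (simp add: \<Omega>_def)
      next
        case False
        then have "n \<le> z - 1 + i" "z - 1 + i - n < n" using that i unfolding \<Omega>_def atLeastAtMost_iff by linarith+
        then have "(z - 1 + i) mod n = z - 1 + i - n" by (simp add: le_mod_geq)
        moreover have "z - 1 + i - n + 1 = z + i - n" using False that i unfolding \<Omega>_def atLeastAtMost_iff by linarith
        ultimately show ?thesis using False by presburger
      qed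
      have uv: "u = (if x < n - i + 1 then x + i else x + i - n)" "v = (if y < n - i + 1 then y + i else y + i - n)"
        using a xy val[OF xy(1)] val[OF xy(2)] by auto
      show "cut_key n 0 u \<le> cut_key n 0 v"
        using xy le i unfolding uv cut_key_def \<Omega>_def atLeastAtMost_iff
        by (cases "x < n - i + 1"; cases "y < n - i + 1"; simp)
    qed
  qed
  then have "rot n (i mod n) \<in> POP n" if "n > 0" using that by simp
  moreover have "rot n i \<in> POP n" if "n = 0"
    using that rot_PT[of n i] by (simp add: POP_iff rot_def cut_mono_def full_map_def \<Omega>_def)
  ultimately show ?thesis by (auto simp: rot_mod)
qed

lemma hperm_Sym: "hperm n \<in> Sym n"
  using hperm_FT hperm_PI by (simp add: Sym_def)

text \<open>The dihedral relation, with a natural number j in the role of -i.\<close>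

lemma hperm_rot_hperm:
  assumes "(i + j) mod n = 0" shows "hperm n \<Zsemi> rot n i \<Zsemi> hperm n = rot n j"
proof (rule ext)
  fix x
  show "(hperm n \<Zsemi> rot n i \<Zsemi> hperm n) x = rot n j x"
  proof (cases "x \<in> \<Omega> n")
    case True
    then have n: "1 \<le> x" "x \<le> n" by (auto simp: \<Omega>_def)
    define a b where "a = (n + 1 - x - 1 + i) mod n" and "b = (x - 1 + j) mod n"
    have ab: "a < n" "b < n" using n by (auto simp: a_def b_def)
    have "(a + b) mod n = (n + 1 - x - 1 + i + (x - 1 + j)) mod n" by (simp add: a_def b_def mod_add_eq)
    also have "n + 1 - x - 1 + i + (x - 1 + j) = (n - 1) + (i + j)" using n by simp
    also have "((n - 1) + (i + j)) mod n = ((n - 1) + (i + j) mod n) mod n" by (simp add: mod_add_right_eq)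
    also have "\<dots> = n - 1" using assms n by simp
    \<comment> \<open>Both residues are below n, so their sum is at most 2n - 2, and n - 1 is the
      only such number in its class modulo n.\<close>
    finally have "a + b = n - 1" using ab n by (auto simp: mod_if split: if_splits)
    then have eq: "n + 1 - (a + 1) = b + 1" using ab by simp
    have "n + 1 - x \<in> \<Omega> n" "a + 1 \<in> \<Omega> n" using n ab by (auto simp: \<Omega>_def)
    then show ?thesis using True eq by (simp add: a_def b_def del: One_nat_def Suc_eq_plus1 add_diff_cancel_left diff_diff_left)
  qed (simp add: rot_def)
qed

lemma rot_inverse: "(n::nat) > 0 \<Longrightarrow> \<exists>j. (i + j) mod n = 0"
proof (cases n)
  case (Suc m)
  then have "i + m * i = n * i" by simp
  then show ?thesis by (metis mod_mult_self1_is_0)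
qed simp

text \<open>A rotation brings the image of 1 back to 1. The result is a group element with a fixed
  point, hence an idempotent permutation, hence the identity.\<close>

lemma POP_Sym_rot:
  assumes "\<alpha> \<in> POP n" "\<alpha> \<in> Sym n" "n > 0" shows "\<exists>i<n. \<alpha> = rot n i"
proof -
  have "1 \<in> \<Omega> n" using assms(3) by (simp add: \<Omega>_def)
  then obtain a where a: "\<alpha> 1 = Some a" "a \<in> \<Omega> n" using FT_D Sym_FT assms(2) by blast
  let ?\<beta> = "\<alpha> \<Zsemi> rot n (n + 1 - a)"
  have "?\<beta> 1 = Some 1" using a by (auto simp: \<Omega>_def)
  moreover have \<beta>: "?\<beta> \<in> Sym n" "?\<beta> \<in> POP n" using Sym_mult POP_mult assms rot_Sym rot_POP by blast+
  moreover obtain k where "k > 0" "ppow ?\<beta> k = pid n" using Sym_pow \<beta>(1) by blast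
  ultimately have "?\<beta> \<Zsemi> ?\<beta> = ?\<beta>"
    using POP_fixpoint_idempotent[of ?\<beta> n 1 k] Sym_PT pid_right by metis
  then have "pinv ?\<beta> \<Zsemi> ?\<beta> \<Zsemi> ?\<beta> = pinv ?\<beta> \<Zsemi> ?\<beta>" by (simp add: pmult_assoc)
  then have b: "?\<beta> = pid n" using pinv_Sym_left[OF \<beta>(1)] Sym_PT[OF \<beta>(1)] by simp
  have "\<alpha> = \<alpha> \<Zsemi> (rot n (n + 1 - a) \<Zsemi> rot n (a - 1))"
    using a Sym_PT[OF assms(2)] by (simp add: rot_mult \<Omega>_def)
  also have "\<dots> = rot n (a - 1)" using b by (metis pmult_assoc pid_left rot_PT)
  finally show ?thesis using a by (auto simp: \<Omega>_def intro!: exI[of _ "a - 1"])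
qed

lemma POR_Sym_cases:
  assumes "\<alpha> \<in> POR n" "\<alpha> \<in> Sym n" "n > 0"
  shows "\<exists>i<n. \<alpha> = rot n i \<or> \<alpha> = hperm n \<Zsemi> rot n i"
proof (cases "\<alpha> \<in> POP n")
  case False
  then have "\<alpha> \<Zsemi> hperm n \<in> POP n" using assms(1) POR_iff by blast
  then have "hperm n \<Zsemi> \<alpha> \<in> POP n" using assms(2) Sym_PT hperm_mult_POP_iff by blast
  then obtain i where "i < n" "hperm n \<Zsemi> \<alpha> = rot n i" using POP_Sym_rot Sym_mult hperm_Sym assms by blast
  then show ?thesis by (metis assms(2) hperm_hperm pid_left pmult_assoc Sym_PT)
qed (use POP_Sym_rot assms in blast)

lemma hperm_POR: "hperm n \<in> POR n"
  unfolding POR_iff using hperm_PT pid_POP by simp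

lemma ppow_rot: "ppow (rot n (Suc 0)) i = (if i = 0 then Some else rot n i)"
  by (induction i) (auto simp: rot_mult)

lemma gperm_pow: "gperm n [^]\<^bsub>Mon n A\<^esub> (i::nat) = rot n i"
  by (cases "i = 0") (simp_all add: gperm_rot Mon_pow rot_PT ppow_rot)

lemma Dih_eq:
  assumes "n > 0"
  shows "Dih n = POR n \<inter> Sym n"
proof
  interpret group "Mon n (Sym n)" by (rule group_Sym)
  have sub: "subgroup (POR n \<inter> Sym n) (Mon n (Sym n))"
    by (rule subgroupI)
      (auto simp: inv_Sym POR_mult Sym_mult POR_pinv Sym_PI pinv_Sym intro: pid_Sym set_mp[OF POP_subset_POR pid_POP])
  show "Dih n \<subseteq> POR n \<inter> Sym n"
    unfolding Dih_def using sub
    by (rule generate_subgroup_incl[rotated]) (auto simp: hperm_POR hperm_Sym gperm_rot rot_Sym intro: set_mp[OF POP_subset_POR rot_POP])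
  have rot: "rot n i \<in> Dih n" for i
  proof (induction i)
    case 0
    then show ?case unfolding Dih_def using generate.one[of "Mon n (Sym n)"] by simp
  next
    case (Suc i)
    have "rot n 1 \<in> Dih n" unfolding Dih_def by (rule generate.incl) (simp add: gperm_rot)
    with Suc have "rot n i \<Zsemi> rot n 1 \<in> Dih n" 
      unfolding Dih_def using generate.eng[of _ "Mon n (Sym n)"] by fastforce
    then show ?case by (simp add: rot_mult)
  qed
  have "hperm n \<Zsemi> rot n i \<in> Dih n" for i
  proof -
    have "hperm n \<in> Dih n" unfolding Dih_def by (rule generate.incl) simp
    with rot[of i] show ?thesis
      unfolding Dih_def using generate.eng[of _ "Mon n (Sym n)"] by fastforce
  qed
  with rot show "POR n \<inter> Sym n \<subseteq> Dih n" using POR_Sym_cases assms by blast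
qed

lemma rot_eq_iff:
  assumes "n > 0" shows "rot n i = rot n j \<longleftrightarrow> i mod n = j mod n"
proof
  assume "rot n i = rot n j"
  then have "rot n i 1 = rot n j 1" by simp
  moreover have "1 \<in> \<Omega> n" using assms by (simp add: \<Omega>_def)
  ultimately show "i mod n = j mod n" by simp
qed (rule rot_cong)

text \<open>From 1 to 2 the values of a rotation step forward and those of a reflection step back;
  equality would make n a divisor of 2.\<close>

lemma rot_neq_refl:
  assumes "n \<ge> 3" shows "rot n i \<noteq> hperm n \<Zsemi> rot n j"
proof
  assume eq: "rot n i = hperm n \<Zsemi> rot n j"
  have n: "1 \<in> \<Omega> n" "2 \<in> \<Omega> n" "n \<in> \<Omega> n" "n - 1 \<in> \<Omega> n" using assms by (auto simp: \<Omega>_def)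
  have "rot n i 1 = (hperm n \<Zsemi> rot n j) 1" "rot n i 2 = (hperm n \<Zsemi> rot n j) 2" using eq by simp_all
  then have a: "i mod n = (n - 1 + j) mod n" "(1 + i) mod n = (n - 1 - 1 + j) mod n"
    using n assms by (simp_all add: numeral_2_eq_2)
  have "(n - 1 - 1 + j) mod n = (1 + (n - 1 + j)) mod n" using a by (metis mod_add_right_eq)
  also have "1 + (n - 1 + j) = (n - 1 - 1 + j) + 2" using assms by simp
  finally have "((n - 1 - 1 + j) + 2) mod n = ((n - 1 - 1 + j) + 0) mod n" by simp
  then have "n dvd 2" by (metis add.right_neutral add_diff_cancel_left' le_add1 mod_eq_dvd_iff_nat)
  then show False using assms by (auto dest: dvd_imp_le)
qed

text \<open>The strict cyclic order on triples: one turn round the circle starting at x meets y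
  before z. It allows orientation to be tested on three points without mentioning a cut.\<close>

definition cyc3 :: "nat \<Rightarrow> nat \<Rightarrow> nat \<Rightarrow> bool" where
  "cyc3 x y z \<longleftrightarrow> x < y \<and> y < z \<or> y < z \<and> z < x \<or> z < x \<and> x < y"

text \<open>A cut does not change the cyclic order of three points, and a monotone map with distinct
  values is strictly monotone on them.\<close>

lemma POP_cyc3:
  assumes "\<alpha> \<in> POP n" "\<alpha> x = Some u" "\<alpha> y = Some v" "\<alpha> z = Some w" "cyc3 x y z"
    and "u \<noteq> v" "v \<noteq> w" "u \<noteq> w"
  shows "cyc3 u v w"
proof -
  obtain c where c: "cut_mono n c 0 \<alpha>" and PT: "\<alpha> \<in> PT n" using assms POP_iff by blast
  have n: "x \<in> \<Omega> n" "y \<in> \<Omega> n" "z \<in> \<Omega> n" using assms PT_D[OF PT] by blast+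
  have le: "cut_key n c x \<le> cut_key n c y \<longrightarrow> u < v" "cut_key n c y \<le> cut_key n c z \<longrightarrow> v < w"
    "cut_key n c z \<le> cut_key n c x \<longrightarrow> w < u" "cut_key n c y \<le> cut_key n c x \<longrightarrow> v < u" "cut_key n c z \<le> cut_key n c y \<longrightarrow> w < v"
    "cut_key n c x \<le> cut_key n c z \<longrightarrow> u < w"
    using cut_monoD[OF c] assms by fastforce+
  have "cyc3 (cut_key n c x) (cut_key n c y) (cut_key n c z)"
    using n assms(5) unfolding cyc3_def cut_key_def \<Omega>_def atLeastAtMost_iff
    by (elim disjE; cases "x < c"; cases "y < c"; cases "z < c"; simp)
  then show ?thesis using le unfolding cyc3_def by (meson less_imp_le)
qed

lemma POR_cyc3:
  assumes "\<alpha> \<in> POR n"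
  obtains "\<And>x y z u v w. \<alpha> x = Some u \<Longrightarrow> \<alpha> y = Some v \<Longrightarrow> \<alpha> z = Some w \<Longrightarrow> cyc3 x y z \<Longrightarrow>
      u \<noteq> v \<Longrightarrow> v \<noteq> w \<Longrightarrow> u \<noteq> w \<Longrightarrow> cyc3 u v w"
  | "\<And>x y z u v w. \<alpha> x = Some u \<Longrightarrow> \<alpha> y = Some v \<Longrightarrow> \<alpha> z = Some w \<Longrightarrow> cyc3 x y z \<Longrightarrow>
      u \<noteq> v \<Longrightarrow> v \<noteq> w \<Longrightarrow> u \<noteq> w \<Longrightarrow> cyc3 w v u"
proof (cases "\<alpha> \<in> POP n")
  case True
  then show ?thesis by (intro that(1)) (rule POP_cyc3)
next
  case False
  then have P: "\<alpha> \<Zsemi> hperm n \<in> POP n" using assms POR_iff by blast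
  have PT: "\<alpha> \<in> PT n" using assms POR_PT by blast
  show ?thesis
  proof (rule that(2))
    fix x y z u v w assume a: "\<alpha> x = Some u" "\<alpha> y = Some v" "\<alpha> z = Some w" "cyc3 x y z" "u \<noteq> v" "v \<noteq> w" "u \<noteq> w"
    then have n: "u \<in> \<Omega> n" "v \<in> \<Omega> n" "w \<in> \<Omega> n" using PT_D[OF PT] by blast+
    have "cyc3 (n + 1 - u) (n + 1 - v) (n + 1 - w)"
      by (rule POP_cyc3[OF P, of x _ y _ z]) (use a n in \<open>auto simp: \<Omega>_def\<close>)
    then show "cyc3 w v u" using n by (auto simp: cyc3_def \<Omega>_def)
  qed
qed

subsection \<open>Factorization through an initial segment\<close>

lemma full_map_mono_OP:
  assumes "f \<in> \<Omega> n \<rightarrow> \<Omega> n" "\<And>x y. x \<in> \<Omega> n \<Longrightarrow> y \<in> \<Omega> n \<Longrightarrow> x \<le> y \<Longrightarrow> f x \<le> f y"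
  shows "full_map n f \<in> OP n"
proof -
  have "cut_mono n 0 0 (full_map n f)"
    unfolding cut_mono_def full_map_Some_iff using assms(2) by simp
  then show ?thesis using POP_I full_map_FT[OF assms(1)] FT_PT by (auto simp: OP_def)
qed

definition pos :: "nat set \<Rightarrow> nat \<Rightarrow> nat" where
  "pos A x = card {y \<in> A. y \<le> x}"

lemma pos_mono: "finite A \<Longrightarrow> x \<le> y \<Longrightarrow> pos A x \<le> pos A y"
  unfolding pos_def by (intro card_mono) auto

lemma pos_strict:
  assumes "finite A" "y \<in> A" "x < y" shows "pos A x < pos A y"
  unfolding pos_def
proof (rule psubset_card_mono)
  have "y \<in> {z \<in> A. z \<le> y}" "y \<notin> {z \<in> A. z \<le> x}" using assms by auto
  moreover have "{z \<in> A. z \<le> x} \<subseteq> {z \<in> A. z \<le> y}" using assms by auto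
  ultimately show "{z \<in> A. z \<le> x} \<subset> {z \<in> A. z \<le> y}" by blast
qed (use assms in simp)

lemma pos_inj: "finite A \<Longrightarrow> x \<in> A \<Longrightarrow> y \<in> A \<Longrightarrow> pos A x = pos A y \<Longrightarrow> x = y"
  by (metis linorder_neqE_nat nat_neq_iff pos_strict)

lemma pos_image: assumes "finite A" shows "pos A ` A = {1..card A}"
proof (rule card_subset_eq)
  show "pos A ` A \<subseteq> {1..card A}"
  proof
    fix k assume "k \<in> pos A ` A"
    then obtain x where x: "x \<in> A" "k = pos A x" by blast
    have "card {x} \<le> k" unfolding x pos_def using assms x by (intro card_mono) auto
    moreover have "k \<le> card A" unfolding x pos_def using assms by (intro card_mono) auto
    ultimately show "k \<in> {1..card A}" by simp
  qed
  show "card (pos A ` A) = card {1..card A}"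
    using card_image[of "pos A" A] pos_inj[OF assms] by (auto simp: inj_on_def)
qed simp

text \<open>The order isomorphism of a finite set \<open>A\<close> onto the initial segment of the
  same size.\<close>

definition ppos :: "nat set \<Rightarrow> pmap" where
  "ppos A = (\<lambda>x. if x \<in> A then Some (pos A x) else None)"

lemma ppos_Some_iff: "ppos A x = Some y \<longleftrightarrow> x \<in> A \<and> y = pos A x"
  by (auto simp: ppos_def)

lemma POPI_iff: "\<alpha> \<in> POPI n \<longleftrightarrow> \<alpha> \<in> POP n \<and> \<alpha> \<in> PI n"
  by (simp add: POPI_def)

context
  fixes A n assumes A: "A \<subseteq> \<Omega> n"
begin

lemma finA: "finite A" and cardA: "card A \<le> n"
  using A finite_subset[OF A finite_Omega] card_mono[OF finite_Omega A] by auto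

lemma ppos_PI: "ppos A \<in> PI n"
proof -
  have "pos A x \<in> \<Omega> n" if "x \<in> A" for x
  proof -
    have "pos A x \<in> {1..card A}" using pos_image[OF finA] that by blast
    then show ?thesis using cardA by (simp add: \<Omega>_def)
  qed
  then show ?thesis using A pos_inj[OF finA] unfolding PI_iff PT_iff ppos_Some_iff by blast
qed

lemma ppos_POPI: "ppos A \<in> POPI n"
  using ppos_PI POP_I[of "ppos A" n 0 0] pos_mono[OF finA]
  by (auto simp: POPI_iff cut_mono_def ppos_Some_iff PI_PT)

lemma dom_ppos: "dom (ppos A) = A"
  by (auto simp: ppos_def dom_def)

lemma ran_ppos: "ran (ppos A) = {1..card A}"
  unfolding pos_image[OF finA, symmetric] by (auto simp: ran_def ppos_Some_iff)

lemma pinv_ppos_POPI: "pinv (ppos A) \<in> POPI n"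
  using ppos_POPI POP_pinv pinv_PI by (auto simp: POPI_iff)

text \<open>Together with \<open>rid_segment_factor\<close> this shows that partial identities of
  equal rank generate the same ideal in every monoid between \<open>POPI n\<close> and
  \<open>PT n\<close>. A homomorphism therefore collapses all of them or none.\<close>

lemma rid_factor: "rid A = ppos A \<Zsemi> rid {1..card A} \<Zsemi> pinv (ppos A)"
  using pinv_right[OF ppos_PI] rid_right[of "ppos A" "{1..card A}"] ran_ppos dom_ppos by simp

lemma rid_segment_factor: "rid {1..card A} = pinv (ppos A) \<Zsemi> rid A \<Zsemi> ppos A"
  using pinv_left[OF ppos_PI] rid_left[of "ppos A" A] ran_ppos dom_ppos by (simp add: pmult_assoc)

end

text \<open>Puts every map of rank r into the ideal generated by \<open>rid {1..r}\<close>; hence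
  this idempotent cannot be collapsed while some map of rank r is not.\<close>

lemma PT_factor:
  assumes "\<alpha> \<in> PT n"
  shows "\<alpha> = \<alpha> \<Zsemi> ppos (ran \<alpha>) \<Zsemi> rid {1..rank \<alpha>} \<Zsemi> pinv (ppos (ran \<alpha>))"
proof -
  have A: "ran \<alpha> \<subseteq> \<Omega> n" using assms by (simp add: PT_def)
  have "\<alpha> = \<alpha> \<Zsemi> rid (ran \<alpha>)" by (simp add: rid_right)
  then show ?thesis using rid_factor[OF A] by (simp add: pmult_assoc rank_def)
qed

text \<open>For 1 \<le> r \<le> n this is an order-preserving idempotent of rank r. Among full maps
  it takes over the role of \<open>rid {1..r}\<close>.\<close>

definition trunc :: "nat \<Rightarrow> nat \<Rightarrow> pmap" where
  "trunc n r = full_map n (\<lambda>i. min i r)"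

lemma trunc_OP: "r \<ge> 1 \<Longrightarrow> trunc n r \<in> OP n"
  unfolding trunc_def by (rule full_map_mono_OP) (auto simp: \<Omega>_def)

lemma FT_factor:
  assumes "\<alpha> \<in> FT n" "n > 0"
  shows "rank \<alpha> \<ge> 1" "\<exists>\<beta> \<in> OP n. \<exists>\<gamma> \<in> OP n. \<alpha> = \<alpha> \<Zsemi> \<beta> \<Zsemi> trunc n (rank \<alpha>) \<Zsemi> \<gamma>"
proof -
  define A where "A = ran \<alpha>"
  define r where "r = card A"
  have A: "A \<subseteq> \<Omega> n" using FT_PT[OF assms(1)] by (simp add: PT_def A_def)
  have fin: "finite A" and rn: "r \<le> n" using finA[OF A] cardA[OF A] by (auto simp: r_def)
  have "1 \<in> \<Omega> n" using assms(2) by (simp add: \<Omega>_def)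
  then obtain j where "\<alpha> 1 = Some j" using FT_D[OF assms(1)] by blast
  then have "A \<noteq> {}" by (auto simp: A_def ran_def)
  then have r1: "r \<ge> 1" using fin by (simp add: r_def Suc_le_eq card_gt_0_iff)
  then show "rank \<alpha> \<ge> 1" by (simp add: rank_def A_def r_def)
  define d where "d i = the (pinv (ppos A) i)" for i
  have d: "d (pos A x) = x" if "x \<in> A" for x
  proof -
    have "pinv (ppos A) (pos A x) = Some x" using that by (simp add: pinv_Some_iff[OF ppos_PI[OF A]] ppos_Some_iff)
    then show ?thesis by (simp add: d_def)
  qed
  have d': "d i \<in> A \<and> pos A (d i) = i" if "1 \<le> i" "i \<le> r" for i
  proof -
    have "i \<in> pos A ` A" using that pos_image[OF fin] by (simp add: r_def)
    then show ?thesis using d by auto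
  qed
  have d_mono: "d i \<le> d j" if "1 \<le> i" "i \<le> j" "j \<le> r" for i j
  proof (rule ccontr)
    assume "\<not> d i \<le> d j"
    then have "pos A (d j) < pos A (d i)" using pos_strict[OF fin, of "d i" "d j"] d'[of i] that by auto
    then show False using d'[of i] d'[of j] that by auto
  qed
  \<comment> \<open>The first map replaces each image point by its position, the second one undoes
    this. The maximum with 1 keeps the first map total: points below all of \<open>A\<close> have
    position 0.\<close>
  let ?\<beta> = "full_map n (\<lambda>x. max 1 (pos A x))" and ?\<gamma> = "full_map n (\<lambda>i. d (min i r))"
  have pos_le: "pos A x \<le> n" for x
  proof -
    have "pos A x \<le> card A" unfolding pos_def using fin by (intro card_mono) auto
    then show ?thesis using cardA[OF A] by simp
  qed
  have "?\<beta> \<in> OP n"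
    using assms(2) pos_le by (intro full_map_mono_OP max.mono pos_mono fin) (auto simp: \<Omega>_def)
  moreover have "?\<gamma> \<in> OP n"
  proof (rule full_map_mono_OP)
    show "(\<lambda>i. d (min i r)) \<in> \<Omega> n \<rightarrow> \<Omega> n" using d' r1 A by (auto simp: \<Omega>_def)
  qed (use r1 in \<open>auto intro!: d_mono simp: \<Omega>_def min_le_iff_disj\<close>)
  moreover have "\<alpha> = \<alpha> \<Zsemi> ?\<beta> \<Zsemi> trunc n (rank \<alpha>) \<Zsemi> ?\<gamma>"
  proof (rule ext)
    fix x
    show "\<alpha> x = (\<alpha> \<Zsemi> ?\<beta> \<Zsemi> trunc n (rank \<alpha>) \<Zsemi> ?\<gamma>) x"
    proof (cases "\<alpha> x")
      case (Some a)
      then have a: "a \<in> A" "a \<in> \<Omega> n" using A by (auto simp: A_def ran_def)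
      have "pos A a \<in> {1..r}" using pos_image[OF fin] a by (force simp: r_def)
      then have p: "1 \<le> pos A a" "pos A a \<le> r" by auto
      have "max 1 (pos A a) = pos A a" using p by simp
      moreover have "pos A a \<in> \<Omega> n" using p rn by (simp add: \<Omega>_def)
      moreover have "rank \<alpha> = r" by (simp add: rank_def A_def r_def)
      ultimately show ?thesis using Some a p d[OF a(1)] by (simp add: trunc_def)
    qed simp
  qed
  ultimately show "\<exists>\<beta> \<in> OP n. \<exists>\<gamma> \<in> OP n. \<alpha> = \<alpha> \<Zsemi> \<beta> \<Zsemi> trunc n (rank \<alpha>) \<Zsemi> \<gamma>" by blast
qed

subsection \<open>Conjugation\<close>

lemma conj_by_eq: "\<sigma> \<in> Sym n \<Longrightarrow> conj_by n \<sigma> s = pinv \<sigma> \<Zsemi> s \<Zsemi> \<sigma>"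
  by (simp add: conj_by_def inv_Sym)

lemma conj_by_mult:
  assumes "\<sigma> \<in> Sym n" "s \<in> PT n"
  shows "conj_by n \<sigma> (s \<Zsemi> t) = conj_by n \<sigma> s \<Zsemi> conj_by n \<sigma> t"
proof -
  have "conj_by n \<sigma> s \<Zsemi> conj_by n \<sigma> t = pinv \<sigma> \<Zsemi> (s \<Zsemi> (\<sigma> \<Zsemi> pinv \<sigma>)) \<Zsemi> t \<Zsemi> \<sigma>"
    using assms(1) by (simp only: conj_by_eq pmult_assoc)
  then show ?thesis using assms by (simp add: pinv_Sym_right conj_by_eq pmult_assoc)
qed

lemma conj_by_eqI:
  assumes "\<sigma> \<in> Sym n" "t \<in> PT n" "s \<Zsemi> \<sigma> = \<sigma> \<Zsemi> t"
  shows "conj_by n \<sigma> s = t"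
proof -
  have "conj_by n \<sigma> s = pinv \<sigma> \<Zsemi> \<sigma> \<Zsemi> t"
    using assms by (simp add: conj_by_eq pmult_assoc)
  then show ?thesis using assms by (simp add: pinv_Sym_left)
qed

lemma conj_by_intertwine:
  assumes "\<sigma> \<in> Sym n" "s \<in> PT n"
  shows "\<sigma> \<Zsemi> conj_by n \<sigma> s = s \<Zsemi> \<sigma>"
proof -
  have "\<sigma> \<Zsemi> conj_by n \<sigma> s = \<sigma> \<Zsemi> pinv \<sigma> \<Zsemi> (s \<Zsemi> \<sigma>)"
    using assms by (simp only: conj_by_eq pmult_assoc)
  then show ?thesis using assms by (simp add: pinv_Sym_right PT_mult Sym_PT)
qed

lemma conj_by_conj_by:
  assumes "\<sigma> \<in> Sym n" "\<tau> \<in> Sym n"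
  shows "conj_by n \<tau> (conj_by n \<sigma> s) = conj_by n (\<sigma> \<Zsemi> \<tau>) s"
proof -
  have "pinv (\<sigma> \<Zsemi> \<tau>) = pinv \<tau> \<Zsemi> pinv \<sigma>"
    using pinv_Some_iff[OF Sym_PI[OF Sym_mult[OF assms]]] pinv_Some_iff[OF Sym_PI[OF assms(1)]]
      pinv_Some_iff[OF Sym_PI[OF assms(2)]]
    by (intro pmap_eqI) (auto simp: map_comp_Some_iff)
  then show ?thesis using assms by (simp add: conj_by_eq Sym_mult pmult_assoc)
qed

subsection \<open>The mapping \<open>\<phi>\<^sub>0\<close>\<close>

text \<open>
  \<open>phi0 n s\<close> maps \<open>i\<close> to \<open>k\<close> iff \<open>punct_bij n s i k\<close>, uniformly for units, partial injections and full
  maps; in this form its multiplicativity needs no case distinction.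
\<close>

definition punct_bij :: "nat \<Rightarrow> pmap \<Rightarrow> nat \<Rightarrow> nat \<Rightarrow> bool" where
  "punct_bij n s i k \<longleftrightarrow> i \<in> \<Omega> n \<and> k \<in> \<Omega> n \<and> \<Omega> n - {i} \<subseteq> dom s \<and>
     bij_betw (\<lambda>x. the (s x)) (\<Omega> n - {i}) (\<Omega> n - {k})"

lemma punct_unique: "punct_bij n s i k \<Longrightarrow> punct_bij n s i l \<Longrightarrow> k = l"
  unfolding punct_bij_def bij_betw_def by blast

lemma ran_image: "ran s = (\<lambda>x. the (s x)) ` dom s"
  by (force simp: ran_def dom_def)

lemma co_singleton:
  assumes "B \<subseteq> \<Omega> n" "card B = n - 1" "n > 0" shows "\<exists>k \<in> \<Omega> n. B = \<Omega> n - {k}"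
proof -
  have "card (\<Omega> n - B) = 1" using assms by (simp add: card_Diff_subset finite_subset)
  then obtain k where "\<Omega> n - B = {k}" using card_1_singletonE by blast
  then show ?thesis using assms(1) by blast
qed

lemma punct_ran:
  assumes "s \<in> PT n" "punct_bij n s i k" "s \<notin> Sym n"
  shows "ran s = \<Omega> n - {k}" "rank s = n - 1"
proof -
  have "\<Omega> n - {k} \<subseteq> ran s" using assms(2) unfolding punct_bij_def bij_betw_def ran_image by blast
  moreover have "ran s \<subseteq> \<Omega> n" "ran s \<noteq> \<Omega> n"
    using assms rank_full_iff[OF assms(1)] by (auto simp: PT_def rank_def)
  ultimately show "ran s = \<Omega> n - {k}" using assms(2) unfolding punct_bij_def by blast
  then show "rank s = n - 1" using assms(2) by (simp add: rank_def punct_bij_def)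
qed

text \<open>Deleting i must leave a bijection onto the complement of one point. For a unit every i
  qualifies, with k its value; for a partial injection of rank n - 1 only the point outside the
  domain does; for a full map of rank n - 1 exactly the two points of the non-singleton kernel class
  do. In all other cases such a bijection would force rank n - 1 and one of these shapes.\<close>

lemma phi0_Some_iff:
  assumes PT: "s \<in> PT n" and n: "n > 0"
  shows "phi0 n s i = Some k \<longleftrightarrow> punct_bij n s i k"
proof -
  let ?f = "\<lambda>x. the (s x)"
  have uniq: "(THE i. i \<in> \<Omega> n \<and> \<Omega> n - {i0} = \<Omega> n - {i}) = i0" if "i0 \<in> \<Omega> n" for i0
    using that by (intro the_equality) auto
  consider (sym) "s \<in> Sym n" | (inj) "s \<notin> Sym n" "s \<in> PI n" "rank s = n - 1"
    | (full) "s \<notin> Sym n" "s \<notin> PI n" "s \<in> FT n" "rank s = n - 1"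
    | (other) "s \<notin> Sym n" "\<not> (s \<in> PI n \<and> rank s = n - 1)" "\<not> (s \<in> FT n \<and> rank s = n - 1)"
    by blast
  then show ?thesis
  proof cases
    case sym
    have dom: "dom s = \<Omega> n" and ran: "ran s = \<Omega> n"
      using sym Sym_ran Sym_dom by auto
    have f: "s x = Some (?f x)" if "x \<in> \<Omega> n" for x
    proof -
      have "x \<in> dom s" using that dom by blast
      then show ?thesis by auto
    qed
    have inj: "inj_on ?f (\<Omega> n)"
    proof (rule inj_onI)
      fix x y assume xy: "x \<in> \<Omega> n" "y \<in> \<Omega> n" "?f x = ?f y"
      have "s x = Some (?f x)" "s y = Some (?f x)" unfolding xy(3) by (rule f[OF xy(1), unfolded xy(3)], rule f[OF xy(2)])
      then show "x = y" using Sym_PI[OF sym] unfolding PI_iff by blast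
    qed
    have im: "?f ` (\<Omega> n - {i}) = \<Omega> n - {?f i}" if "i \<in> \<Omega> n" for i
      using inj that ran dom unfolding ran_image by (auto simp: inj_on_def)
    show ?thesis
    proof
      assume "phi0 n s i = Some k"
      then have a: "s i = Some k" using sym by (simp add: phi0_def)
      then have "i \<in> \<Omega> n" "k \<in> \<Omega> n" using PT PT_D by blast+
      then show "punct_bij n s i k"
        using a dom inj im[of i] unfolding punct_bij_def bij_betw_def by (auto intro: inj_on_subset)
    next
      assume a: "punct_bij n s i k"
      then have i: "i \<in> \<Omega> n" "k \<in> \<Omega> n" and "?f ` (\<Omega> n - {i}) = \<Omega> n - {k}" unfolding punct_bij_def bij_betw_def by auto
      then have "\<Omega> n - {?f i} = \<Omega> n - {k}" using im by simp
      moreover have "?f i \<in> \<Omega> n" using f[OF i(1)] PT PT_D by blast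
      ultimately have "?f i = k" using i by blast
      then show "phi0 n s i = Some k" using sym f[OF i(1)] by (simp add: phi0_def)
    qed
  next
    case inj
    have inj': "inj_on ?f (dom s)" using inj(2) by (auto simp: PI_def inj_on_def dom_def)
    then have "card (dom s) = n - 1" using inj(3) by (simp add: rank_def ran_image card_image)
    then obtain i0 where i0: "i0 \<in> \<Omega> n" "dom s = \<Omega> n - {i0}"
      using co_singleton[of "dom s" n] PT n by (auto simp: PT_def)
    obtain k0 where k0: "k0 \<in> \<Omega> n" "ran s = \<Omega> n - {k0}"
      using co_singleton[of "ran s" n] PT n inj(3) by (auto simp: PT_def rank_def)
    have "phi0 n s = [i0 \<mapsto> k0]" using inj uniq i0 k0 by (simp add: phi0_def)
    moreover have "punct_bij n s i0 k0" using i0 k0 inj' by (auto simp: punct_bij_def bij_betw_def ran_image)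
    moreover have "i = i0" if "punct_bij n s i k" using that i0 unfolding punct_bij_def by blast
    ultimately show ?thesis using punct_unique by (auto split: if_splits)
  next
    case full
    obtain k0 where k0: "k0 \<in> \<Omega> n" "ran s = \<Omega> n - {k0}"
      using co_singleton[of "ran s" n] PT n full(4) by (auto simp: PT_def rank_def)
    have dom: "dom s = \<Omega> n" using full by (simp add: FT_def)
    have f: "s x = Some (?f x)" if "x \<in> \<Omega> n" for x
    proof -
      have "x \<in> dom s" using that dom by blast
      then show ?thesis by auto
    qed
    have phi0: "phi0 n s = (\<lambda>i. if i \<in> \<Omega> n \<and> (\<exists>j \<in> \<Omega> n. j \<noteq> i \<and> s i = s j) then Some k0 else None)"
      using full unfolding phi0_def k0(2) uniq[OF k0(1)] by simp
    show ?thesis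
    proof
      assume "phi0 n s i = Some k"
      then obtain j where j: "i \<in> \<Omega> n" "k = k0" "j \<in> \<Omega> n" "j \<noteq> i" "s i = s j"
        unfolding phi0 by (auto split: if_splits)
      have "?f i \<in> ?f ` (\<Omega> n - {i})" using j by (intro image_eqI[of _ _ j]) auto
      then have "?f ` (\<Omega> n - {i}) = ?f ` insert i (\<Omega> n - {i})" unfolding image_insert by (simp only: insert_absorb)
      then have "?f ` (\<Omega> n - {i}) = ?f ` \<Omega> n" using j(1) by (simp add: insert_absorb)
      then have im: "?f ` (\<Omega> n - {i}) = \<Omega> n - {k0}" using k0 dom by (simp add: ran_image)
      then have "inj_on ?f (\<Omega> n - {i})" using j(1) k0(1) by (intro eq_card_imp_inj_on) auto
      then show "punct_bij n s i k" using j dom k0 im by (auto simp: punct_bij_def bij_betw_def)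
    next
      assume a: "punct_bij n s i k"
      then have k: "k = k0" using punct_ran(1)[OF PT a full(1)] k0 unfolding punct_bij_def by blast
      have i: "i \<in> \<Omega> n" using a by (simp add: punct_bij_def)
      have "?f i \<in> ran s" using f[OF i] by (auto simp: ran_def)
      then have "?f i \<in> ?f ` (\<Omega> n - {i})" using a k k0 unfolding punct_bij_def bij_betw_def by simp
      then obtain j where j: "j \<in> \<Omega> n" "j \<noteq> i" "?f i = ?f j" by auto
      then have "s i = s j" using f[OF i] f[OF j(1)] by simp
      then show "phi0 n s i = Some k" using i j k unfolding phi0 by auto
    qed
  next
    case other
    have "\<not> punct_bij n s i k"
    proof
      assume a: "punct_bij n s i k"
      have r: "rank s = n - 1" using punct_ran(2)[OF PT a other(1)] .
      have i: "i \<in> \<Omega> n" and d: "\<Omega> n - {i} \<subseteq> dom s" and inj: "inj_on ?f (\<Omega> n - {i})"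
        using a by (auto simp: punct_bij_def bij_betw_def)
      have d': "dom s \<subseteq> \<Omega> n" using PT by (simp add: PT_def)
      show False
      proof (cases "i \<in> dom s")
        case True
        then have "dom s = \<Omega> n" using d d' by blast
        then show False using other(3) r PT by (simp add: FT_def)
      next
        case False
        then have "dom s = \<Omega> n - {i}" using d d' by blast
        then have "inj_on ?f (dom s)" using inj by simp
        then have "s \<in> PI n" using PT by (auto simp: PI_def inj_on_def)
        then show False using other(2) r by blast
      qed
    qed
    moreover have "phi0 n s = Map.empty" using other unfolding phi0_def by auto
    ultimately show ?thesis by simp
  qed
qed

text \<open>If the product is bijective on the complement of i, then s is injective there and its
  image has n - 1 points. That image misses a single point, and this is the intermediate k.\<close>

lemma punct_bij_mult:
  assumes "s \<in> PT n" "t \<in> PT n"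
  shows "punct_bij n (s \<Zsemi> t) i l \<longleftrightarrow> (\<exists>k. punct_bij n s i k \<and> punct_bij n t k l)"
proof
  let ?s = "\<lambda>x. the (s x)" and ?t = "\<lambda>x. the (t x)" and ?st = "\<lambda>x. the ((s \<Zsemi> t) x)"
  assume a: "punct_bij n (s \<Zsemi> t) i l"
  then have il: "i \<in> \<Omega> n" "l \<in> \<Omega> n" and d: "\<Omega> n - {i} \<subseteq> dom (s \<Zsemi> t)" and
    b: "bij_betw ?st (\<Omega> n - {i}) (\<Omega> n - {l})" by (auto simp: punct_bij_def)
  have def: "s x = Some (?s x)" "t (?s x) = Some (?t (?s x))" "?st x = ?t (?s x)" if x: "x \<in> \<Omega> n - {i}" for x
  proof -
    obtain v where "(s \<Zsemi> t) x = Some v" using x d by blast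
    then obtain u where "s x = Some u" "t u = Some v" unfolding map_comp_Some_iff by blast
    then show "s x = Some (?s x)" "t (?s x) = Some (?t (?s x))" "?st x = ?t (?s x)" by simp_all
  qed
  have b': "bij_betw (?t \<circ> ?s) (\<Omega> n - {i}) (\<Omega> n - {l})"
    using b bij_betw_cong[of "\<Omega> n - {i}" ?st "?t \<circ> ?s" "\<Omega> n - {l}"] def(3) by auto
  then have inj_s: "inj_on ?s (\<Omega> n - {i})" and inj_t: "inj_on ?t (?s ` (\<Omega> n - {i}))"
    using inj_on_imageI2[of ?t ?s "\<Omega> n - {i}"] inj_on_imageI[of ?t ?s "\<Omega> n - {i}"] by (simp_all add: bij_betw_def)
  have sub: "?s ` (\<Omega> n - {i}) \<subseteq> \<Omega> n"
  proof (rule image_subsetI)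
    fix x assume "x \<in> \<Omega> n - {i}"
    then show "?s x \<in> \<Omega> n" using def(1)[of x] PT_D[OF assms(1), of x "?s x"] by blast
  qed
  have crd: "card (?s ` (\<Omega> n - {i})) = n - 1" using card_image[OF inj_s] il by simp
  have "n > 0" using il by (auto simp: \<Omega>_def)
  then obtain k where k: "k \<in> \<Omega> n" "?s ` (\<Omega> n - {i}) = \<Omega> n - {k}" using co_singleton[OF sub crd] by blast
  have "\<Omega> n - {i} \<subseteq> dom s" using def(1) by blast
  then have "punct_bij n s i k" using il k inj_s by (simp add: punct_bij_def bij_betw_def)
  moreover have "punct_bij n t k l"
    unfolding punct_bij_def
  proof (intro conjI)
    show "\<Omega> n - {k} \<subseteq> dom t" unfolding k(2)[symmetric] using def(2) by blast
    show "bij_betw ?t (\<Omega> n - {k}) (\<Omega> n - {l})"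
      unfolding k(2)[symmetric] using inj_t b' by (simp add: bij_betw_def image_comp)
  qed (use k il in auto)
  ultimately show "\<exists>k. punct_bij n s i k \<and> punct_bij n t k l" by blast
next
  let ?s = "\<lambda>x. the (s x)" and ?t = "\<lambda>x. the (t x)" and ?st = "\<lambda>x. the ((s \<Zsemi> t) x)"
  assume "\<exists>k. punct_bij n s i k \<and> punct_bij n t k l"
  then obtain k where k: "punct_bij n s i k" "punct_bij n t k l" by blast
  have def: "(s \<Zsemi> t) x = Some (?t (?s x))" if x: "x \<in> \<Omega> n - {i}" for x
  proof -
    have "x \<in> dom s" using k(1) x unfolding punct_bij_def by blast
    then have "s x = Some (?s x)" by auto
    moreover have "?s x \<in> \<Omega> n - {k}" using k(1) x unfolding punct_bij_def bij_betw_def by blast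
    then have "?s x \<in> dom t" using k(2) unfolding punct_bij_def by blast
    then have "t (?s x) = Some (?t (?s x))" by auto
    ultimately show ?thesis by (simp add: map_comp_Some_iff)
  qed
  have "bij_betw (?t \<circ> ?s) (\<Omega> n - {i}) (\<Omega> n - {l})"
    using k unfolding punct_bij_def by (blast intro: bij_betw_trans)
  moreover have "bij_betw ?st (\<Omega> n - {i}) (\<Omega> n - {l}) = bij_betw (?t \<circ> ?s) (\<Omega> n - {i}) (\<Omega> n - {l})"
    by (rule bij_betw_cong) (simp add: def)
  ultimately show "punct_bij n (s \<Zsemi> t) i l"
    using k def unfolding punct_bij_def by blast
qed

lemma phi0_mult:
  assumes "s \<in> PT n" "t \<in> PT n" "n > 0"
  shows "phi0 n (s \<Zsemi> t) = phi0 n s \<Zsemi> phi0 n t"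
  by (rule pmap_eqI) (use assms in \<open>simp add: phi0_Some_iff PT_mult punct_bij_mult map_comp_Some_iff\<close>)

lemma phi0_PT: "s \<in> PT n \<Longrightarrow> n > 0 \<Longrightarrow> phi0 n s \<in> PT n"
  by (auto simp: PT_iff[of "phi0 n s"] phi0_Some_iff punct_bij_def)

subsection \<open>The normalizer\<close>

lemma mod_add_lcancel: "(a + x) mod n = (a + y) mod n \<longleftrightarrow> x mod n = y mod (n :: nat)"
proof
  \<comment> \<open>Adding \<open>n * a - a\<close> is subtraction of a modulo n within the natural
    numbers.\<close>
  have shift: "((a + z) mod n + (n * a - a)) mod n = z mod n" if "n > 0" for z
  proof -
    have e: "(a + z) + (n * a - a) = z + n * a" using that by (cases n) auto
    have "((a + z) + (n * a - a)) mod n = z mod n" unfolding e by simp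
    then show ?thesis by (simp only: mod_add_left_eq)
  qed
  assume "(a + x) mod n = (a + y) mod n"
  then show "x mod n = y mod n" using shift[of x] shift[of y] by (cases "n = 0") auto
qed (metis mod_add_right_eq)

lemma residue_eq: "n > 0 \<Longrightarrow> m > 0 \<Longrightarrow> residue n m = (m - 1) mod n + 1"
  unfolding residue_def
proof (rule the_equality)
  assume n: "n > 0" "m > 0"
  have "((m - 1) mod n + 1) mod n = (m - 1 + 1) mod n" by (rule mod_add_left_eq)
  then show "(m - 1) mod n + 1 \<in> \<Omega> n \<and> ((m - 1) mod n + 1) mod n = m mod n"
    using n by (simp add: \<Omega>_def Suc_le_eq)
  fix r assume r: "r \<in> \<Omega> n \<and> r mod n = m mod n"
  then have "(r - 1 + 1) mod n = (m - 1 + 1) mod n" using n by (simp add: \<Omega>_def)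
  then have "(r - 1) mod n = (m - 1) mod n" by (metis add.commute mod_add_lcancel)
  then show "r = (m - 1) mod n + 1" using r n by (auto simp: \<Omega>_def)
qed

lemma full_map_Sym:
  assumes "c \<in> \<Omega> n \<rightarrow> \<Omega> n" "inj_on c (\<Omega> n)" shows "full_map n c \<in> Sym n"
  using full_map_FT[OF assms(1)] assms(2) FT_PT
  by (auto simp: Sym_def PI_iff full_map_Some_iff inj_on_def)

lemma refl_square:
  assumes "n > 0" shows "hperm n \<Zsemi> rot n i \<Zsemi> (hperm n \<Zsemi> rot n i) = pid n"
proof -
  obtain j where j: "(i + j) mod n = 0" using rot_inverse[OF assms, of i] by (rule exE)
  have "hperm n \<Zsemi> rot n i \<Zsemi> (hperm n \<Zsemi> rot n i) = rot n (j + i)"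
    unfolding rot_mult[symmetric] hperm_rot_hperm[OF j, symmetric] by (simp only: pmult_assoc)
  also have "\<dots> = pid n" using j by (metis add.commute rot_0 rot_mod)
  finally show ?thesis .
qed

text \<open>The conjugate t of g is an oriented permutation, so it is a rotation or a reflection. As
  a rotation by k it makes the values of \<open>c\<close> an arithmetic progression with step k
  modulo n, and injectivity makes k prime to n.\<close>

lemma normalizer_sigma:
  assumes n: "n \<ge> 3" and c: "c \<in> \<Omega> n \<rightarrow> \<Omega> n" "inj_on c (\<Omega> n)" and t: "t \<in> POR n"
    and comm: "rot n 1 \<Zsemi> full_map n c = full_map n c \<Zsemi> t"
  obtains k where "1 \<le> k" "k < n" "gcd k n = 1" "full_map n c = sigma n (c 1) k"
    "\<And>i. 1 \<le> i \<Longrightarrow> i \<le> n \<Longrightarrow> c i = (c 1 - 1 + (i - 1) * k) mod n + 1"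
proof -
  let ?\<sigma> = "full_map n c"
  have \<sigma>: "?\<sigma> \<in> Sym n" by (rule full_map_Sym[OF c])
  have tPT: "t \<in> PT n" using t by (rule POR_PT)
  have "t = pinv ?\<sigma> \<Zsemi> (rot n 1 \<Zsemi> ?\<sigma>)"
    unfolding comm pmult_assoc[symmetric] pinv_Sym_left[OF \<sigma>] using tPT by simp
  then have tSym: "t \<in> Sym n" using Sym_mult pinv_Sym \<sigma> rot_Sym by metis
  \<comment> \<open>Reflections are involutions, while the square of g is not the identity for n
    \<ge> 3.\<close>
  have "t \<noteq> hperm n \<Zsemi> rot n k" for k
  proof
    assume "t = hperm n \<Zsemi> rot n k"
    then have tt: "t \<Zsemi> t = pid n" using refl_square n by simp
    have "rot n 2 \<Zsemi> ?\<sigma> = rot n 1 \<Zsemi> (rot n 1 \<Zsemi> ?\<sigma>)" by (simp only: pmult_assoc[symmetric] rot_mult one_add_one)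
    also have "\<dots> = ?\<sigma> \<Zsemi> (t \<Zsemi> t)" by (metis comm pmult_assoc)
    finally have "rot n 2 \<Zsemi> ?\<sigma> = ?\<sigma>" using tt Sym_PT[OF \<sigma>] by simp
    then have "rot n 2 \<Zsemi> (?\<sigma> \<Zsemi> pinv ?\<sigma>) = ?\<sigma> \<Zsemi> pinv ?\<sigma>" by (metis pmult_assoc)
    then have "rot n 2 = rot n 0" using pinv_Sym_right[OF \<sigma>] rot_PT by simp
    then have "2 mod n = 0 mod n" using n by (subst (asm) rot_eq_iff) auto
    then show False using n by simp
  qed
  then obtain k where k: "k < n" "t = rot n k" using POR_Sym_cases[OF t tSym] n by auto
  have cn: "1 \<le> c i" "c i \<le> n" if "1 \<le> i" "i \<le> n" for i using c(1) that by (auto simp: \<Omega>_def)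
  have step: "c (Suc i) = (c i - 1 + k) mod n + 1" if "1 \<le> i" "i < n" for i
  proof -
    have i: "i \<in> \<Omega> n" "Suc i \<in> \<Omega> n" "c i \<in> \<Omega> n" using that c(1) by (auto simp: \<Omega>_def)
    have "(rot n 1 \<Zsemi> ?\<sigma>) i = (?\<sigma> \<Zsemi> t) i" using comm by simp
    then show ?thesis using i that k by simp
  qed
  have form: "c i = (c 1 - 1 + (i - 1) * k) mod n + 1" if "1 \<le> i" "i \<le> n" for i
    using that
  proof (induction i rule: dec_induct)
    case base
    then show ?case using cn[of 1] n by auto
  next
    case (step i)
    then have "c (Suc i) = ((c 1 - 1 + (i - 1) * k) mod n + k) mod n + 1"
      using \<open>\<And>i. 1 \<le> i \<Longrightarrow> i < n \<Longrightarrow> c (Suc i) = (c i - 1 + k) mod n + 1\<close>[of i] by simp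
    also have "\<dots> = (c 1 - 1 + (i - 1) * k + k) mod n + 1" by (simp only: mod_add_left_eq)
    also have "c 1 - 1 + (i - 1) * k + k = c 1 - 1 + i * k" using step by (cases i) auto
    finally show ?case by simp
  qed
  have gcd: "gcd k n = 1"
  proof (rule ccontr)
    assume g: "gcd k n \<noteq> 1"
    define d where "d = gcd k n"
    have d: "d > 1" "d dvd n" "d dvd k" using g n by (auto simp: d_def intro: nat_neq_iff[THEN iffD1] Suc_lessI)
    \<comment> \<open>A progression whose step is divisible by d returns to its start after n / d
      steps; since n / d < n this contradicts injectivity.\<close>
    define q where "q = n div d"
    have q1: "n = d * q" using d by (simp add: q_def)
    moreover from this have q0: "q > 0" using n by (cases q) auto
    ultimately have q: "n = d * q" "q < n" "q > 0" using d by auto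
    obtain e where e: "k = d * e" using d by blast
    have "q * k = n * e" using q e by simp
    have "c (1 + q) = (c 1 - 1 + q * k) mod n + 1" using form[of "1 + q"] q by (simp only: add_diff_cancel_left')
    also have "(c 1 - 1 + q * k) mod n = (c 1 - 1) mod n" unfolding \<open>q * k = n * e\<close> by simp
    also have "(c 1 - 1) mod n + 1 = c 1" using form[of 1] n by simp
    finally have "c (1 + q) = c 1" .
    then have "1 + q = 1" by (rule inj_onD[OF c(2)]) (use q(2) in \<open>auto simp: \<Omega>_def\<close>)
    then show False using q by simp
  qed
  have "k \<ge> 1" using gcd n by (cases k) auto
  moreover have "?\<sigma> = sigma n (c 1) k"
    unfolding sigma_def
  proof (rule full_map_cong)
    fix i assume "i \<in> \<Omega> n"
    then have "1 \<le> i" "i \<le> n" by (auto simp: \<Omega>_def)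
    moreover have "1 \<le> c 1" using cn n by simp
    ultimately show "c i = residue n (c 1 + (i - 1) * k)" using form[of i] n by (subst residue_eq) auto
  qed
  ultimately show ?thesis using that[of k] k(1) gcd form by blast
qed

lemma cyc3_total: "x \<noteq> y \<Longrightarrow> y \<noteq> z \<Longrightarrow> x \<noteq> z \<Longrightarrow> cyc3 x y z \<or> cyc3 y x z"
  by (cases rule: linorder_cases[of x y]; cases rule: linorder_cases[of y z]; cases rule: linorder_cases[of x z])
    (simp_all add: cyc3_def)

lemma cyc3_asym: "cyc3 x y z \<Longrightarrow> \<not> cyc3 z y x"
  unfolding cyc3_def by linarith

text \<open>If b were not next to a, both circular neighbours of a would be fixed. A preserving map
  would then have to keep the image of a between them, where a is the only point; a reversing map
  cannot fix three points.\<close>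

lemma POR_fix_adjacent:
  assumes n: "n \<ge> 5" and v: "v \<in> POR n" and ab: "a \<in> \<Omega> n" "b \<in> \<Omega> n" "a \<noteq> b" "v a = Some b"
    and fixed: "\<And>p. p \<in> \<Omega> n \<Longrightarrow> p \<noteq> a \<Longrightarrow> p \<noteq> b \<Longrightarrow> v p = Some p"
  shows "b = a mod n + 1 \<or> a = b mod n + 1"
proof (rule ccontr)
  \<comment> \<open>The successor and the predecessor of a on the circle.\<close>
  define p q where "p = (if a = n then 1 else a + 1)" and "q = (if a = 1 then n else a - 1)"
  assume neg: "\<not> ?thesis"
  have pq: "p \<in> \<Omega> n" "q \<in> \<Omega> n" "p \<noteq> q" "p \<noteq> a" "q \<noteq> a" using ab n by (auto simp: p_def q_def \<Omega>_def)
  have "p = a mod n + 1" using ab by (auto simp: p_def \<Omega>_def)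
  moreover have "a = q mod n + 1" using ab by (auto simp: q_def \<Omega>_def)
  ultimately have b: "p \<noteq> b" "q \<noteq> b" using neg by auto
  have vp: "v p = Some p" "v q = Some q" using fixed pq b by blast+
  have c1: "cyc3 q a p" using ab n by (auto simp: cyc3_def p_def q_def \<Omega>_def)
  have c2: "\<not> cyc3 q b p" using ab b n by (auto simp: cyc3_def p_def q_def \<Omega>_def split: if_splits)
  \<comment> \<open>Here n \<ge> 5 provides a further point t; the fixed points p, q, t exclude the
    reversing case.\<close>
  have "card {a, b, p, q} < card (\<Omega> n)" using n card_insert_le_m1[of 4 "{b,p,q}" a]
    by (simp add: card_insert_if)
  then obtain t where t: "t \<in> \<Omega> n" "t \<notin> {a, b, p, q}"
    by (metis card_mono finite.emptyI finite_insert linorder_not_less subsetI)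
  then have vt: "v t = Some t" using fixed by blast
  from v show False
  proof (cases rule: POR_cyc3)
    case 1
    have "cyc3 q b p" by (rule 1[OF vp(2) ab(4) vp(1) c1]) (use b pq in blast)+
    then show False using c2 by simp
  next
    case 2
    have "cyc3 p q t \<or> cyc3 q p t" using cyc3_total[of p q t] pq t by blast
    then show False
    proof
      assume h: "cyc3 p q t"
      have "cyc3 t q p" by (rule 2[OF vp(1) vp(2) vt h]) (use pq t in blast)+
      then show False using h cyc3_asym by blast
    next
      assume h: "cyc3 q p t"
      have "cyc3 t p q" by (rule 2[OF vp(2) vp(1) vt h]) (use pq t in blast)+
      then show False using h cyc3_asym by blast
    qed
  qed
qed

lemma sigma_Dih:
  assumes n: "n \<ge> 3" and x: "x \<in> \<Omega> n" and k: "k = 1 \<or> k = n - 1"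
  shows "sigma n x k \<in> Dih n"
proof -
  have D: "rot n i \<in> Dih n" "hperm n \<Zsemi> rot n i \<in> Dih n" for i
    using n rot_Sym set_mp[OF POP_subset_POR rot_POP] Sym_mult[OF hperm_Sym rot_Sym] POR_mult[OF hperm_POR set_mp[OF POP_subset_POR rot_POP]]
    by (simp_all add: Dih_eq)
  from k show ?thesis
  proof
    assume k: "k = 1"
    have "sigma n x k = rot n (x - 1)"
      unfolding sigma_def rot_def using x n k
      by (intro full_map_cong, subst residue_eq) (auto simp: \<Omega>_def add_ac)
    then show ?thesis using D by simp
  next
    assume k: "k = n - 1"
    \<comment> \<open>The progression with step -1 that starts at x: the reversal sends 1 to n, and
      n + x is x modulo n.\<close>
    have "sigma n x k = hperm n \<Zsemi> rot n x"
    proof (rule ext)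
      fix i
      show "sigma n x k i = (hperm n \<Zsemi> rot n x) i"
      proof (cases "i \<in> \<Omega> n")
        case True
        then have i: "1 \<le> i" "i \<le> n" by (auto simp: \<Omega>_def)
        have x1: "1 \<le> x" using x by (simp add: \<Omega>_def)
        have "(x + (i - 1) * k - 1) mod n = (x - 1 + (i - 1) * (n - 1)) mod n" using x1 k by (simp add: add.commute)
        also have "\<dots> = (n + 1 - i - 1 + x) mod n"
        proof -
          have "(i - 1) * (n - 1) + (i - 1) = (i - 1) * n" using n by (cases n) auto
          then have "(x - 1 + (i - 1) * (n - 1)) + (i - 1) = x - 1 + (i - 1) * n" by (simp only: add.assoc)
          moreover have "(n + 1 - i - 1 + x) + (i - 1) = x - 1 + n" using i x1 by simp
          ultimately have "((i - 1) + (x - 1 + (i - 1) * (n - 1))) mod n = ((i - 1) + (n + 1 - i - 1 + x)) mod n"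
            by (metis add.commute mod_add_self2 mod_mult_self1)
          then show ?thesis by (simp add: mod_add_lcancel)
        qed
        finally have e: "(x + (i - 1) * k - 1) mod n = (n + 1 - i - 1 + x) mod n" .
        have "sigma n x k i = Some ((x + (i - 1) * k - 1) mod n + 1)"
          unfolding sigma_def using True x1 n by (simp add: residue_eq)
        moreover have "n + 1 - i \<in> \<Omega> n" using i by (auto simp: \<Omega>_def)
        then have "(hperm n \<Zsemi> rot n x) i = Some ((n + 1 - i - 1 + x) mod n + 1)" using True by (simp del: diff_diff_left add: numeral_2_eq_2)
        ultimately show ?thesis using e by simp
      qed (simp add: sigma_def)
    qed
    then show ?thesis using D by simp
  qed
qed

subsection \<open>The six monoids\<close>

definition cst :: "nat \<Rightarrow> nat \<Rightarrow> pmap" where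
  "cst n j = full_map n (\<lambda>_. j)"

lemma cst_OP: "j \<in> \<Omega> n \<Longrightarrow> cst n j \<in> OP n"
  unfolding cst_def by (rule full_map_mono_OP) auto

lemma cst_simps [simp]: "i \<in> \<Omega> n \<Longrightarrow> cst n j i = Some j" "i \<notin> \<Omega> n \<Longrightarrow> cst n j i = None"
  by (simp_all add: cst_def)

lemma FT_cst: "s \<in> FT n \<Longrightarrow> j \<in> \<Omega> n \<Longrightarrow> s \<Zsemi> cst n j = cst n j"
proof (rule ext)
  fix i assume s: "s \<in> FT n" "j \<in> \<Omega> n"
  show "(s \<Zsemi> cst n j) i = cst n j i"
  proof (cases "i \<in> \<Omega> n")
    case True
    then obtain k where "k \<in> \<Omega> n" "s i = Some k" using FT_D[OF s(1)] by blast
    then show ?thesis using True by simp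
  next
    case False
    then have "s i = None" using s(1) by (auto simp: FT_def)
    then show ?thesis using False by simp
  qed
qed

lemma cst_mult: "s i = Some j \<Longrightarrow> cst n i \<Zsemi> s = cst n j"
  by (rule ext) (auto simp: cst_def full_map_def)

lemma OP_two_values:
  assumes "j \<in> \<Omega> n" "j' \<in> \<Omega> n" shows "full_map n (\<lambda>x. if x < m then j else j') \<in> OP n"
proof (cases "j \<le> j'")
  case True
  then show ?thesis using assms by (intro full_map_mono_OP) auto
next
  case False
  have FT: "full_map n (\<lambda>x. if x < m then j else j') \<in> FT n" using assms by (intro full_map_FT) auto
  \<comment> \<open>When the values step down at m, cutting the domain at m puts the smaller value
    first.\<close>
  have "cut_mono n m 0 (full_map n (\<lambda>x. if x < m then j else j'))"
    using False unfolding cut_mono_def full_map_Some_iff by (auto simp: cut_key_def \<Omega>_def)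
  then show ?thesis using FT POP_I FT_PT by (auto simp: OP_def)
qed

text \<open>A form of 2-transitivity. In \<open>full_endo\<close> it spreads a coincidence at one
  pair of points to all pairs.\<close>

lemma OP_two_points:
  assumes "i \<in> \<Omega> n" "i' \<in> \<Omega> n" "i \<noteq> i'" "j \<in> \<Omega> n" "j' \<in> \<Omega> n"
  shows "\<exists>s \<in> OP n. s i = Some j \<and> s i' = Some j'"
proof (cases "i < i'")
  case True
  then show ?thesis using OP_two_values[OF assms(4,5), of i'] assms by (intro bexI) auto
next
  case False
  then show ?thesis using OP_two_values[OF assms(5,4), of i] assms by (intro bexI) auto
qed

lemma POR_square: "\<alpha> \<in> POR n \<Longrightarrow> \<alpha> \<Zsemi> \<alpha> \<in> POP n"
  using POP_mult POR_rev_mult POR_iff by blast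

lemma conj_by_hperm: "conj_by n (hperm n) s = hperm n \<Zsemi> s \<Zsemi> hperm n"
proof -
  have "pinv (hperm n) = hperm n"
    by (rule pmap_eqI) (auto simp: pinv_Some_iff[OF hperm_PI] hperm_Some_iff)
  then show ?thesis by (simp add: conj_by_eq hperm_Sym)
qed

locale oriented_monoid =
  fixes n :: nat and S :: "pmap set"
  assumes n3: "n \<ge> 3" and S_cases: "S \<in> {OP n, POPI n, POP n, OR n, PORI n, POR n}"
begin

lemma n0: "n > 0" using n3 by simp

lemma S_POR: "s \<in> S \<Longrightarrow> s \<in> POR n"
  using S_cases POP_subset_POR by (auto simp: OP_def POPI_def OR_def PORI_def)

lemma S_PT: "s \<in> S \<Longrightarrow> s \<in> PT n"
  using S_POR POR_PT by blast

lemma S_mult: "s \<in> S \<Longrightarrow> t \<in> S \<Longrightarrow> s \<Zsemi> t \<in> S"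
  using S_cases POP_mult POR_mult FT_mult PI_mult by (auto simp: OP_def POPI_def OR_def PORI_def)

lemma POP_Sym_S: "s \<in> POP n \<Longrightarrow> s \<in> Sym n \<Longrightarrow> s \<in> S"
  using S_cases POP_subset_POR by (auto simp: OP_def POPI_def OR_def PORI_def Sym_def)

lemma rot_S: "rot n i \<in> S"
  using POP_Sym_S rot_POP rot_Sym by blast

lemma pid_S: "pid n \<in> S"
  using rot_S[of 0] by simp

lemma hperm_S: "S \<in> {OR n, PORI n, POR n} \<Longrightarrow> hperm n \<in> S"
  using hperm_POR hperm_FT hperm_PI by (auto simp: OR_def PORI_def)

lemma S_POP: "S \<in> {OP n, POPI n, POP n} \<Longrightarrow> s \<in> S \<Longrightarrow> s \<in> POP n"
  by (auto simp: OP_def POPI_def)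

lemma S_full: "S \<in> {OP n, OR n} \<Longrightarrow> OP n \<subseteq> S \<and> S \<subseteq> FT n"
  using POP_subset_POR by (auto simp: OP_def OR_def)

lemma S_partial: "S \<in> {POPI n, POP n, PORI n, POR n} \<Longrightarrow> POPI n \<subseteq> S"
  using POP_subset_POR by (auto simp: POPI_def PORI_def)

lemma S_pinv: "POPI n \<subseteq> S \<Longrightarrow> s \<in> S \<Longrightarrow> s \<in> PI n \<Longrightarrow> pinv s \<in> S"
proof -
  assume a: "POPI n \<subseteq> S" "s \<in> S" "s \<in> PI n"
  \<comment> \<open>The empty map lies in \<open>POPI n\<close> but is not full; this excludes the
    two monoids of full maps.\<close>
  have "rid {} \<in> POPI n" using rid_PI rid_POP by (auto simp: POPI_def)
  then have "rid {} \<in> S" using a by blast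
  moreover have "rid {} \<notin> FT n" using n3 by (auto simp: FT_def rid_def \<Omega>_def)
  ultimately have "S \<noteq> OP n" "S \<noteq> OR n" by (auto simp: OP_def OR_def)
  then show ?thesis using S_cases a POP_pinv[of s n] POR_pinv[of s n] pinv_PI[of s n] by (auto simp: POPI_def PORI_def)
qed

lemma S_Sym_cases:
  assumes "s \<in> S" "s \<in> Sym n"
  shows "\<exists>i<n. s = rot n i \<or> hperm n \<in> S \<and> s = hperm n \<Zsemi> rot n i"
proof (cases "S \<in> {OP n, POPI n, POP n}")
  case True
  then show ?thesis using S_POP assms POP_Sym_rot n0 by blast
next
  case False
  then have "hperm n \<in> S" using S_cases hperm_S by blast
  then show ?thesis using POR_Sym_cases[OF S_POR[OF assms(1)] assms(2) n0] by blast
qed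

lemma J_set_eq: "J_set n S = S \<inter> Sym n"
  using rank_full_iff S_PT by (auto simp: J_set_def)

lemma I_set_eq: "I_set (n - 1) S = S - Sym n"
proof -
  have "rank s \<le> n - 1 \<longleftrightarrow> s \<notin> Sym n" if "s \<in> S" for s
    using rank_full_iff[OF S_PT[OF that]] rank_le[OF S_PT[OF that]] n3 by auto
  then show ?thesis by (auto simp: I_set_def)
qed

lemma Sym_mult_iff:
  assumes "s \<in> S" "t \<in> S" shows "s \<Zsemi> t \<in> Sym n \<longleftrightarrow> s \<in> Sym n \<and> t \<in> Sym n"
proof
  assume "s \<Zsemi> t \<in> Sym n"
  then have "rank (s \<Zsemi> t) = n" using rank_full_iff[OF PT_mult] assms S_PT by blast
  then have "rank s = n" "rank t = n"
    using rank_mult_le1[of s n t] rank_mult_le2[of t n s] rank_le[of s n] rank_le[of t n] assms S_PT by force+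
  then show "s \<in> Sym n \<and> t \<in> Sym n" using rank_full_iff assms S_PT by blast
qed (simp add: Sym_mult)

lemma Dih_cases: "\<sigma> \<in> Dih n \<Longrightarrow> \<exists>i<n. \<sigma> = rot n i \<or> \<sigma> = hperm n \<Zsemi> rot n i"
  using POR_Sym_cases n0 by (auto simp: Dih_eq)

lemma Dih_Sym: "\<sigma> \<in> Dih n \<Longrightarrow> \<sigma> \<in> Sym n"
  using n0 by (simp add: Dih_eq)

lemma conj_by_S:
  assumes "\<sigma> \<in> Dih n" "s \<in> S" shows "conj_by n \<sigma> s \<in> S"
proof -
  have rot: "conj_by n (rot n i) t \<in> S" if "t \<in> S" for i t
  proof -
    have "pinv (rot n i) \<in> S" using POP_Sym_S POP_pinv rot_POP rot_Sym Sym_PI pinv_Sym by blast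
    then show ?thesis using that by (simp add: conj_by_eq rot_Sym S_mult rot_S)
  qed
  have h: "hperm n \<Zsemi> s \<Zsemi> hperm n \<in> S"
  proof -
    have "s \<in> FT n \<Longrightarrow> hperm n \<Zsemi> s \<Zsemi> hperm n \<in> FT n" "s \<in> PI n \<Longrightarrow> hperm n \<Zsemi> s \<Zsemi> hperm n \<in> PI n"
      "s \<in> POP n \<Longrightarrow> hperm n \<Zsemi> s \<Zsemi> hperm n \<in> POP n" "s \<in> POR n \<Longrightarrow> hperm n \<Zsemi> s \<Zsemi> hperm n \<in> POR n"
      by (auto intro: FT_mult PI_mult POR_mult hperm_conj_POP hperm_POR hperm_FT hperm_PI)
    then show ?thesis using S_cases assms(2) by (auto simp: OP_def POPI_def OR_def PORI_def)
  qed
  obtain i where "\<sigma> = rot n i \<or> \<sigma> = hperm n \<Zsemi> rot n i" using Dih_cases assms by blast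
  then show ?thesis
  proof
    assume "\<sigma> = hperm n \<Zsemi> rot n i"
    then have "conj_by n \<sigma> s = conj_by n (rot n i) (hperm n \<Zsemi> s \<Zsemi> hperm n)"
      by (simp add: conj_by_conj_by hperm_Sym rot_Sym flip: conj_by_hperm)
    then show ?thesis using rot h by simp
  qed (use rot assms in simp)
qed

text \<open>The test map for \<open>conj_closed_Dih\<close>: the only moved point goes to a
  neighbour. In the partial monoids n - 1 is left out of the domain, so that the map is injective
  and lies in \<open>POPI n\<close>.\<close>

lemma fold_map_S:
  obtains u where "u \<in> S" "u n = Some (n - 1)" "\<And>i. i \<in> \<Omega> n \<Longrightarrow> i \<noteq> n \<Longrightarrow> i \<noteq> n - 1 \<Longrightarrow> u i = Some i"
proof -
  have t: "trunc n (n - 1) \<in> OP n" using n3 by (intro trunc_OP) simp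
  consider "S \<in> {OP n, OR n}" | "S \<in> {POPI n, POP n, PORI n, POR n}" using S_cases by blast
  then show ?thesis
  proof cases
    case 1
    then have "trunc n (n - 1) \<in> S" using t S_full by blast
    moreover have "trunc n (n - 1) i = Some (min i (n - 1))" if "i \<in> \<Omega> n" for i using that by (simp add: trunc_def)
    ultimately show ?thesis using n3 by (intro that[of "trunc n (n - 1)"]) (auto simp: \<Omega>_def)
  next
    case 2
    define u where "u = rid (\<Omega> n - {n - 1}) \<Zsemi> trunc n (n - 1)"
    have val: "u i = (if i = n - 1 \<or> i \<notin> \<Omega> n then None else Some (if i = n then n - 1 else i))" for i
      by (auto simp: u_def rid_def trunc_def \<Omega>_def)
    have POP: "u \<in> POP n" using t rid_POP[of "\<Omega> n - {n - 1}" n] POP_mult by (auto simp: OP_def u_def)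
    moreover have "u \<in> PI n" using POP_PT[OF POP] unfolding PI_iff val by (auto split: if_splits)
    ultimately have "u \<in> S" using S_partial[OF 2] by (auto simp: POPI_def)
    moreover have "n \<in> \<Omega> n" "n \<noteq> n - 1" using n3 by (auto simp: \<Omega>_def)
    ultimately show ?thesis by (intro that[of u]) (simp_all add: val)
  qed
qed

text \<open>By \<open>normalizer_sigma\<close> the permutation is a progression with some step k.
  The conjugate of the test map sends \<open>c n\<close> to \<open>c (n - 1)\<close> and fixes all
  points besides these two, so the two are adjacent by \<open>POR_fix_adjacent\<close>. They are
  also consecutive terms of the progression, whence k is 1 or -1 modulo n.\<close>

lemma conj_closed_Dih:
  assumes c: "c \<in> \<Omega> n \<rightarrow> \<Omega> n" "inj_on c (\<Omega> n)" and cl: "\<And>s. s \<in> S \<Longrightarrow> conj_by n (full_map n c) s \<in> S"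
  shows "full_map n c \<in> Dih n"
proof -
  let ?\<sigma> = "full_map n c"
  have \<sigma>: "?\<sigma> \<in> Sym n" by (rule full_map_Sym[OF c])
  have "rot n 1 \<Zsemi> ?\<sigma> = ?\<sigma> \<Zsemi> conj_by n ?\<sigma> (rot n 1)" using conj_by_intertwine[OF \<sigma> rot_PT] by simp
  from normalizer_sigma[OF n3 c S_POR[OF cl[OF rot_S]] this]
  obtain k where k: "1 \<le> k" "k < n" "gcd k n = 1" "?\<sigma> = sigma n (c 1) k"
    "\<And>i. 1 \<le> i \<Longrightarrow> i \<le> n \<Longrightarrow> c i = (c 1 - 1 + (i - 1) * k) mod n + 1" by blast
  have "k = 1 \<or> k = n - 1"
  proof (cases "n \<ge> 5")
    \<comment> \<open>The only residues prime to 3 or to 4 are 1 and -1, so the gcd condition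
      suffices.\<close>
    case False
    then have "n = 3 \<or> n = 4" using n3 by auto
    moreover have "gcd 2 (4::nat) \<noteq> 1" by (simp add: gcd_non_0_nat)
    ultimately show ?thesis using k(1-3) by (auto simp: numeral_3_eq_3 numeral_eq_Suc less_Suc_eq)
  next
    case True
    obtain u where u: "u \<in> S" "u n = Some (n - 1)" "\<And>i. i \<in> \<Omega> n \<Longrightarrow> i \<noteq> n \<Longrightarrow> i \<noteq> n - 1 \<Longrightarrow> u i = Some i"
      by (rule fold_map_S) blast
    let ?v = "conj_by n ?\<sigma> u"
    have v: "?v (c i) = Some (c j)" if "i \<in> \<Omega> n" "u i = Some j" for i j
    proof -
      have "j \<in> \<Omega> n" using that S_PT[OF u(1)] PT_D by blast
      moreover have "(?\<sigma> \<Zsemi> ?v) i = (u \<Zsemi> ?\<sigma>) i" using conj_by_intertwine[OF \<sigma> S_PT[OF u(1)]] by simp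
      ultimately show ?thesis using that by simp
    qed
    have nn: "n \<in> \<Omega> n" "n - 1 \<in> \<Omega> n" using n3 by (auto simp: \<Omega>_def)
    have surj: "c ` \<Omega> n = \<Omega> n" using c by (intro card_subset_eq) (auto simp: card_image)
    have "c (n - 1) = c n mod n + 1 \<or> c n = c (n - 1) mod n + 1"
    proof (rule POR_fix_adjacent[OF True S_POR[OF cl[OF u(1)]]])
      show "c n \<in> \<Omega> n" "c (n - 1) \<in> \<Omega> n" using c(1) nn by auto
      show "c n \<noteq> c (n - 1)" using inj_onD[OF c(2) _ nn] n3 by fastforce
      show "?v (c n) = Some (c (n - 1))" using v nn u(2) by blast
      fix p assume p: "p \<in> \<Omega> n" "p \<noteq> c n" "p \<noteq> c (n - 1)"
      then obtain i where "i \<in> \<Omega> n" "p = c i" using surj by blast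
      then show "?v p = Some p" using v u(3) p by blast
    qed
    moreover have cn: "c n = (c (n - 1) - 1 + k) mod n + 1"
    proof -
      have "c (n - 1) - 1 = (c 1 - 1 + (n - 2) * k) mod n" using k(5)[of "n - 1"] n3 by (simp add: numeral_2_eq_2)
      then have "(c (n - 1) - 1 + k) mod n = (c 1 - 1 + (n - 2) * k + k) mod n" by (simp only: mod_add_left_eq)
      moreover have "(n - 2) * k + k = (n - 1) * k" using n3 by (cases n) (auto simp: algebra_simps dest!: Suc_le_D)
      ultimately show ?thesis using k(5)[of n] n3 by (simp add: add.assoc)
    qed
    moreover have c1: "1 \<le> c (n - 1)" "c (n - 1) \<le> n" "1 \<le> c n" using c(1) nn by (auto simp: \<Omega>_def Pi_def)
    ultimately consider (a) "c (n - 1) = c n mod n + 1" | (b) "(c (n - 1) - 1 + k) mod n = c (n - 1) mod n" by auto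
    then show ?thesis
    proof cases
      case a
      have "c n mod n = ((c (n - 1) - 1 + k) mod n + 1) mod n" using cn by simp
      also have "\<dots> = (c (n - 1) - 1 + (k + 1)) mod n" by (simp only: mod_add_left_eq add.assoc)
      finally have "c n mod n = (c (n - 1) - 1 + (k + 1)) mod n" .
      moreover have "c (n - 1) - 1 = c n mod n" using a by (metis add_diff_cancel_right')
      ultimately have "c (n - 1) - 1 = (c (n - 1) - 1 + (k + 1)) mod n" by presburger
      moreover have "c (n - 1) - 1 < n" using c1 by simp
      ultimately have "(c (n - 1) - 1 + 0) mod n = (c (n - 1) - 1 + (k + 1)) mod n" by (metis add.right_neutral mod_less)
      then have "0 mod n = (k + 1) mod n" by (simp only: mod_add_lcancel)
      then have "(k + 1) mod n = 0" by simp
      then have "n dvd k + 1" by (simp only: mod_eq_0_iff_dvd)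
      then have "n \<le> k + 1" by (rule dvd_imp_le) simp
      then have "k = n - 1" using k(1,2) by linarith
      then show ?thesis by simp
    next
      case b
      moreover have "c (n - 1) = c (n - 1) - 1 + 1" using c1(1) by simp
      ultimately have "(c (n - 1) - 1 + k) mod n = (c (n - 1) - 1 + 1) mod n" by presburger
      then have "k mod n = 1 mod n" by (simp only: mod_add_lcancel)
      then show ?thesis using k(1,2) n3 by simp
    qed
  qed
  moreover have "c 1 \<in> \<Omega> n" using c(1) n3 by (auto simp: \<Omega>_def)
  ultimately show ?thesis unfolding k(4) by (intro sigma_Dih n3)
qed

end

locale oriented_endo = oriented_monoid +
  fixes \<phi> :: "pmap \<Rightarrow> pmap"
  assumes hom: "\<phi> \<in> hom (Mon n S) (Mon n S)"
begin

lemma phi_S: "s \<in> S \<Longrightarrow> \<phi> s \<in> S"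
  using hom by (auto simp: hom_def)

lemma phi_mult: "s \<in> S \<Longrightarrow> t \<in> S \<Longrightarrow> \<phi> (s \<Zsemi> t) = \<phi> s \<Zsemi> \<phi> t"
  using hom by (auto simp: hom_def)

lemma phi_PT: "s \<in> S \<Longrightarrow> \<phi> s \<in> PT n"
  using phi_S S_PT by blast

lemma phi_rot: "\<phi> (rot n i) \<Zsemi> \<phi> (rot n j) = \<phi> (rot n (i + j))"
  by (simp add: phi_mult rot_S flip: rot_mult)

lemma ppow_phi_rot: "k > 0 \<Longrightarrow> ppow (\<phi> (rot n i)) k = \<phi> (rot n (k * i))"
proof (induction k)
  case (Suc k)
  then show ?case by (cases "k = 0") (simp_all add: phi_rot add.commute)
qed simp

lemma phi_pid_mult: "s \<in> S \<Longrightarrow> \<phi> (pid n) \<Zsemi> \<phi> s = \<phi> s" "s \<in> S \<Longrightarrow> \<phi> s \<Zsemi> \<phi> (pid n) = \<phi> s"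
  by (simp_all add: pid_S S_PT flip: phi_mult)

subsection \<open>Full transformations\<close>

text \<open>If \<open>\<phi>\<close> is constant on the constant maps, \<open>\<phi> (g\<^sup>2)\<close> fixes a point and hence equals \<open>\<phi> 1\<close>;
  conjugating the middle factor in \<open>trunc r \<cdot> trunc r\<close> by \<open>g\<^sup>2\<close> then lowers the rank
  without changing the image under \<open>\<phi>\<close>.\<close>

lemma full_collapse:
  assumes sub: "OP n \<subseteq> S" "S \<subseteq> FT n" and z: "\<And>j. j \<in> \<Omega> n \<Longrightarrow> \<phi> (cst n j) = z"
  shows "s \<in> S \<Longrightarrow> rank s < n \<Longrightarrow> \<phi> s = z"
proof -
  have one: "1 \<in> \<Omega> n" using n3 by (simp add: \<Omega>_def)
  have cst: "cst n j \<in> S" if "j \<in> \<Omega> n" for j using sub cst_OP that by blast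
  have FT: "s \<in> FT n" if "s \<in> S" for s using sub that by blast
  have zl: "\<phi> s \<Zsemi> z = z" if "s \<in> S" for s
    using phi_mult[OF that cst[OF one]] FT_cst[OF FT[OF that] one] z[OF one] by simp
  have zr: "z \<Zsemi> \<phi> s = z" if s: "s \<in> S" for s
  proof -
    obtain j where j: "j \<in> \<Omega> n" "s 1 = Some j" using FT_D[OF FT[OF s] one] by blast
    then show ?thesis using phi_mult[OF cst[OF one] s] cst_mult[of s 1 j n] z[OF one] z[OF j(1)] by simp
  qed
  have "z \<in> S" using phi_S[OF cst[OF one]] z[OF one] by simp
  then obtain a where a: "a \<in> \<Omega> n" "z 1 = Some a" using FT_D FT one by blast
  \<comment> \<open>As \<open>z\<close> absorbs all images from the left factor, each point of its
    image is a common fixed point.\<close>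
  have fixes_a: "\<phi> s a = Some a" if "s \<in> S" for s
  proof -
    have "(z \<Zsemi> \<phi> s) 1 = Some a" using zr[OF that] a by simp
    then show ?thesis using a by simp
  qed
  define y where "y = \<phi> (rot n 2)"
  \<comment> \<open>A square preserves orientation even if \<open>\<phi> (rot n 1)\<close> reverses
    it; hence the use of the second power of g.\<close>
  have y2: "y = \<phi> (rot n 1) \<Zsemi> \<phi> (rot n 1)" unfolding y_def phi_rot one_add_one ..
  have "y \<in> POP n" unfolding y2 using POR_square S_POR phi_S rot_S by blast
  moreover have "y \<Zsemi> ppow y n = y"
    unfolding y_def ppow_phi_rot[OF n0] phi_rot
    by (rule arg_cong[of _ _ \<phi>], rule rot_cong, rule mod_mult_self2)
  ultimately have yy: "y \<Zsemi> y = y"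
    using POP_fixpoint_idempotent[of y n a n] fixes_a[OF rot_S, of 2] n0 unfolding y_def by blast
  have "ppow y k = y" if "k > 0" for k
    using that by (induction k) (auto simp: yy, metis One_nat_def Some_mult(1) bot_nat_0.not_eq_extremum ppow.simps(1) yy)
  then have "y = \<phi> (rot n (n * 2))" using ppow_phi_rot[OF n0, of 2] n0 unfolding y_def by metis
  moreover have "rot n (n * 2) = pid n" using rot_cong[of "n * 2" n 0] by simp
  ultimately have E2: "\<phi> (rot n 2) = \<phi> (pid n)" by (simp add: y_def)
  have "\<phi> (rot n (n - 2)) = \<phi> (rot n (n - 2)) \<Zsemi> \<phi> (rot n 2)"
    unfolding E2 using phi_pid_mult(2) rot_S by simp
  also have "\<dots> = \<phi> (rot n n)" unfolding phi_rot using n3 by (simp only: le_add_diff_inverse2[of 2 n])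
  finally have En: "\<phi> (rot n (n - 2)) = \<phi> (pid n)" by simp
  have trunc_S: "trunc n r \<in> S" if "r \<ge> 1" for r using trunc_OP that sub by blast
  show "s \<in> S \<Longrightarrow> rank s < n \<Longrightarrow> \<phi> s = z"
  proof (induction "rank s" arbitrary: s rule: less_induct)
    case less
    have s: "s \<in> S" "s \<in> FT n" using less(2) FT by blast+
    define r where "r = rank s"
    have r: "r \<ge> 1" "r < n" using FT_factor(1)[OF s(2) n0] less(3) by (simp_all add: r_def)
    show ?case
    proof (cases "r = 1")
      case True
      then obtain j where j: "ran s = {j}" unfolding r_def rank_def by (rule card_1_singletonE)
      have "s = cst n j"
      proof (rule ext)
        fix i
        show "s i = cst n j i"
        proof (cases "i \<in> \<Omega> n")
          case True
          then obtain k where k: "s i = Some k" using FT_D s by blast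
          then have "k \<in> ran s" by (auto simp: ran_def)
          then show ?thesis using True k j by simp
        next
          case False
          then have "s i = None" using s(2) by (auto simp: FT_def)
          then show ?thesis using False by simp
        qed
      qed
      moreover have "j \<in> \<Omega> n" using j S_PT[OF s(1)] by (auto simp: PT_def)
      ultimately show ?thesis using z by simp
    next
      case False
      then have r2: "r \<ge> 2" using r by simp
      define t where "t = trunc n r \<Zsemi> rot n (n - 2) \<Zsemi> trunc n r \<Zsemi> rot n 2"
      have e: "trunc n r \<in> S" using trunc_S r by blast
      have t: "t \<in> S" unfolding t_def by (intro S_mult e rot_S)
      have phi_t: "\<phi> t = \<phi> (trunc n r)"
      proof -
        have "\<phi> t = \<phi> (trunc n r) \<Zsemi> \<phi> (pid n) \<Zsemi> \<phi> (trunc n r) \<Zsemi> \<phi> (pid n)"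
          unfolding t_def using e by (simp add: phi_mult S_mult rot_S E2 En)
        also have "\<dots> = \<phi> (trunc n r) \<Zsemi> \<phi> (trunc n r)" using e by (simp add: phi_pid_mult pmult_assoc)
        also have "\<dots> = \<phi> (trunc n r \<Zsemi> trunc n r)" using e by (simp add: phi_mult)
        also have "trunc n r \<Zsemi> trunc n r = trunc n r"
          unfolding trunc_def using r by (subst full_map_mult) (auto simp: \<Omega>_def intro!: full_map_cong)
        finally show ?thesis .
      qed
      have "rank t < r"
      proof -
        define w where "w i = min ((i - 1 + (n - 2)) mod n + 1) r" for i
        \<comment> \<open>The rotation by n - 2 takes 1 and 2 to n - 1 and n, and both are truncated
          to r since r < n. So one of the r values is lost.\<close>
        have w1: "w 1 = r" "w 2 = r" using r r2 n3 by (auto simp: w_def)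
        have "ran (trunc n r \<Zsemi> rot n (n - 2) \<Zsemi> trunc n r) \<subseteq> w ` {1..r}"
        proof
          fix v assume "v \<in> ran (trunc n r \<Zsemi> rot n (n - 2) \<Zsemi> trunc n r)"
          then obtain i where "(trunc n r \<Zsemi> rot n (n - 2) \<Zsemi> trunc n r) i = Some v" by (auto simp: ran_def)
          then have "i \<in> \<Omega> n" "v = w (min i r)"
            using r by (auto simp: map_comp_Some_iff trunc_def full_map_Some_iff w_def rot_def)
          then show "v \<in> w ` {1..r}" using r by (auto simp: \<Omega>_def)
        qed
        also have "w ` {1..r} \<subseteq> w ` {2..r}"
        proof
          fix v assume "v \<in> w ` {1..r}"
          then obtain i where i: "i \<in> {1..r}" "v = w i" by blast
          show "v \<in> w ` {2..r}"
          proof (cases "i = 1")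
            case True
            then have "v = w 2" using i w1 by simp
            then show ?thesis using r2 by simp
          next
            case False
            then show ?thesis using i by auto
          qed
        qed
        finally have "rank (trunc n r \<Zsemi> rot n (n - 2) \<Zsemi> trunc n r) \<le> card (w ` {2..r})"
          unfolding rank_def by (rule card_mono[rotated]) simp
        also have "\<dots> \<le> card {2..r}" by (rule card_image_le) simp
        also have "\<dots> < r" using r by simp
        finally have "rank (trunc n r \<Zsemi> rot n (n - 2) \<Zsemi> trunc n r) < r" .
        moreover have "trunc n r \<Zsemi> rot n (n - 2) \<Zsemi> trunc n r \<in> PT n" using S_PT S_mult e rot_S by blast
        ultimately show ?thesis unfolding t_def using rank_mult_le1 by (metis le_less_trans)
      qed
      then have "\<phi> (trunc n r) = z" using less(1)[of t] t r phi_t by (simp add: r_def)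
      moreover obtain \<beta> \<gamma> where "\<beta> \<in> OP n" "\<gamma> \<in> OP n" and f: "s = s \<Zsemi> \<beta> \<Zsemi> trunc n r \<Zsemi> \<gamma>"
        using FT_factor(2)[OF s(2) n0] unfolding r_def by blast
      then have bc: "\<beta> \<in> S" "\<gamma> \<in> S" using sub by auto
      have "\<phi> s = \<phi> (s \<Zsemi> \<beta>) \<Zsemi> \<phi> (trunc n r) \<Zsemi> \<phi> \<gamma>"
        using phi_mult[of "s \<Zsemi> \<beta> \<Zsemi> trunc n r" \<gamma>] phi_mult[of "s \<Zsemi> \<beta>" "trunc n r"] S_mult bc s(1) e f by metis
      ultimately show ?thesis using zl[OF S_mult[OF s(1) bc(1)]] zr[OF bc(2)] by simp
    qed
  qed
qed

text \<open>The images \<open>\<gamma> j\<close> of the constant maps are observed at one point b at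
  a time. If the values at some b are distinct for distinct j, they exhaust {1..n}, and then each
  \<open>\<gamma> j\<close> is itself constant. If there is a coincidence at every b,
  \<open>OP_two_points\<close> spreads it to all j, so the \<open>\<gamma> j\<close> are all equal
  and \<open>full_collapse\<close> applies.\<close>

lemma full_endo:
  assumes sub: "OP n \<subseteq> S" "S \<subseteq> FT n"
  shows "(\<exists>\<sigma> \<in> Dih n. \<forall>s \<in> S. \<phi> s = conj_by n \<sigma> s) \<or> (\<exists>f. \<forall>s \<in> S. rank s < n \<longrightarrow> \<phi> s = f)"
proof -
  have one: "1 \<in> \<Omega> n" using n3 by (simp add: \<Omega>_def)
  have cst: "cst n j \<in> S" if "j \<in> \<Omega> n" for j using sub cst_OP that by blast
  have FT: "s \<in> FT n" if "s \<in> S" for s using sub that by blast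
  define \<gamma> where "\<gamma> i = \<phi> (cst n i)" for i
  have \<gamma>FT: "\<gamma> i \<in> FT n" if "i \<in> \<Omega> n" for i using FT phi_S cst that by (simp add: \<gamma>_def)
  have act: "\<gamma> i \<Zsemi> \<phi> s = \<gamma> j" if "i \<in> \<Omega> n" "s \<in> S" "s i = Some j" for i j s
    using phi_mult[OF cst[OF that(1)] that(2)] cst_mult[of s i j n, OF that(3)] by (simp add: \<gamma>_def)
  have \<gamma>\<gamma>: "\<gamma> i \<Zsemi> \<gamma> j = \<gamma> j" if "i \<in> \<Omega> n" "j \<in> \<Omega> n" for i j
    using phi_mult[OF cst[OF that(1)] cst[OF that(2)]] FT_cst[OF FT[OF cst[OF that(1)]] that(2)] by (simp add: \<gamma>_def)
  define v where "v b i = the (\<gamma> i b)" for b i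
  have v: "\<gamma> i b = Some (v b i)" "v b i \<in> \<Omega> n" if "i \<in> \<Omega> n" "b \<in> \<Omega> n" for i b
    using FT_D[OF \<gamma>FT[OF that(1)] that(2)] by (auto simp: v_def)
  show ?thesis
  proof (cases "\<exists>b \<in> \<Omega> n. inj_on (v b) (\<Omega> n)")
    case True
    then obtain b where b: "b \<in> \<Omega> n" "inj_on (v b) (\<Omega> n)" by blast
    define c where "c = v b"
    have c: "c \<in> \<Omega> n \<rightarrow> \<Omega> n" "inj_on c (\<Omega> n)" using b v by (auto simp: c_def)
    then have surj: "c ` \<Omega> n = \<Omega> n" by (intro card_subset_eq) (auto simp: card_image)
    \<comment> \<open>Every point d is a value \<open>c i\<close> of some \<open>\<gamma> i\<close>
      at b, so evaluating \<open>\<gamma> i \<Zsemi> \<gamma> j = \<gamma> j\<close> at b determines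
      \<open>\<gamma> j\<close> at d.\<close>
    have \<gamma>c: "\<gamma> j d = Some (c j)" if "j \<in> \<Omega> n" "d \<in> \<Omega> n" for j d
    proof -
      have "d \<in> c ` \<Omega> n" using surj that(2) by simp
      then obtain i where i: "i \<in> \<Omega> n" "d = c i" by blast
      have "(\<gamma> i \<Zsemi> \<gamma> j) b = \<gamma> j b" using \<gamma>\<gamma> i that by simp
      then show ?thesis using v(1)[OF i(1) b(1)] v(1)[OF that(1) b(1)] i(2) by (simp add: c_def)
    qed
    let ?\<sigma> = "full_map n c"
    have \<sigma>: "?\<sigma> \<in> Sym n" by (rule full_map_Sym[OF c])
    have conj: "conj_by n ?\<sigma> s = \<phi> s" if s: "s \<in> S" for s
    proof (rule conj_by_eqI[OF \<sigma> phi_PT[OF s]], rule ext)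
      fix i
      show "(s \<Zsemi> ?\<sigma>) i = (?\<sigma> \<Zsemi> \<phi> s) i"
      proof (cases "i \<in> \<Omega> n")
        case True
        then obtain j where j: "j \<in> \<Omega> n" "s i = Some j" using FT_D[OF FT[OF s]] by blast
        have "(\<gamma> i \<Zsemi> \<phi> s) 1 = \<gamma> j 1" using act[OF True s j(2)] by simp
        then show ?thesis using \<gamma>c[OF True one] \<gamma>c[OF j(1) one] j True by simp
      next
        case False
        then have "s i = None" using FT[OF s] by (auto simp: FT_def)
        then show ?thesis using False by simp
      qed
    qed
    have "?\<sigma> \<in> Dih n" using conj phi_S by (intro conj_closed_Dih[OF c]) simp
    then show ?thesis using conj by metis
  next
    case False
    have const: "v b j = v b j'" if b: "b \<in> \<Omega> n" and j: "j \<in> \<Omega> n" "j' \<in> \<Omega> n" for b j j'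
    proof -
      obtain i i' where i: "i \<in> \<Omega> n" "i' \<in> \<Omega> n" "i \<noteq> i'" "v b i = v b i'"
        using False b unfolding inj_on_def by blast
      obtain s where s: "s \<in> OP n" "s i = Some j" "s i' = Some j'" using OP_two_points[OF i(1,2,3) j] by blast
      then have sS: "s \<in> S" using sub by blast
      have "\<gamma> j b = (\<gamma> i \<Zsemi> \<phi> s) b" "\<gamma> j' b = (\<gamma> i' \<Zsemi> \<phi> s) b" using act[OF _ sS] i s by simp_all
      then have "\<gamma> j b = \<gamma> j' b" using v(1)[OF i(1) b] v(1)[OF i(2) b] i(4) by simp
      then show ?thesis by (simp add: v_def)
    qed
    have eq: "\<gamma> j = \<gamma> 1" if j: "j \<in> \<Omega> n" for j
    proof (rule ext)
      fix b
      show "\<gamma> j b = \<gamma> 1 b"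
      proof (cases "b \<in> \<Omega> n")
        case True
        then show ?thesis using v(1)[OF j True] v(1)[OF one True] const[OF True j one] by simp
      next
        case False
        then have "\<gamma> j b = None" "\<gamma> 1 b = None" using \<gamma>FT[OF j] \<gamma>FT[OF one] by (auto simp: FT_def)
        then show ?thesis by simp
      qed
    qed
    then have "\<phi> s = \<gamma> 1" if "s \<in> S" "rank s < n" for s
      using full_collapse[OF sub _ that, of "\<gamma> 1"] by (simp add: \<gamma>_def)
    then show ?thesis by blast
  qed
qed

end

subsection \<open>Monoids containing the injective maps\<close>

text \<open>Excludes the middle ranks in \<open>level_structure\<close>: there n choose r distinct
  points would have to be found among n.\<close>

lemma choose_gt:
  assumes "2 \<le> r" "r + 2 \<le> n" shows "n choose r > n"
proof -
  have c2: "n choose 2 > n" if "n \<ge> 4"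
  proof -
    have "n * 3 \<le> n * (n - 1)" using that by (intro mult_le_mono2) simp
    then show ?thesis using that unfolding choose_two by linarith
  qed
  have half: "n choose 2 \<le> n choose q" if "2 \<le> q" "2 * q \<le> n" for q
    using that by (intro binomial_mono) auto
  show ?thesis
  proof (cases "2 * r \<le> n")
    case True
    then show ?thesis using half[of r] c2 assms by linarith
  next
    case False
    then have "n choose 2 \<le> n choose (n - r)" using assms by (intro half) auto
    also have "\<dots> = n choose r" using assms by (intro binomial_symmetric[symmetric]) simp
    finally show ?thesis using c2 assms by linarith
  qed
qed

context oriented_endo
begin

context
  assumes sub: "POPI n \<subseteq> S"
begin

lemma rid_S: "A \<subseteq> \<Omega> n \<Longrightarrow> rid A \<in> S"
  using sub rid_POP rid_PI by (auto simp: POPI_def)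

lemma empty_S: "Map.empty \<in> S"
  using rid_S[of "{}"] by (simp add: rid_empty)

lemma zero_left: "s \<in> S \<Longrightarrow> \<phi> Map.empty \<Zsemi> \<phi> s = \<phi> Map.empty"
  using phi_mult[OF empty_S, of s] by (simp add: map_comp_def)

lemma zero_right: "s \<in> S \<Longrightarrow> \<phi> s \<Zsemi> \<phi> Map.empty = \<phi> Map.empty"
  using phi_mult[OF _ empty_S, of s] by simp

lemma zero_ideal:
  assumes "a \<in> S" "b \<in> S" "c \<in> S" "\<phi> b = \<phi> Map.empty" shows "\<phi> (a \<Zsemi> b \<Zsemi> c) = \<phi> Map.empty"
  using assms phi_mult[of "a \<Zsemi> b" c] phi_mult[of a b] zero_left zero_right S_mult by simp

text \<open>The identity on the domain of s is s times its inverse, so it lies in the ideal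
  generated by s and collapses with it.\<close>

lemma PI_nonzero:
  assumes "s \<in> S" "s \<in> PI n" "\<phi> (rid (dom s)) \<noteq> \<phi> Map.empty" shows "\<phi> s \<noteq> \<phi> Map.empty"
proof
  assume a: "\<phi> s = \<phi> Map.empty"
  have "pinv s \<in> S" using S_pinv sub assms by blast
  then have "\<phi> (pid n \<Zsemi> s \<Zsemi> pinv s) = \<phi> Map.empty" using a assms pid_S by (intro zero_ideal) auto
  then show False using assms(3) pinv_right[OF assms(2)] S_PT[OF assms(1)] by simp
qed

text \<open>At the least rank r that is not collapsed, two different sets of size r meet in a
  smaller one, so the images of their partial identities multiply to \<open>z\<close>. A point
  outside \<open>ran z\<close> in the image of one such idempotent is fixed by it, hence lies in no
  other image. These chosen points \<open>c A\<close> are therefore distinct.\<close>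

lemma level_structure:
  assumes "\<not> (\<exists>f. \<forall>s \<in> S. rank s < n \<longrightarrow> \<phi> s = f)"
  obtains r c where "r = 1 \<or> r = n - 1" "\<phi> Map.empty = Map.empty"
    "\<And>s. s \<in> S \<Longrightarrow> rank s < r \<Longrightarrow> \<phi> s = Map.empty"
    "\<And>A. A \<subseteq> \<Omega> n \<Longrightarrow> card A = r \<Longrightarrow> c A \<in> \<Omega> n \<and> \<phi> (rid A) = rid {c A}"
    "inj_on c {A. A \<subseteq> \<Omega> n \<and> card A = r}"
proof -
  define z where "z = \<phi> Map.empty"
  have zS: "z \<in> S" using phi_S empty_S by (simp add: z_def)
  obtain s0 where s0: "s0 \<in> S" "rank s0 < n" "\<phi> s0 \<noteq> z" using assms by blast
  define r where "r = (LEAST k. \<exists>s \<in> S. rank s = k \<and> \<phi> s \<noteq> z)"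
  have low: "\<phi> s = z" if "s \<in> S" "rank s < r" for s
    using not_less_Least[of "rank s" "\<lambda>k. \<exists>s \<in> S. rank s = k \<and> \<phi> s \<noteq> z"] that unfolding r_def by blast
  have "\<exists>s \<in> S. rank s = r \<and> \<phi> s \<noteq> z" unfolding r_def by (rule LeastI_ex) (use s0 in blast)
  then obtain s1 where s1: "s1 \<in> S" "rank s1 = r" "\<phi> s1 \<noteq> z" by blast
  have rn: "r < n" using low s0 by (meson le_less_trans not_le)
  have r0: "r \<noteq> 0"
  proof
    assume "r = 0"
    then have "ran s1 = {}" using s1 finite_ran[OF S_PT[OF s1(1)]] by (simp add: rank_def)
    then have "s1 = Map.empty" by (auto simp: ran_def fun_eq_iff) (metis not_None_eq)
    then show False using s1 by (simp add: z_def)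
  qed
  have seg: "{1..r} \<subseteq> \<Omega> n" using rn by (auto simp: \<Omega>_def)
  have seg_nz: "\<phi> (rid {1..r}) \<noteq> z"
  proof
    assume a: "\<phi> (rid {1..r}) = z"
    have R: "ran s1 \<subseteq> \<Omega> n" using S_PT[OF s1(1)] by (simp add: PT_def)
    have "\<phi> (s1 \<Zsemi> ppos (ran s1) \<Zsemi> rid {1..r} \<Zsemi> pinv (ppos (ran s1))) = z"
      unfolding z_def using a ppos_POPI[OF R] pinv_ppos_POPI[OF R] sub s1(1) rid_S[OF seg]
      by (intro zero_ideal) (auto simp: z_def intro: S_mult)
    then show False using PT_factor[OF S_PT[OF s1(1)]] s1 by simp
  qed
  define F where "F = {A. A \<subseteq> \<Omega> n \<and> card A = r}"
  define \<epsilon> where "\<epsilon> A = \<phi> (rid A)" for A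
  have nz: "\<epsilon> A \<noteq> z" if "A \<in> F" for A
  proof
    assume a: "\<epsilon> A = z"
    have A: "A \<subseteq> \<Omega> n" "card A = r" using that by (auto simp: F_def)
    have "\<phi> (pinv (ppos A) \<Zsemi> rid A \<Zsemi> ppos A) = z"
      unfolding z_def using a ppos_POPI[OF A(1)] pinv_ppos_POPI[OF A(1)] sub rid_S[OF A(1)]
      by (intro zero_ideal) (auto simp: z_def \<epsilon>_def)
    then show False using seg_nz rid_segment_factor[OF A(1)] A(2) by simp
  qed
  have prod: "\<epsilon> A \<Zsemi> \<epsilon> B = z" if "A \<in> F" "B \<in> F" "A \<noteq> B" for A B
  proof -
    have AB: "A \<subseteq> \<Omega> n" "B \<subseteq> \<Omega> n" "card A = r" "card B = r" using that by (auto simp: F_def)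
    have "\<not> A \<subseteq> B"
      using card_subset_eq[of B A] finite_subset[OF AB(2) finite_Omega] AB(3,4) that(3) by auto
    then have "A \<inter> B \<subset> A" by blast
    then have "card (A \<inter> B) < r" using psubset_card_mono[of A] finite_subset[OF AB(1) finite_Omega] AB(3) by blast
    moreover have "A \<inter> B \<subseteq> \<Omega> n" using AB by blast
    ultimately have "\<phi> (rid (A \<inter> B)) = z" using low rid_S by simp
    then show ?thesis using phi_mult[OF rid_S[OF AB(1)] rid_S[OF AB(2)]] by (simp add: \<epsilon>_def rid_mult)
  qed
  have idem: "\<epsilon> A \<Zsemi> \<epsilon> A = \<epsilon> A" if "A \<subseteq> \<Omega> n" for A
    using phi_mult[OF rid_S[OF that] rid_S[OF that]] by (simp add: \<epsilon>_def rid_mult)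
  have fixpt: "e x = Some x" if "e \<Zsemi> e = e" "x \<in> ran e" for e :: pmap and x
  proof -
    have "\<exists>w. e w = Some x" using that(2) by (simp add: ran_def)
    then obtain w where w: "e w = Some x" by blast
    then have "(e \<Zsemi> e) w = Some x" using that(1) by simp
    then show ?thesis using w by simp
  qed
  have zz: "z \<Zsemi> z = z" using zero_left[OF empty_S] by (simp add: z_def)
  have \<epsilon>z: "\<epsilon> A \<Zsemi> z = z" if "A \<subseteq> \<Omega> n" for A
    using zero_right[OF rid_S[OF that]] by (simp add: z_def \<epsilon>_def)
  have Fsub: "A \<subseteq> \<Omega> n" if "A \<in> F" for A using that by (simp add: F_def)
  define c where "c A = (SOME y. y \<in> ran (\<epsilon> A) - ran z)" for A
  \<comment> \<open>Otherwise \<open>z\<close> fixes the image of \<open>\<epsilon> A\<close>, and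
    then \<open>\<epsilon> A = \<epsilon> A \<Zsemi> z = z\<close>.\<close>
  have "ran (\<epsilon> A) - ran z \<noteq> {}" if A: "A \<in> F" for A
  proof
    assume "ran (\<epsilon> A) - ran z = {}"
    then have zy: "z y = Some y" if "y \<in> ran (\<epsilon> A)" for y using that fixpt[OF zz] by blast
    have "(\<epsilon> A \<Zsemi> z) x = \<epsilon> A x" for x by (cases "\<epsilon> A x") (simp_all add: zy ranI)
    then have "\<epsilon> A \<Zsemi> z = \<epsilon> A" by (rule ext)
    then show False using \<epsilon>z[OF Fsub[OF A]] nz[OF A] by simp
  qed
  then have c: "c A \<in> ran (\<epsilon> A) - ran z" if "A \<in> F" for A
    unfolding c_def using that by (meson ex_in_conv someI_ex)
  have disj: "A = B" if "A \<in> F" "B \<in> F" "y \<in> ran (\<epsilon> A) - ran z" "y \<in> ran (\<epsilon> B)" for A B y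
  proof (rule ccontr)
    assume "A \<noteq> B"
    have "\<epsilon> A y = Some y" "\<epsilon> B y = Some y" using fixpt[OF idem[OF Fsub]] that by auto
    then have "(\<epsilon> A \<Zsemi> \<epsilon> B) y = Some y" by simp
    then have "z y = Some y" using prod[OF that(1,2) \<open>A \<noteq> B\<close>] by simp
    then show False using that(3) by (auto simp: ran_def)
  qed
  have inj: "inj_on c F"
  proof (rule inj_onI)
    fix A B assume a: "A \<in> F" "B \<in> F" "c A = c B"
    show "A = B" by (rule disj[OF a(1,2) c[OF a(1)]]) (use c[OF a(2)] a(3) in simp)
  qed
  have im: "c ` F \<subseteq> \<Omega> n - ran z"
  proof (rule image_subsetI)
    fix A assume A: "A \<in> F"
    have "ran (\<epsilon> A) \<subseteq> \<Omega> n" using phi_PT[OF rid_S[OF Fsub[OF A]]] by (simp add: \<epsilon>_def PT_def)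
    then show "c A \<in> \<Omega> n - ran z" using c[OF A] by blast
  qed
  have cF: "card F = n choose r" unfolding F_def using n_subsets[OF finite_Omega, of n r] by simp
  have le: "card F \<le> card (\<Omega> n - ran z)" using card_inj_on_le[OF inj im] by simp
  also have "\<dots> \<le> n" using card_mono[of "\<Omega> n" "\<Omega> n - ran z"] by simp
  finally have Fn: "card F \<le> n" .
  then have "\<not> (2 \<le> r \<and> r + 2 \<le> n)" using choose_gt[of r n] unfolding cF by linarith
  then have r: "r = 1 \<or> r = n - 1" using rn r0 by linarith
  \<comment> \<open>Now the bound is attained. All n points lie outside \<open>ran z\<close>, so
    \<open>z\<close> is empty; and \<open>c\<close> is onto, so no image of an
    \<open>\<epsilon> A\<close> has room for a second point.\<close>
  then have cFn: "card F = n" using cF n3 choose_one[of n] binomial_symmetric[of 1 n] by auto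
  have "ran z \<subseteq> \<Omega> n" using S_PT[OF zS] by (simp add: PT_def)
  moreover have "\<Omega> n - ran z = \<Omega> n" using le cFn by (intro card_seteq) auto
  ultimately have "ran z = {}" by blast
  then have z: "z = Map.empty" by (auto simp: ran_def fun_eq_iff) (metis not_None_eq)
  have surj: "c ` F = \<Omega> n" using im cFn card_image[OF inj] by (intro card_subset_eq) auto
  have form: "\<epsilon> A = rid {c A}" if A: "A \<in> F" for A
  proof (rule pmap_eqI)
    fix x y
    have ran: "y = c A" if "y \<in> ran (\<epsilon> A)" for y
    proof -
      have "y \<in> \<Omega> n" using that phi_PT[OF rid_S[OF Fsub[OF A]]] unfolding \<epsilon>_def PT_def by blast
      then obtain B where B: "B \<in> F" "y = c B" using surj by blast
      then have "B = A" using disj[OF B(1) A] c[OF B(1)] that by blast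
      then show ?thesis using B by simp
    qed
    show "\<epsilon> A x = Some y \<longleftrightarrow> rid {c A} x = Some y"
    proof
      assume xy: "\<epsilon> A x = Some y"
      then have y: "y = c A" using ran by (auto simp: ran_def)
      have "x \<in> \<Omega> n" using xy PT_D[OF phi_PT[OF rid_S[OF Fsub[OF A]]]] unfolding \<epsilon>_def by blast
      then obtain B where B: "B \<in> F" "x = c B" using surj by blast
      have "\<epsilon> B x = Some x" using fixpt[OF idem[OF Fsub[OF B(1)]]] c[OF B(1)] B(2) by blast
      then have "(\<epsilon> B \<Zsemi> \<epsilon> A) x = Some y" using xy by simp
      \<comment> \<open>For B different from A the product would be empty, although it is defined at
        x.\<close>
      then have "B = A" using prod[OF B(1) A] z by fastforce
      then show "rid {c A} x = Some y" using B y by simp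
    next
      assume "rid {c A} x = Some y"
      then show "\<epsilon> A x = Some y" using fixpt[OF idem[OF Fsub[OF A]]] c[OF A] by simp
    qed
  qed
  show ?thesis
  proof (rule that[OF r])
    show "\<phi> Map.empty = Map.empty" using z by (simp add: z_def)
    show "\<phi> s = Map.empty" if "s \<in> S" "rank s < r" for s using low z that by simp
    show "c A \<in> \<Omega> n \<and> \<phi> (rid A) = rid {c A}" if "A \<subseteq> \<Omega> n" "card A = r" for A
      using form[of A] im that unfolding \<epsilon>_def F_def by blast
    show "inj_on c {A. A \<subseteq> \<Omega> n \<and> card A = r}" using inj by (simp add: F_def)
  qed
qed

text \<open>Covers both levels: \<open>A i = {i}\<close> with \<open>\<psi> s = s\<close>, and \<open>A i = \<Omega> n - {i}\<close> with \<open>\<psi> = \<phi>\<^sub>0\<close>.\<close>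

lemma level_conj:
  assumes empty: "\<phi> Map.empty = Map.empty"
    and A: "\<And>i. i \<in> \<Omega> n \<Longrightarrow> A i \<subseteq> \<Omega> n" "\<And>i. i \<in> \<Omega> n \<Longrightarrow> \<phi> (rid (A i)) = rid {c i}"
    and c: "c \<in> \<Omega> n \<rightarrow> \<Omega> n" "inj_on c (\<Omega> n)"
    and \<psi>_def: "\<And>i k. \<psi> i = Some k \<Longrightarrow> i \<in> \<Omega> n \<and> k \<in> \<Omega> n \<and> rid (A i) \<Zsemi> s \<in> PI n \<and>
        dom (rid (A i) \<Zsemi> s) = A i \<and> ran (rid (A i) \<Zsemi> s) = A k"
    and \<psi>_undef: "\<And>i. i \<in> \<Omega> n \<Longrightarrow> \<psi> i = None \<Longrightarrow> \<phi> (rid (A i) \<Zsemi> s) = Map.empty"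
    and s: "s \<in> S"
  shows "\<phi> s = conj_by n (full_map n c) \<psi>"
proof (rule conj_by_eqI[symmetric, OF full_map_Sym[OF c] phi_PT[OF s]], rule ext)
  fix i
  show "(\<psi> \<Zsemi> full_map n c) i = (full_map n c \<Zsemi> \<phi> s) i"
  proof (cases "i \<in> \<Omega> n")
    case True
    have ph: "\<phi> (rid (A i) \<Zsemi> s) = rid {c i} \<Zsemi> \<phi> s" using phi_mult[OF rid_S[OF A(1)[OF True]] s] A(2)[OF True] by simp
    show ?thesis
    proof (cases "\<psi> i")
      case None
      have e: "rid {c i} \<Zsemi> \<phi> s = Map.empty" using ph \<psi>_undef[OF True None] by simp
      have "(rid {c i} \<Zsemi> \<phi> s) (c i) = None" unfolding e by simp
      then have "\<phi> s (c i) = None" by (simp add: rid_def)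
      then show ?thesis using None True by simp
    next
      case (Some k)
      let ?w = "rid (A i) \<Zsemi> s"
      have k: "k \<in> \<Omega> n" "?w \<in> PI n" "dom ?w = A i" "ran ?w = A k" using \<psi>_def[OF Some] by auto
      have wS: "?w \<in> S" using S_mult rid_S A True s by blast
      \<comment> \<open>The image of the restriction \<open>?w\<close> is not empty and starts in
        \<open>c i\<close> and ends in \<open>c k\<close> by its factors; so \<open>\<phi> s\<close>
        maps \<open>c i\<close> to \<open>c k\<close>.\<close>
      have "\<phi> (rid (dom ?w)) \<noteq> \<phi> Map.empty"
        unfolding k(3) A(2)[OF True] empty by (auto simp: rid_def fun_eq_iff)
      then have "\<phi> ?w \<noteq> Map.empty" using PI_nonzero[OF wS k(2)] empty by simp
      moreover have "?w = ?w \<Zsemi> rid (A k)" using rid_right[of ?w "A k"] k(4) by simp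
      then have "\<phi> ?w = \<phi> ?w \<Zsemi> rid {c k}" using phi_mult[OF wS rid_S[OF A(1)[OF k(1)]]] A(2)[OF k(1)] by simp
      then have "\<phi> ?w = rid {c i} \<Zsemi> \<phi> s \<Zsemi> rid {c k}" using ph by simp
      ultimately obtain x y where "(rid {c i} \<Zsemi> \<phi> s \<Zsemi> rid {c k}) x = Some y"
        by (metis ext not_None_eq)
      then have "\<phi> s (c i) = Some (c k)" by (auto simp: map_comp_Some_iff)
      then show ?thesis using Some True k(1) by simp
    qed
  next
    case False
    then have "\<psi> i = None" using \<psi>_def by (metis not_None_eq)
    then show ?thesis using False by simp
  qed
qed

lemma partial_endo:
  "(\<exists>\<sigma> \<in> Dih n. \<forall>s \<in> S. \<phi> s = conj_by n \<sigma> s) \<or> (\<exists>\<sigma> \<in> Nrm n. \<forall>s \<in> S. \<phi> s = conj_by n \<sigma> (phi0 n s)) \<or>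
    (\<exists>f. \<forall>s \<in> S. rank s < n \<longrightarrow> \<phi> s = f)"
proof (cases "\<exists>f. \<forall>s \<in> S. rank s < n \<longrightarrow> \<phi> s = f")
  case False
  obtain r c where r: "r = 1 \<or> r = n - 1" and empty: "\<phi> Map.empty = Map.empty"
    and low: "\<And>s. s \<in> S \<Longrightarrow> rank s < r \<Longrightarrow> \<phi> s = Map.empty"
    and cA: "\<And>A. A \<subseteq> \<Omega> n \<Longrightarrow> card A = r \<Longrightarrow> c A \<in> \<Omega> n \<and> \<phi> (rid A) = rid {c A}"
    and inj: "inj_on c {A. A \<subseteq> \<Omega> n \<and> card A = r}"
    by (rule level_structure[OF False]) (rule that; blast)
  show ?thesis
  proof (cases "r = 1")
    case True
    let ?c = "\<lambda>i. c {i}"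
    have c: "?c \<in> \<Omega> n \<rightarrow> \<Omega> n" "inj_on ?c (\<Omega> n)"
    proof -
      show "?c \<in> \<Omega> n \<rightarrow> \<Omega> n" using cA True by auto
      show "inj_on ?c (\<Omega> n)"
      proof (rule inj_onI)
        fix i j assume ij: "i \<in> \<Omega> n" "j \<in> \<Omega> n" "?c i = ?c j"
        have "{i} = {j}" using inj ij(3) by (rule inj_onD) (use ij True in auto)
        then show "i = j" by simp
      qed
    qed
    have conj: "\<phi> s = conj_by n (full_map n ?c) s" if s: "s \<in> S" for s
    proof (rule level_conj[where A = "\<lambda>i. {i}", OF empty _ _ c _ _ s])
      fix i k assume ik: "s i = Some k"
      then have "rid {i} \<Zsemi> s = [i \<mapsto> k]" by (auto simp: rid_def fun_eq_iff map_comp_def)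
      then show "i \<in> \<Omega> n \<and> k \<in> \<Omega> n \<and> rid {i} \<Zsemi> s \<in> PI n \<and> dom (rid {i} \<Zsemi> s) = {i} \<and> ran (rid {i} \<Zsemi> s) = {k}"
        using PT_D[OF S_PT[OF s] ik] by (auto simp: PI_iff PT_iff split: if_splits)
    next
      fix i assume "i \<in> \<Omega> n" "s i = None"
      then have "rid {i} \<Zsemi> s = Map.empty" by (auto simp: rid_def fun_eq_iff map_comp_def)
      then show "\<phi> (rid {i} \<Zsemi> s) = Map.empty" using empty by simp
    qed (use cA True in auto)
    have "full_map n ?c \<in> Dih n" using conj phi_S by (intro conj_closed_Dih[OF c]) simp
    then show ?thesis using conj by blast
  next
    case False
    then have rn: "r = n - 1" using r by simp
    let ?A = "\<lambda>i. \<Omega> n - {i}"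
    let ?c = "\<lambda>i. c (?A i)"
    have cardA: "card (?A i) = r" if "i \<in> \<Omega> n" for i using that rn by simp
    have c: "?c \<in> \<Omega> n \<rightarrow> \<Omega> n" using cA cardA by auto
    have c': "inj_on ?c (\<Omega> n)"
    proof (rule inj_onI)
      fix i j assume ij: "i \<in> \<Omega> n" "j \<in> \<Omega> n" "?c i = ?c j"
      have "?A i = ?A j" using inj ij(3) by (rule inj_onD) (use cardA ij in auto)
      then show "i = j" using ij by blast
    qed
    have conj: "\<phi> s = conj_by n (full_map n ?c) (phi0 n s)" if s: "s \<in> S" for s
    proof (rule level_conj[where A = ?A, OF empty _ _ c c' _ _ s])
      fix i k assume "phi0 n s i = Some k"
      then have p: "punct_bij n s i k" using phi0_Some_iff[OF S_PT[OF s] n0] by blast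
      let ?w = "rid (?A i) \<Zsemi> s"
      have w: "?w x = (if x \<in> ?A i then s x else None)" for x by (simp add: rid_def map_comp_def)
      have sx: "s x = Some (the (s x))" if "x \<in> ?A i" for x
      proof -
        have "x \<in> dom s" using p that unfolding punct_bij_def by blast
        then show ?thesis by auto
      qed
      have dom: "dom ?w = ?A i" using sx unfolding dom_def w by auto
      have "ran ?w = (\<lambda>x. the (?w x)) ` ?A i" using ran_image[of ?w] dom by simp
      also have "\<dots> = (\<lambda>x. the (s x)) ` ?A i" using w by (intro image_cong) auto
      finally have ran: "ran ?w = ?A k" using p by (simp add: punct_bij_def bij_betw_def)
      have "?w \<in> PT n" by (intro S_PT S_mult rid_S s Diff_subset)
      moreover have "x = y" if "?w x = Some j" "?w y = Some j" for x y j
      proof -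
        have "x \<in> ?A i" "y \<in> ?A i" "the (s x) = the (s y)" using that unfolding w by (auto split: if_splits)
        then show ?thesis using p unfolding punct_bij_def bij_betw_def inj_on_def by blast
      qed
      ultimately have "?w \<in> PI n" unfolding PI_iff by blast
      then show "i \<in> \<Omega> n \<and> k \<in> \<Omega> n \<and> ?w \<in> PI n \<and> dom ?w = ?A i \<and> ran ?w = ?A k"
        using p dom ran by (simp add: punct_bij_def)
    next
      fix i assume i: "i \<in> \<Omega> n" "phi0 n s i = None"
      let ?w = "rid (?A i) \<Zsemi> s"
      have wS: "?w \<in> S" by (intro S_mult rid_S s Diff_subset)
      have w: "?w x = (if x \<in> ?A i then s x else None)" for x by (simp add: rid_def map_comp_def)
      \<comment> \<open>If deleting i from the domain left rank n - 1, then s would be a bijection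
        from the complement of i onto the complement of some point, and \<open>phi0 n s\<close>
        would be defined at i.\<close>
      have "rank ?w < r"
      proof (rule ccontr)
        assume "\<not> rank ?w < r"
        moreover have dA: "dom ?w \<subseteq> ?A i" unfolding dom_def w by auto
        have fin: "finite (dom ?w)" using finite_subset[OF dA] by simp
        moreover have crd: "rank ?w \<le> card (dom ?w)" "card (dom ?w) \<le> r"
          using card_image_le[OF fin, of "\<lambda>x. the (?w x)"] card_mono[OF _ dA] cardA[OF i(1)] by (simp_all add: rank_def ran_image)
        ultimately have eq: "rank ?w = r" "card (dom ?w) = r" by simp_all
        then have dom: "dom ?w = ?A i" using dA cardA[OF i(1)] by (intro card_subset_eq) auto
        obtain k where k: "k \<in> \<Omega> n" "ran ?w = ?A k"
          using co_singleton[of "ran ?w" n] S_PT[OF wS] eq(1) rn n0 by (auto simp: PT_def rank_def)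
        have im: "(\<lambda>x. the (s x)) ` ?A i = ?A k"
        proof -
          have "ran ?w = (\<lambda>x. the (?w x)) ` ?A i" using ran_image[of ?w] dom by simp
          also have "\<dots> = (\<lambda>x. the (s x)) ` ?A i" using w by (intro image_cong) auto
          finally show ?thesis using k by simp
        qed
        then have "inj_on (\<lambda>x. the (s x)) (?A i)" using i(1) k(1) by (intro eq_card_imp_inj_on) auto
        moreover have "?A i \<subseteq> dom s"
        proof
          fix x assume "x \<in> ?A i"
          then have "x \<in> dom ?w" using dom by simp
          then show "x \<in> dom s" unfolding dom_def w by (auto split: if_splits)
        qed
        ultimately have "punct_bij n s i k" using i(1) k(1) im by (simp add: punct_bij_def bij_betw_def)
        then have "phi0 n s i = Some k" using phi0_Some_iff[OF S_PT[OF s] n0] by blast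
        then show False using i(2) by simp
      qed
      then show "\<phi> ?w = Map.empty" using low wS by blast
    qed (use cA cardA in auto)
    have \<sigma>: "full_map n ?c \<in> Sym n" by (rule full_map_Sym[OF c c'])
    \<comment> \<open>Units are unchanged by \<open>phi0\<close>, so \<open>\<phi>\<close>
      conjugates g itself and the permutation normalizes the cycle. The adjacency test has no
      counterpart here because \<open>phi0\<close> lowers non-units to rank at most 1.\<close>
    have "phi0 n (rot n 1) = rot n 1" using rot_Sym by (simp add: phi0_def)
    then have "rot n 1 \<Zsemi> full_map n ?c = full_map n ?c \<Zsemi> \<phi> (rot n 1)"
      using conj[OF rot_S, of 1] conj_by_intertwine[OF \<sigma> rot_PT] by simp
    from normalizer_sigma[OF n3 c c' S_POR[OF phi_S[OF rot_S]] this]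
    obtain k where k: "1 \<le> k" "k < n" "gcd k n = 1" "full_map n ?c = sigma n (?c 1) k"
      "\<And>i. 1 \<le> i \<Longrightarrow> i \<le> n \<Longrightarrow> ?c i = (?c 1 - 1 + (i - 1) * k) mod n + 1" by blast
    have "1 \<in> \<Omega> n" using n3 by (simp add: \<Omega>_def)
    then have "?c 1 \<in> \<Omega> n" using c by blast
    moreover have "k \<in> \<Omega> n" using k(1,2) by (simp add: \<Omega>_def)
    ultimately have "full_map n ?c \<in> Nrm n" using k(3) unfolding Nrm_def k(4) mem_Collect_eq by (intro exI conjI) (rule refl, assumption+)
    then show ?thesis using conj by blast
  qed
qed blast

end

end

subsection \<open>Dihedral pairs\<close>

text \<open>Normal form of a word in two dihedral generators; the flag marks the elements of
  reflection type.\<close>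

definition dih_elt :: "('a, 'b) monoid_scheme \<Rightarrow> 'a \<Rightarrow> 'a \<Rightarrow> bool \<Rightarrow> nat \<Rightarrow> 'a" where
  "dih_elt G a b \<epsilon> i = (if \<epsilon> then b \<otimes>\<^bsub>G\<^esub> a [^]\<^bsub>G\<^esub> i else a [^]\<^bsub>G\<^esub> i)"

text \<open>Only the relations of a dihedral group, without faithfulness: the order of
  \<open>a\<close> may be a proper divisor of \<open>m\<close>, and \<open>b\<close> may be a power
  of \<open>a\<close>. Any homomorphic image of the pair g, h is therefore again such a pair with
  \<open>m = n\<close>.\<close>

locale dihedral_pair = group G for G (structure) +
  fixes a b :: 'a and m :: nat
  assumes a: "a \<in> carrier G" and b: "b \<in> carrier G" and m: "m > 0"
    and a_pow: "a [^] m = \<one>" and b_sq: "b \<otimes> b = \<one>" and conj: "b \<otimes> a \<otimes> b = inv a"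
begin

abbreviation elt :: "bool \<Rightarrow> nat \<Rightarrow> 'a" where "elt \<equiv> dih_elt G a b"

lemma elt_simps [simp]: "elt False i = a [^] i" "elt True i = b \<otimes> a [^] i"
  by (simp_all add: dih_elt_def)

lemma elt_closed: "elt \<epsilon> i \<in> carrier G"
  using a b by (cases \<epsilon>) simp_all

lemma inv_a: "inv a = a [^] (m - 1)"
proof (rule inv_equality)
  have "a [^] (m - 1) \<otimes> a = a [^] Suc (m - 1)" by simp
  then show "a [^] (m - 1) \<otimes> a = \<one>" using a_pow m by simp
qed (use a in simp_all)

lemma a_b: "a \<otimes> b = b \<otimes> a [^] (m - 1)"
proof -
  have "b \<otimes> (b \<otimes> a \<otimes> b) = a \<otimes> b" using a b b_sq by (simp add: m_assoc[symmetric])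
  then show ?thesis by (simp add: conj inv_a)
qed

lemma pow_b: "a [^] i \<otimes> b = b \<otimes> a [^] ((m - 1) * i)"
proof (induction i)
  case (Suc i)
  have "a [^] Suc i \<otimes> b = a [^] i \<otimes> (a \<otimes> b)" using a b by (simp add: m_assoc)
  also have "\<dots> = a [^] i \<otimes> b \<otimes> a [^] (m - 1)" unfolding a_b using a b by (simp add: m_assoc)
  also have "\<dots> = b \<otimes> (a [^] ((m - 1) * i) \<otimes> a [^] (m - 1))" unfolding Suc using a b by (simp add: m_assoc)
  also have "a [^] ((m - 1) * i) \<otimes> a [^] (m - 1) = a [^] ((m - 1) * Suc i)" using a by (simp add: nat_pow_mult add.commute)
  finally show ?case .
qed (use b in simp)

lemma elt_mod: "elt \<epsilon> (i mod m) = elt \<epsilon> i"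
proof -
  have "a [^] i = a [^] (m * (i div m) + i mod m)" by simp
  also have "\<dots> = (a [^] m) [^] (i div m) \<otimes> a [^] (i mod m)"
    using a by (simp only: nat_pow_mult nat_pow_pow)
  also have "\<dots> = a [^] (i mod m)" using a by (simp add: a_pow)
  finally show ?thesis by (cases \<epsilon>) simp_all
qed

text \<open>Moving a power of \<open>a\<close> past \<open>b\<close> inverts it, and
  \<open>(m - 1) * i\<close> stands for -i. The rule mentions only \<open>m\<close> and not the
  group, so matching normal forms in two groups is automatically multiplicative;
  \<open>dihedral_pair_hom\<close> rests on this.\<close>

lemma elt_mult: "elt \<epsilon> i \<otimes> elt \<delta> j = elt (\<epsilon> \<noteq> \<delta>) ((if \<delta> then (m - 1) * i else i) + j)"
proof (cases \<delta>)
  case False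
  then show ?thesis using a b by (cases \<epsilon>) (simp_all add: m_assoc nat_pow_mult)
next
  case True
  have e: "a [^] i \<otimes> (b \<otimes> a [^] j) = b \<otimes> a [^] ((m - 1) * i + j)"
  proof -
    have "a [^] i \<otimes> (b \<otimes> a [^] j) = a [^] i \<otimes> b \<otimes> a [^] j" using a b by (simp add: m_assoc)
    also have "\<dots> = b \<otimes> (a [^] ((m - 1) * i) \<otimes> a [^] j)" unfolding pow_b using a b by (simp add: m_assoc)
    finally show ?thesis using a by (simp add: nat_pow_mult)
  qed
  show ?thesis
  proof (cases \<epsilon>)
    case True
    have "b \<otimes> a [^] i \<otimes> (b \<otimes> a [^] j) = b \<otimes> (b \<otimes> a [^] ((m - 1) * i + j))"
      using e a b by (simp add: m_assoc)
    also have "\<dots> = a [^] ((m - 1) * i + j)" using a b b_sq by (simp add: m_assoc[symmetric])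
    finally show ?thesis using True \<open>\<delta>\<close> by simp
  next
    case False
    then show ?thesis using e \<open>\<delta>\<close> by simp
  qed
qed

lemma elt_True_sq: "elt True i \<otimes> elt True i = \<one>"
proof -
  have "(m - 1) * i + i = m * i" using m by (cases m) auto
  then have "elt True i \<otimes> elt True i = a [^] (m * i)" by (simp only: elt_mult) simp
  then show ?thesis using a a_pow by (simp flip: nat_pow_pow)
qed

lemma generate_elt: "generate G {a, b} = {elt \<epsilon> i | \<epsilon> i. i < m}"
proof
  let ?R = "{elt \<epsilon> i | \<epsilon> i. i < m}"
  have R: "elt \<epsilon> i \<in> ?R" for \<epsilon> i using elt_mod[of \<epsilon> i] m by (metis (mono_tags, lifting) mem_Collect_eq mod_less_divisor)
  have "subgroup ?R G"
  proof (rule subgroupI)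
    show "?R \<subseteq> carrier G" using elt_closed by blast
    show "?R \<noteq> {}" using m by blast
    fix x y assume "x \<in> ?R"
    then obtain \<epsilon> i where x: "x = elt \<epsilon> i" by blast
    have "inv x = elt \<epsilon> (if \<epsilon> then i else (m - 1) * i)"
    proof (rule inv_equality)
      show "elt \<epsilon> (if \<epsilon> then i else (m - 1) * i) \<otimes> x = \<one>"
      proof (cases \<epsilon>)
        case True
        then show ?thesis using elt_True_sq x by (simp only: if_True)
      next
        case False
        have "(m - 1) * i + i = m * i" using m by (cases m) auto
        then have "elt False ((m - 1) * i) \<otimes> elt False i = a [^] (m * i)" by (simp only: elt_mult) simp
        then show ?thesis using False x a a_pow by (simp flip: nat_pow_pow)
      qed
    qed (use elt_closed x in simp_all)
    then show "inv x \<in> ?R" using R by simp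
    assume "y \<in> ?R"
    then obtain \<delta> j where "y = elt \<delta> j" by blast
    then show "x \<otimes> y \<in> ?R" unfolding x by (simp only: elt_mult R)
  qed
  moreover have "elt False 1 = a" "elt True 0 = b" using a b by simp_all
  then have "a \<in> ?R" "b \<in> ?R" using R[of False 1] R[of True 0] by (simp_all only:)
  ultimately show "generate G {a, b} \<subseteq> ?R" by (intro generate_subgroup_incl) auto
  have A: "a [^] (i::nat) \<in> generate G {a, b}" for i
  proof (induction i)
    case (Suc i)
    then have "a [^] i \<otimes> a \<in> generate G {a, b}" by (intro generate.eng) (auto intro: generate.incl)
    then show ?case by simp
  qed (simp add: generate.one)
  moreover have "b \<otimes> a [^] i \<in> generate G {a, b}" for i :: nat using A by (intro generate.eng) (auto intro: generate.incl)
  ultimately have "elt \<epsilon> i \<in> generate G {a, b}" for \<epsilon> i by (cases \<epsilon>) simp_all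
  then show "?R \<subseteq> generate G {a, b}" by blast
qed

lemma elt_inj:
  assumes ord: "ord a = m" and b_notin: "\<And>i. b \<noteq> a [^] (i::nat)"
    and eq: "elt \<epsilon> i = elt \<delta> j" "i < m" "j < m"
  shows "\<epsilon> = \<delta> \<and> i = j"
proof -
  have pow: "k = l" if "a [^] k = a [^] l" "k < m" "l < m" for k l :: nat
    using ord_inj[OF a] that ord by (auto simp: inj_on_def)
  have "b = a [^] ((m - 1) * i + j)" if "b \<otimes> a [^] i = a [^] j" for i j :: nat
  proof -
    have "a [^] i \<otimes> a [^] ((m - 1) * i) = a [^] (m * i)" using a m by (simp add: nat_pow_mult, cases m, auto)
    also have "\<dots> = \<one>" using a a_pow by (simp flip: nat_pow_pow)
    finally have "a [^] i \<otimes> a [^] ((m - 1) * i) = \<one>" .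
    then have "b = b \<otimes> a [^] i \<otimes> a [^] ((m - 1) * i)" using a b by (simp add: m_assoc)
    then show ?thesis using that a by (simp add: nat_pow_mult add.commute)
  qed
  then have no: "b \<otimes> a [^] i \<noteq> a [^] j" for i j :: nat using b_notin by blast
  show ?thesis
  proof (cases "\<epsilon> = \<delta>")
    case True
    have "a [^] i = a [^] j"
    proof (cases \<delta>)
      case True
      then have "b \<otimes> a [^] i = b \<otimes> a [^] j" using eq(1) \<open>\<epsilon> = \<delta>\<close> by simp
      then show ?thesis using l_cancel[of b "a [^] i" "a [^] j"] a b by simp
    next
      case False
      then show ?thesis using eq(1) \<open>\<epsilon> = \<delta>\<close> by simp
    qed
    then show ?thesis using pow eq True by blast
  next
    case False
    then show ?thesis using eq(1) no by (cases \<epsilon>; cases \<delta>) (simp, simp, metis elt_simps, simp)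
  qed
qed

end

lemma dihedral_pair_hom:
  assumes G: "dihedral_pair G a b m" and H: "dihedral_pair H c d m"
    and f: "\<And>\<epsilon> i. i < m \<Longrightarrow> f (dih_elt G a b \<epsilon> i) = dih_elt H c d \<epsilon> i"
  shows "f (dih_elt G a b \<epsilon> i \<otimes>\<^bsub>G\<^esub> dih_elt G a b \<delta> j) = f (dih_elt G a b \<epsilon> i) \<otimes>\<^bsub>H\<^esub> f (dih_elt G a b \<delta> j)"
proof -
  interpret G: dihedral_pair G a b m by (rule G)
  interpret H: dihedral_pair H c d m by (rule H)
  have f': "f (G.elt \<epsilon> i) = H.elt \<epsilon> i" for \<epsilon> i
    using f[of "i mod m" \<epsilon>] G.m by (simp only: G.elt_mod H.elt_mod mod_less_divisor)
  show ?thesis by (simp only: G.elt_mult f' H.elt_mult)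
qed

text \<open>The group \<open>H\<close> is the ambient one and \<open>K\<close> is the subgroup
  generated by the pair, taken as a structure of its own. This covers \<open>Mon p (Dih p)\<close>
  inside the symmetric group as well as the Klein group inside itself. On unique normal forms the
  isomorphism is forced.\<close>

lemma dihedral_pair_iso:
  assumes G: "dihedral_pair G a b m" and H: "dihedral_pair H c d m"
    and Gi: "group.ord G a = m" "\<And>i. b \<noteq> a [^]\<^bsub>G\<^esub> (i::nat)"
    and Hi: "group.ord H c = m" "\<And>i. d \<noteq> c [^]\<^bsub>H\<^esub> (i::nat)"
    and K: "carrier K = generate H {c, d}" "\<And>x y. x \<otimes>\<^bsub>K\<^esub> y = x \<otimes>\<^bsub>H\<^esub> y"
  shows "subgroup_generated G {a, b} \<cong> K"
proof -
  interpret G: dihedral_pair G a b m by (rule G)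
  interpret H: dihedral_pair H c d m by (rule H)
  define f where "f x = (THE y. \<exists>\<epsilon> i. i < m \<and> x = G.elt \<epsilon> i \<and> y = H.elt \<epsilon> i)" for x
  have f: "f (G.elt \<epsilon> i) = H.elt \<epsilon> i" if "i < m" for \<epsilon> i
    unfolding f_def using that G.elt_inj[OF Gi] by (intro the_equality) blast+
  have car: "carrier (subgroup_generated G {a, b}) = {G.elt \<epsilon> i | \<epsilon> i. i < m}"
    using G.generate_elt G.a G.b by (simp add: carrier_subgroup_generated Int_absorb1)
  have carK: "carrier K = {H.elt \<epsilon> i | \<epsilon> i. i < m}"
    using K(1) H.generate_elt by simp
  have "f \<in> hom (subgroup_generated G {a, b}) K"
    unfolding hom_def car carK
    using f dihedral_pair_hom[OF G H f] by (auto simp: K(2))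
  moreover have "inj_on f {G.elt \<epsilon> i | \<epsilon> i. i < m}"
  proof (rule inj_onI)
    fix x y assume "x \<in> {G.elt \<epsilon> i | \<epsilon> i. i < m}" "y \<in> {G.elt \<epsilon> i | \<epsilon> i. i < m}" and e: "f x = f y"
    then obtain \<epsilon> i \<delta> j where "x = G.elt \<epsilon> i" "y = G.elt \<delta> j" "i < m" "j < m" by blast
    then show "x = y" using e f H.elt_inj[OF Hi, of \<epsilon> i \<delta> j] by simp
  qed
  moreover have "f ` {G.elt \<epsilon> i | \<epsilon> i. i < m} = {H.elt \<epsilon> i | \<epsilon> i. i < m}"
  proof
    show "f ` {G.elt \<epsilon> i | \<epsilon> i. i < m} \<subseteq> {H.elt \<epsilon> i | \<epsilon> i. i < m}" using f by blast
    show "{H.elt \<epsilon> i | \<epsilon> i. i < m} \<subseteq> f ` {G.elt \<epsilon> i | \<epsilon> i. i < m}"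
    proof
      fix y assume "y \<in> {H.elt \<epsilon> i | \<epsilon> i. i < m}"
      then obtain \<epsilon> i where "i < m" "y = f (G.elt \<epsilon> i)" using f by force
      then show "y \<in> f ` {G.elt \<epsilon> i | \<epsilon> i. i < m}" by blast
    qed
  qed
  ultimately have "f \<in> iso (subgroup_generated G {a, b}) K"
    unfolding iso_def bij_betw_def car carK by blast
  then show ?thesis unfolding is_iso_def by blast
qed

subsection \<open>The model dihedral groups\<close>

lemma dihedral_pair_Sym: "n > 0 \<Longrightarrow> dihedral_pair (Mon n (Sym n)) (gperm n) (hperm n) n"
proof (intro dihedral_pair.intro group_Sym dihedral_pair_axioms.intro)
  assume n: "n > 0"
  obtain j where j: "(1 + j) mod n = 0" using rot_inverse[OF n, of 1] by (rule exE)
  have "hperm n \<Zsemi> rot n 1 \<Zsemi> hperm n = rot n j" by (rule hperm_rot_hperm[OF j])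
  moreover have "inv\<^bsub>Mon n (Sym n)\<^esub> (rot n 1) = rot n j"
  proof (rule group.inv_equality[OF group_Sym])
    have "rot n (j + 1) = rot n 0" using j by (intro rot_cong) (simp add: add.commute)
    then show "rot n j \<otimes>\<^bsub>Mon n (Sym n)\<^esub> rot n 1 = \<one>\<^bsub>Mon n (Sym n)\<^esub>" by (simp add: rot_mult)
  qed (simp_all add: rot_Sym)
  ultimately show "hperm n \<otimes>\<^bsub>Mon n (Sym n)\<^esub> gperm n \<otimes>\<^bsub>Mon n (Sym n)\<^esub> hperm n = inv\<^bsub>Mon n (Sym n)\<^esub> gperm n"
    by (simp add: gperm_rot)
qed (simp_all add: gperm_pow hperm_Sym, simp add: gperm_rot rot_Sym)

lemma dih_elt_Sym: "dih_elt (Mon n (Sym n)) (gperm n) (hperm n) \<epsilon> i = (if \<epsilon> then hperm n \<Zsemi> rot n i else rot n i)"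
  by (simp add: dih_elt_def gperm_pow)

lemma ord_gperm: assumes "n > 0" shows "group.ord (Mon n (Sym n)) (gperm n) = n"
proof -
  have "gperm n [^]\<^bsub>Mon n (Sym n)\<^esub> k = \<one>\<^bsub>Mon n (Sym n)\<^esub> \<longleftrightarrow> n dvd k" for k :: nat
    using rot_eq_iff[OF assms, of k 0] by (simp add: gperm_pow mod_eq_0_iff_dvd)
  then show ?thesis by (intro group.ord_unique[OF group_Sym, THEN iffD2]) (simp_all add: gperm_rot rot_Sym)
qed

text \<open>Faithful dihedral pairs with the same p generate isomorphic groups, so it is enough to
  exhibit one in each model. On two points g and h coincide, hence the separate model for p =
  2.\<close>

lemma dihedral_order_2timesI:
  assumes G: "dihedral_pair G a b p" and "group.ord G a = p" "\<And>i. b \<noteq> a [^]\<^bsub>G\<^esub> (i::nat)" and p: "p \<ge> 2"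
  shows "dihedral_of_order_2times p (subgroup_generated G {a, b})"
proof (cases "p = 2")
  case True
  let ?K = "integer_mod_group 2 \<times>\<times> integer_mod_group 2"
  have K: "group ?K" by (intro DirProd_group group_integer_mod_group)
  have car: "carrier ?K = {0, 1} \<times> {0, 1}"
    by (auto simp: DirProd_def carrier_integer_mod_group)
  have mult: "(x, y) \<otimes>\<^bsub>?K\<^esub> (u, v) = ((x + u) mod 2, (y + v) mod 2)" for x y u v by (simp add: DirProd_def)
  have one: "\<one>\<^bsub>?K\<^esub> = (0, 0)" by (simp add: DirProd_def)
  have pow: "(1, 0) [^]\<^bsub>?K\<^esub> (k::nat) = (int k mod 2, 0)" for k
    by (induction k) (simp_all add: one mult nat_pow_def mod_add_right_eq add.commute)
  have H: "dihedral_pair ?K (1, 0) (0, 1) 2"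
  proof (intro dihedral_pair.intro K dihedral_pair_axioms.intro)
    have "inv\<^bsub>?K\<^esub> (1, 0) = (1, 0)" by (rule group.inv_equality[OF K]) (simp_all add: mult one car)
    then show "(0, 1) \<otimes>\<^bsub>?K\<^esub> (1, 0) \<otimes>\<^bsub>?K\<^esub> (0, 1) = inv\<^bsub>?K\<^esub> (1, 0)" by (simp add: mult)
  qed (simp_all only: pow one mult car, simp_all)
  have ord: "group.ord ?K (1, 0) = 2"
  proof (rule group.ord_unique[OF K, THEN iffD2])
    show "(1, 0) \<in> carrier ?K" unfolding car by simp
    have "(int k mod 2, 0) = (0 :: int, 0 :: int) \<longleftrightarrow> 2 dvd k" for k :: nat by (simp, presburger)
    then show "\<forall>k :: nat. ((1, 0) [^]\<^bsub>?K\<^esub> k = \<one>\<^bsub>?K\<^esub>) = (2 dvd k)" unfolding pow one by blast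
  qed
  have gen: "carrier ?K = generate ?K {(1, 0), (0, 1)}"
    unfolding dihedral_pair.generate_elt[OF H]
  proof
    show "carrier ?K \<subseteq> {dih_elt ?K (1, 0) (0, 1) \<epsilon> i | \<epsilon> i. i < 2}"
    proof
      fix x assume "x \<in> carrier ?K"
      then have "x \<in> {(0,0),(0,1),(1,0),(1,1)}" unfolding car by auto
      then obtain \<epsilon> i where "i < 2" "x = dih_elt ?K (1, 0) (0, 1) \<epsilon> i"
      proof -
        have "x = dih_elt ?K (1, 0) (0, 1) (snd x = 1) (nat (fst x))" "nat (fst x) < 2"
          using \<open>x \<in> {(0,0),(0,1),(1,0),(1,1)}\<close> by (auto simp: dih_elt_def pow mult)
        then show ?thesis using that by blast
      qed
      then show "x \<in> {dih_elt ?K (1, 0) (0, 1) \<epsilon> i | \<epsilon> i. i < 2}" by blast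
    qed
    show "{dih_elt ?K (1, 0) (0, 1) \<epsilon> i | \<epsilon> i. i < 2} \<subseteq> carrier ?K"
      using dihedral_pair.elt_closed[OF H] by blast
  qed
  have "subgroup_generated G {a, b} \<cong> ?K"
    using G assms(2,3) H ord gen unfolding True
    by (intro dihedral_pair_iso[where c = "(1, 0)" and d = "(0, 1)" and H = ?K and m = 2]) (simp_all add: pow)
  then show ?thesis using True by (simp add: dihedral_of_order_2times_def)
next
  case False
  then have p3: "p \<ge> 3" using p by simp
  have "subgroup_generated G {a, b} \<cong> Mon p (Dih p)"
  proof (rule dihedral_pair_iso[OF G dihedral_pair_Sym assms(2,3)])
    show "hperm p \<noteq> gperm p [^]\<^bsub>Mon p (Sym p)\<^esub> i" for i :: nat
      using rot_neq_refl[OF p3, of i 0] hperm_PT by (simp add: gperm_pow)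
    show "carrier (Mon p (Dih p)) = generate (Mon p (Sym p)) {gperm p, hperm p}" by (simp add: Dih_def)
  qed (use p3 ord_gperm in simp_all)
  then show ?thesis using p3 by (simp add: dihedral_of_order_2times_def)
qed

text \<open>Recovers the dihedral relation from a bare isomorphism. For p \<ge> 3 the element a is
  too large in order to correspond to a reflection, so it corresponds to a rotation; then b must
  correspond to a reflection, since otherwise only rotations would be generated. So b a corresponds
  to a reflection and squares to one. For p = 2 everything commutes and squares to one.\<close>

lemma dihedral_order_2timesD:
  fixes G (structure)
  assumes grp: "group G" and ab: "a \<in> carrier G" "b \<in> carrier G"
    and ord: "group.ord G a = p" "group.ord G b = 2" and p: "p \<ge> 2"
    and dih: "dihedral_of_order_2times p (subgroup_generated G {a, b})"
  shows "b \<otimes>\<^bsub>G\<^esub> a \<otimes>\<^bsub>G\<^esub> b = inv\<^bsub>G\<^esub> a"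
proof -
  interpret group G by (rule grp)
  let ?D = "subgroup_generated G {a, b}"
  have carD: "carrier ?D = generate G {a, b}" using ab by (simp add: carrier_subgroup_generated Int_absorb1)
  have D: "a \<in> carrier ?D" "b \<in> carrier ?D" unfolding carD by (auto intro: generate.incl)
  have grpD: "group ?D" by (rule group_subgroup_generated)
  have bb: "b \<otimes> b = \<one>" using pow_ord_eq_1[OF ab(2)] ord ab by (simp add: numeral_2_eq_2)
  have Dmult: "x \<otimes>\<^bsub>?D\<^esub> y = x \<otimes> y" for x y by simp
  consider "p = 2" "?D \<cong> integer_mod_group 2 \<times>\<times> integer_mod_group 2" | "p \<ge> 3" "?D \<cong> Mon p (Dih p)"
    using dih by (auto simp: dihedral_of_order_2times_def)
  then show ?thesis
  proof cases
    case 1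
    then obtain \<psi> where \<psi>: "\<psi> \<in> iso ?D (integer_mod_group 2 \<times>\<times> integer_mod_group 2)" unfolding is_iso_def by blast
    have "\<psi> (a \<otimes> b) = \<psi> (b \<otimes> a)"
    proof -
      have "\<psi> (a \<otimes> b) = \<psi> a \<otimes>\<^bsub>integer_mod_group 2 \<times>\<times> integer_mod_group 2\<^esub> \<psi> b"
        "\<psi> (b \<otimes> a) = \<psi> b \<otimes>\<^bsub>integer_mod_group 2 \<times>\<times> integer_mod_group 2\<^esub> \<psi> a"
        using hom_mult[OF iso_imp_homomorphism[OF \<psi>] D(1,2)] hom_mult[OF iso_imp_homomorphism[OF \<psi>] D(2,1)]
        unfolding Dmult by blast+
      then show ?thesis by (cases "\<psi> a"; cases "\<psi> b") (simp add: DirProd_def add.commute)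
    qed
    moreover have "a \<otimes> b \<in> carrier ?D" "b \<otimes> a \<in> carrier ?D" unfolding carD by (auto intro: generate.eng generate.incl)
    ultimately have c: "a \<otimes> b = b \<otimes> a" using \<psi> unfolding iso_def bij_betw_def inj_on_def by blast
    have aa: "a \<otimes> a = \<one>" using pow_ord_eq_1[OF ab(1)] ord ab 1 by (simp add: numeral_2_eq_2)
    have "b \<otimes> a \<otimes> b = a \<otimes> (b \<otimes> b)" using c ab by (simp add: m_assoc[symmetric])
    also have "\<dots> = a" using bb ab by simp
    also have "a = inv a" using aa ab by (metis inv_equality)
    finally show ?thesis .
  next
    case 2
    then obtain \<psi> where \<psi>: "\<psi> \<in> iso ?D (Mon p (Dih p))" unfolding is_iso_def by blast
    have hom: "\<psi> (x \<otimes> y) = \<psi> x \<Zsemi> \<psi> y" if "x \<in> carrier ?D" "y \<in> carrier ?D" for x y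
      using hom_mult[OF iso_imp_homomorphism[OF \<psi>] that] unfolding Dmult Mon_simps .
    have inj: "x = y" if "x \<in> carrier ?D" "y \<in> carrier ?D" "\<psi> x = \<psi> y" for x y
      using \<psi> that unfolding iso_def bij_betw_def inj_on_def by blast
    have surj: "\<psi> ` carrier ?D = Dih p" using \<psi> unfolding iso_def bij_betw_def by simp
    have p0: "p > 0" using 2 by simp
    have P: "dihedral_pair (Mon p (Sym p)) (gperm p) (hperm p) p" using dihedral_pair_Sym p0 .
    have Dih: "Dih p = {dih_elt (Mon p (Sym p)) (gperm p) (hperm p) \<epsilon> i | \<epsilon> i. i < p}"
      unfolding Dih_def by (rule dihedral_pair.generate_elt[OF P])
    have cl: "x \<otimes> y \<in> carrier ?D" if "x \<in> carrier ?D" "y \<in> carrier ?D" for x y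
      using group.is_monoid[OF grpD, THEN monoid.m_closed, OF that] by simp
    have one: "\<psi> \<one> = pid p"
    proof -
      have o: "\<one> \<in> carrier ?D" using group.is_monoid[OF grpD, THEN monoid.one_closed] by simp
      have "\<psi> \<one> \<in> Sym p" using surj o Dih_eq[OF p0] by blast
      moreover have "\<psi> \<one> \<Zsemi> \<psi> \<one> = \<psi> \<one>" using hom[OF o o] by simp
      ultimately show ?thesis using group.is_monoid[OF group_Sym] group.l_cancel_one[OF group_Sym, of "\<psi> \<one>" p "\<psi> \<one>"] by simp
    qed
    have psi_D: "\<exists>\<epsilon> i. \<psi> x = (if \<epsilon> then hperm p \<Zsemi> rot p i else rot p i)" if "x \<in> carrier ?D" for x
      using surj that unfolding Dih dih_elt_Sym by blast
    have refl: "x \<otimes> x = \<one>" if x: "x \<in> carrier ?D" "\<psi> x = hperm p \<Zsemi> rot p i" for x i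
    proof (rule inj[OF cl[OF x(1) x(1)]])
      show "\<psi> (x \<otimes> x) = \<psi> \<one>" unfolding hom[OF x(1) x(1)] x(2) one by (rule refl_square[OF p0])
      show "\<one> \<in> carrier ?D" using group.is_monoid[OF grpD, THEN monoid.one_closed] by simp
    qed
    have "\<psi> a \<noteq> hperm p \<Zsemi> rot p i" for i
    proof
      assume "\<psi> a = hperm p \<Zsemi> rot p i"
      then have "a [^] (2::nat) = \<one>" using refl[OF D(1)] ab by (simp add: numeral_2_eq_2)
      then have "p dvd 2" using ord ab pow_eq_id by blast
      then show False using 2 by (auto dest: dvd_imp_le)
    qed
    then obtain i where i: "\<psi> a = rot p i" using psi_D[OF D(1)] by metis
    have "\<exists>j. \<psi> b = hperm p \<Zsemi> rot p j"
    proof (rule ccontr)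
      assume "\<not> ?thesis"
      then obtain j where j: "\<psi> b = rot p j" using psi_D[OF D(2)] by metis
      \<comment> \<open>The elements that correspond to rotations form a subgroup; containing a and
        b it would be everything, against the reversal in \<open>Dih p\<close>.\<close>
      let ?R = "{x \<in> carrier ?D. \<exists>i. \<psi> x = rot p i}"
      have "subgroup ?R ?D"
      proof (rule group.subgroupI[OF grpD])
        show "?R \<noteq> {}" using D i by blast
        fix x assume x: "x \<in> ?R"
        then obtain k where k: "\<psi> x = rot p k" by blast
        have ix: "inv\<^bsub>?D\<^esub> x \<in> carrier ?D" using x group.inv_closed[OF grpD] by blast
        have "inv\<^bsub>?D\<^esub> x \<otimes> x = \<one>" using group.l_inv[OF grpD, of x] x by simp
        then have h: "\<psi> (inv\<^bsub>?D\<^esub> x) \<Zsemi> rot p k = pid p" using hom[OF ix, of x] x k one by simp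
        obtain l where l: "(k + l) mod p = 0" using rot_inverse[OF p0, of k] by (rule exE)
        have "\<psi> (inv\<^bsub>?D\<^esub> x) \<in> PT p" using surj ix Dih_eq[OF p0] Sym_PT by blast
        then have "\<psi> (inv\<^bsub>?D\<^esub> x) = \<psi> (inv\<^bsub>?D\<^esub> x) \<Zsemi> (rot p k \<Zsemi> rot p l)"
          using rot_cong[of "k + l" p 0] l by (simp add: rot_mult)
        also have "\<dots> = rot p l" using h by (simp only: pmult_assoc[symmetric]) (simp add: rot_PT)
        finally show "inv\<^bsub>?D\<^esub> x \<in> ?R" using ix by blast
        fix y assume y: "y \<in> ?R"
        then show "x \<otimes>\<^bsub>?D\<^esub> y \<in> ?R" using x hom[of x y] cl[of x y] by (auto simp: rot_mult)
      qed blast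
      then have "subgroup ?R G"
        by (simp only: subgroup_subgroup_generated_iff)
      moreover have "{a, b} \<subseteq> ?R" using D i j by blast
      ultimately have "generate G {a, b} \<subseteq> ?R" by (intro generate_subgroup_incl)
      then have gen: "\<exists>i. \<psi> x = rot p i" if "x \<in> carrier ?D" for x using that unfolding carD by blast
      have all: "\<exists>i. y = rot p i" if y: "y \<in> Dih p" for y
      proof -
        obtain x where "x \<in> carrier ?D" "y = \<psi> x" using y unfolding surj[symmetric] by (rule imageE)
        then show ?thesis using gen by simp
      qed
      have "hperm p \<in> Dih p" unfolding Dih_def by (rule generate.incl) simp
      then obtain k where "hperm p = rot p k" using all by blast
      then show False using rot_neq_refl[OF 2(1), of k 0] hperm_PT[of p] rot_PT[of p k] by simp
    qed
    then obtain j where j: "\<psi> b = hperm p \<Zsemi> rot p j" by blast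
    have ba: "b \<otimes> a \<in> carrier ?D" by (rule cl[OF D(2,1)])
    have "\<psi> (b \<otimes> a) = hperm p \<Zsemi> rot p (j + i)" using hom[OF D(2,1)] i j by (simp add: pmult_assoc rot_mult)
    then have "b \<otimes> a \<otimes> (b \<otimes> a) = \<one>" by (rule refl[OF ba])
    then have "b \<otimes> a \<otimes> b \<otimes> a = \<one>" using ab by (simp add: m_assoc)
    then show ?thesis using ab by (metis inv_equality m_closed)
  qed
qed

subsection \<open>The seven types of endomorphisms\<close>

definition endo1 :: "nat \<Rightarrow> pmap set \<Rightarrow> (pmap \<Rightarrow> pmap) \<Rightarrow> bool" where
  "endo1 n S \<phi> \<longleftrightarrow> (\<exists>\<sigma> \<in> Dih n. \<forall>s \<in> S. \<phi> s = conj_by n \<sigma> s)"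

definition endo2 :: "nat \<Rightarrow> pmap set \<Rightarrow> (pmap \<Rightarrow> pmap) \<Rightarrow> bool" where
  "endo2 n S \<phi> \<longleftrightarrow> S \<in> {POPI n, POP n, PORI n, POR n} \<and>
     (\<exists>\<sigma> \<in> Nrm n. \<forall>s \<in> S. \<phi> s = conj_by n \<sigma> (phi0 n s))"

definition endo3 :: "nat \<Rightarrow> pmap set \<Rightarrow> (pmap \<Rightarrow> pmap) \<Rightarrow> bool" where
  "endo3 n S \<phi> \<longleftrightarrow> (\<exists>e \<in> idempotents S. \<exists>f \<in> idempotents S. e \<noteq> f \<and>
     e \<otimes>\<^bsub>Mon n S\<^esub> f = f \<and> f \<otimes>\<^bsub>Mon n S\<^esub> e = f \<and>
     \<phi> ` J_set n S = {e} \<and> \<phi> ` I_set (n - 1) S = {f})"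

text \<open>The exponent is shifted by p to keep it positive: the zeroth power in
  \<open>Mon n S\<close> is the identity of S, which need not be the identity of the subgroup
  containing g0. Since g0 to the power p is that identity, the shift has no other effect.\<close>

definition endo4 :: "nat \<Rightarrow> pmap set \<Rightarrow> (pmap \<Rightarrow> pmap) \<Rightarrow> bool" where
  "endo4 n S \<phi> \<longleftrightarrow> S \<in> {POPI n, POP n} \<and>
     (\<exists>p g0. p dvd n \<and> p > 1 \<and> group_element_of_order S p g0 \<and>
       (\<forall>i \<in> {0..n - 1}. \<phi> (gperm n [^]\<^bsub>Mon n S\<^esub> i) = g0 [^]\<^bsub>Mon n S\<^esub> (i + p)) \<and>
       \<phi> ` I_set (n - 1) S = {Map.empty})"

definition endo5 :: "nat \<Rightarrow> pmap set \<Rightarrow> (pmap \<Rightarrow> pmap) \<Rightarrow> bool" where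
  "endo5 n S \<phi> \<longleftrightarrow> S \<in> {PORI n, POR n} \<and>
     (\<exists>p g0 h0 G e. p dvd n \<and> p > 1 \<and>
       maximal_subgroup_of S G e \<and> g0 \<in> G \<and> h0 \<in> G \<and>
       group.ord (comp_structure G e) h0 = 2 \<and>
       group.ord (comp_structure G e) g0 = p \<and>
       dihedral_of_order_2times p (subgroup_generated (comp_structure G e) {g0, h0}) \<and>
       (\<forall>i \<in> {0..n - 1}.
         \<phi> (gperm n [^]\<^bsub>Mon n S\<^esub> i) = g0 [^]\<^bsub>Mon n S\<^esub> (i + p) \<and>
         \<phi> (hperm n \<otimes>\<^bsub>Mon n S\<^esub> gperm n [^]\<^bsub>Mon n S\<^esub> i) =
           h0 \<otimes>\<^bsub>Mon n S\<^esub> g0 [^]\<^bsub>Mon n S\<^esub> (i + p)) \<and>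
       \<phi> ` I_set (n - 1) S = {Map.empty})"

definition endo6 :: "nat \<Rightarrow> pmap set \<Rightarrow> (pmap \<Rightarrow> pmap) \<Rightarrow> bool" where
  "endo6 n S \<phi> \<longleftrightarrow> S \<in> {OR n, PORI n, POR n} \<and>
     (\<exists>h0 f. group_element_of_order S 2 h0 \<and> f \<in> idempotents S \<and> rank f \<le> 2 \<and>
       h0 \<otimes>\<^bsub>Mon n S\<^esub> f = f \<and> f \<otimes>\<^bsub>Mon n S\<^esub> h0 = f \<and>
       \<phi> ` I_set (n - 1) S = {f} \<and>
       ((\<forall>i \<in> {0..n - 1}.
           \<phi> (gperm n [^]\<^bsub>Mon n S\<^esub> i) = h0 [^]\<^bsub>Mon n S\<^esub> (2::nat) \<and>
           \<phi> (hperm n \<otimes>\<^bsub>Mon n S\<^esub> gperm n [^]\<^bsub>Mon n S\<^esub> i) = h0) \<or>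
        (even n \<and> (\<forall>i \<in> {0..n - 1}.
           \<phi> (gperm n [^]\<^bsub>Mon n S\<^esub> i) = h0 [^]\<^bsub>Mon n S\<^esub> (i + 2) \<and>
           \<phi> (hperm n \<otimes>\<^bsub>Mon n S\<^esub> gperm n [^]\<^bsub>Mon n S\<^esub> i) = h0 [^]\<^bsub>Mon n S\<^esub> (i + 2))) \<or>
        (even n \<and> (\<forall>i \<in> {0..n - 1}.
           \<phi> (gperm n [^]\<^bsub>Mon n S\<^esub> i) = h0 [^]\<^bsub>Mon n S\<^esub> (i + 2) \<and>
           \<phi> (hperm n \<otimes>\<^bsub>Mon n S\<^esub> gperm n [^]\<^bsub>Mon n S\<^esub> i) = h0 [^]\<^bsub>Mon n S\<^esub> (i + 1)))))"

definition endo7 :: "pmap set \<Rightarrow> (pmap \<Rightarrow> pmap) \<Rightarrow> bool" where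
  "endo7 S \<phi> \<longleftrightarrow> (\<exists>f \<in> idempotents S. \<forall>s \<in> S. \<phi> s = f)"

lemma less_iff_atMost: "n > 0 \<Longrightarrow> i \<in> {0..n - 1} \<longleftrightarrow> i < (n::nat)"
  by auto

lemma group_idempotent: "group (comp_structure G e) \<Longrightarrow> x \<in> G \<Longrightarrow> x \<Zsemi> x = x \<Longrightarrow> x = e"
  using group.l_cancel_one[of "comp_structure G e" x x] by simp

lemma group_pow_ppow:
  assumes "group (comp_structure G e)" "x \<in> G" "k > 0"
  shows "x [^]\<^bsub>comp_structure G e\<^esub> k = ppow x k"
  using comp_structure_pow[of G e "comp_structure G e" x k] assms(3) monoid.l_one[OF group.is_monoid[OF assms(1)], of x] assms(2) by simp

subsection \<open>From the types to endomorphisms\<close>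

context oriented_monoid
begin

lemma finite_S: "finite S"
  using finite_subset[OF _ finite_PT[of n]] S_PT by blast

lemma unit_pinv: "s \<in> S \<Longrightarrow> s \<in> Sym n \<Longrightarrow> pinv s \<in> S"
  using S_cases POP_pinv[of s n] POR_pinv[of s n] pinv_Sym[of s n] Sym_PI[of s n] pinv_PI[of s n] Sym_FT[of "pinv s" n]
  by (auto simp: OP_def POPI_def OR_def PORI_def)

lemma rank_one_pair:
  obtains s t where "s \<in> S" "t \<in> S" "s \<noteq> t" "rank s = 1" "rank t = 1"
proof -
  have n: "1 \<in> \<Omega> n" "2 \<in> \<Omega> n" using n3 by (auto simp: \<Omega>_def)
  consider "S \<in> {OP n, OR n}" | "S \<in> {POPI n, POP n, PORI n, POR n}" using S_cases by blast
  then show ?thesis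
  proof cases
    case 1
    have r: "rank (cst n j) = 1" for j
    proof -
      have "ran (cst n j) = {j}" using n(1) by (auto simp: ran_def cst_def full_map_Some_iff)
      then show ?thesis by (simp add: rank_def)
    qed
    have "cst n 1 1 \<noteq> cst n 2 1" using n by simp
    then have "cst n 1 \<noteq> cst n 2" by metis
    then show ?thesis using that[of "cst n 1" "cst n 2"] S_full[OF 1] cst_OP n r by blast
  next
    case 2
    have "rid {j} \<in> S" if "j \<in> \<Omega> n" for j
      using S_partial[OF 2] that rid_POP[of "{j}" n] rid_PI[of "{j}" n] by (auto simp: POPI_def)
    moreover have "rid {1} 1 \<noteq> rid {2} 1" by (simp add: rid_def)
    then have "rid {1} \<noteq> rid {2}" by metis
    ultimately show ?thesis using that[of "rid {1}" "rid {2}"] n by simp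
  qed
qed

lemma nonunit_ex: "\<exists>s. s \<in> S - Sym n"
proof -
  obtain s where "s \<in> S" "rank s = 1" using rank_one_pair by metis
  then show ?thesis using rank_full_iff[OF S_PT] n3 by force
qed

text \<open>As S is finite, some subgroup above H is maximal. Its identity is again
  \<open>e\<close>, because \<open>e\<close> is idempotent and a group has only one
  idempotent.\<close>

lemma maximal_subgroup_ex:
  assumes "subgroup_of S H e"
  shows "\<exists>G. maximal_subgroup_of S G e \<and> H \<subseteq> G"
proof -
  let ?F = "{G. (\<exists>e'. subgroup_of S G e') \<and> H \<subseteq> G}"
  have "?F \<subseteq> Pow S" by (auto simp: subgroup_of_def)
  then have "finite ?F" using finite_S finite_subset by blast
  moreover have "H \<in> ?F" using assms by blast
  ultimately obtain G where G: "G \<in> ?F" "\<And>G'. G' \<in> ?F \<Longrightarrow> G \<subseteq> G' \<Longrightarrow> G = G'"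
    using finite_has_maximal2[of ?F H] by (metis (no_types, lifting))
  then obtain e' where e': "subgroup_of S G e'" by blast
  have "group (comp_structure H e)" using assms by (simp add: subgroup_of_def)
  then have "e \<in> H" "e \<Zsemi> e = e"
    using monoid.one_closed[OF group.is_monoid, of "comp_structure H e"] monoid.l_one[OF group.is_monoid, of "comp_structure H e" e] by simp_all
  then have "e = e'" using group_idempotent[of G e' e] e' G(1) by (auto simp: subgroup_of_def)
  then have "maximal_subgroup_of S G e"
    unfolding maximal_subgroup_of_def using e' G by blast
  then show ?thesis using G(1) by blast
qed

lemma hom_constI:
  assumes "\<phi> \<in> S \<rightarrow> S" "\<And>s. s \<in> S \<Longrightarrow> s \<notin> Sym n \<Longrightarrow> \<phi> s = f" "f \<Zsemi> f = f"
    and "\<And>s. s \<in> S \<Longrightarrow> s \<in> Sym n \<Longrightarrow> \<phi> s \<Zsemi> f = f \<and> f \<Zsemi> \<phi> s = f"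
    and "\<And>s t. s \<in> S \<Longrightarrow> t \<in> S \<Longrightarrow> s \<in> Sym n \<Longrightarrow> t \<in> Sym n \<Longrightarrow> \<phi> (s \<Zsemi> t) = \<phi> s \<Zsemi> \<phi> t"
  shows "\<phi> \<in> hom (Mon n S) (Mon n S)"
  unfolding hom_def
proof (simp only: Mon_simps mem_Collect_eq, intro conjI ballI assms(1))
  fix s t assume st: "s \<in> S" "t \<in> S"
  then show "\<phi> (s \<Zsemi> t) = \<phi> s \<Zsemi> \<phi> t"
    using Sym_mult_iff[OF st] assms(2)[OF S_mult[OF st]] assms(2-5)
    by (cases "s \<in> Sym n"; cases "t \<in> Sym n") simp_all
qed

text \<open>Serves type 5 and all three variants of type 6: each prescribes the images of rotations
  and reflections by a dihedral pair, possibly a degenerate one.\<close>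

lemma hom_dihI:
  assumes \<phi>: "\<phi> \<in> S \<rightarrow> S" and N: "\<And>s. s \<in> S \<Longrightarrow> s \<notin> Sym n \<Longrightarrow> \<phi> s = f" and f: "f \<Zsemi> f = f"
    and P: "dihedral_pair (comp_structure G e) x y n"
    and val: "\<And>i. i < n \<Longrightarrow> \<phi> (rot n i) = x [^]\<^bsub>comp_structure G e\<^esub> i"
      "\<And>i. i < n \<Longrightarrow> \<phi> (hperm n \<Zsemi> rot n i) = y \<Zsemi> x [^]\<^bsub>comp_structure G e\<^esub> i"
    and absorb: "e \<Zsemi> f = f" "f \<Zsemi> e = f" "x \<Zsemi> f = f" "f \<Zsemi> x = f" "y \<Zsemi> f = f" "f \<Zsemi> y = f"
  shows "\<phi> \<in> hom (Mon n S) (Mon n S)"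
proof (rule hom_constI[OF \<phi> N f])
  let ?G = "comp_structure G e"
  let ?D = "dih_elt (Mon n (Sym n)) (gperm n) (hperm n)"
  have val': "\<phi> (?D \<epsilon> i) = dih_elt ?G x y \<epsilon> i" if "i < n" for \<epsilon> i
    using val[OF that] unfolding dih_elt_Sym by (cases \<epsilon>) (simp_all add: dih_elt_def)
  have units: "\<exists>\<epsilon> i. i < n \<and> s = ?D \<epsilon> i" if "s \<in> S" "s \<in> Sym n" for s
  proof -
    obtain i where "i < n" "s = rot n i \<or> s = hperm n \<Zsemi> rot n i" using S_Sym_cases \<open>s \<in> S\<close> \<open>s \<in> Sym n\<close> by blast
    then show ?thesis unfolding dih_elt_Sym by metis
  qed
  have pow_absorb: "x [^]\<^bsub>?G\<^esub> (i::nat) \<Zsemi> f = f \<and> f \<Zsemi> x [^]\<^bsub>?G\<^esub> i = f" for i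
  proof (induction i)
    case (Suc i)
    have "x [^]\<^bsub>?G\<^esub> Suc i = x [^]\<^bsub>?G\<^esub> i \<Zsemi> x" by (simp add: nat_pow_def)
    moreover have "f \<Zsemi> (x [^]\<^bsub>?G\<^esub> i \<Zsemi> x) = f \<Zsemi> x [^]\<^bsub>?G\<^esub> i \<Zsemi> x" by (simp only: pmult_assoc)
    ultimately show ?case using Suc absorb by (simp only: pmult_assoc)
  qed (simp add: absorb)
  have elt_absorb: "dih_elt ?G x y \<epsilon> i \<Zsemi> f = f \<and> f \<Zsemi> dih_elt ?G x y \<epsilon> i = f" for \<epsilon> i
  proof (cases \<epsilon>)
    case True
    have "f \<Zsemi> (y \<Zsemi> x [^]\<^bsub>?G\<^esub> i) = f \<Zsemi> y \<Zsemi> x [^]\<^bsub>?G\<^esub> i" by (simp only: pmult_assoc)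
    then show ?thesis using True pow_absorb[of i] absorb by (simp add: dih_elt_def pmult_assoc)
  qed (simp add: dih_elt_def pow_absorb)
  show "\<phi> s \<Zsemi> f = f \<and> f \<Zsemi> \<phi> s = f" if st: "s \<in> S" "s \<in> Sym n" for s
  proof -
    obtain \<epsilon> i where "i < n" "s = ?D \<epsilon> i" using units st by blast
    then show ?thesis using val' elt_absorb by simp
  qed
  show "\<phi> (s \<Zsemi> t) = \<phi> s \<Zsemi> \<phi> t" if st: "s \<in> S" "t \<in> S" "s \<in> Sym n" "t \<in> Sym n" for s t
  proof -
    obtain \<epsilon> i where s: "s = ?D \<epsilon> i" using units st by blast
    obtain \<delta> j where t: "t = ?D \<delta> j" using units st by blast
    show ?thesis
      using dihedral_pair_hom[where f = \<phi>, OF dihedral_pair_Sym[OF n0] P val', of \<epsilon> i \<delta> j] unfolding s t by simp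
  qed
qed

lemma endo1_hom: "\<phi> \<in> S \<rightarrow> S \<Longrightarrow> endo1 n S \<phi> \<Longrightarrow> \<phi> \<in> hom (Mon n S) (Mon n S)"
  unfolding hom_def endo1_def using S_mult S_PT conj_by_mult Dih_Sym by auto

lemma sigma_Sym:
  assumes "x \<in> \<Omega> n" "gcd k n = 1" shows "sigma n x k \<in> Sym n"
  unfolding sigma_def
proof (rule full_map_Sym)
  have x: "x \<ge> 1" using assms(1) by (simp add: \<Omega>_def)
  have res: "residue n (x + (i - 1) * k) = (x - 1 + (i - 1) * k) mod n + 1" for i
    using x n0 by (subst residue_eq) simp_all
  show "(\<lambda>i. residue n (x + (i - 1) * k)) \<in> \<Omega> n \<rightarrow> \<Omega> n"
    unfolding res using n0 by (auto simp: \<Omega>_def Suc_le_eq)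
  have le: "i = j" if ij: "i \<in> \<Omega> n" "j \<in> \<Omega> n" "i \<le> j"
    "residue n (x + (i - 1) * k) = residue n (x + (j - 1) * k)" for i j
  proof -
    have "(x - 1 + (j - 1) * k) mod n = (x - 1 + (i - 1) * k) mod n" using ij(4) unfolding res by simp
    then have "((j - 1) * k) mod n = ((i - 1) * k) mod n" by (simp only: mod_add_lcancel)
    moreover have "(i - 1) * k \<le> (j - 1) * k" using ij(3) by (intro mult_le_mono1) simp
    ultimately have "n dvd (j - 1) * k - (i - 1) * k" using mod_eq_dvd_iff_nat by blast
    then have "n dvd (j - 1 - (i - 1)) * k" by (simp only: diff_mult_distrib)
    moreover have "coprime n k" using assms(2) by (simp add: coprime_iff_gcd_eq_1 gcd.commute)
    ultimately have "n dvd j - 1 - (i - 1)" by (simp only: coprime_dvd_mult_left_iff)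
    moreover have "j - 1 - (i - 1) < n" using ij by (auto simp: \<Omega>_def)
    ultimately have "j - 1 - (i - 1) = 0" by (metis dvd_imp_le not_gr_zero not_le)
    then show ?thesis using ij by (auto simp: \<Omega>_def)
  qed
  show "inj_on (\<lambda>i. residue n (x + (i - 1) * k)) (\<Omega> n)"
  proof (rule inj_onI)
    fix i j assume "i \<in> \<Omega> n" "j \<in> \<Omega> n" "residue n (x + (i - 1) * k) = residue n (x + (j - 1) * k)"
    then show "i = j" using le[of i j] le[of j i] by (cases "i \<le> j") simp_all
  qed
qed

lemma endo2_hom:
  assumes "\<phi> \<in> S \<rightarrow> S" "endo2 n S \<phi>" shows "\<phi> \<in> hom (Mon n S) (Mon n S)"
proof -
  obtain \<sigma> where \<sigma>: "\<sigma> \<in> Nrm n" "\<And>s. s \<in> S \<Longrightarrow> \<phi> s = conj_by n \<sigma> (phi0 n s)" using assms by (auto simp: endo2_def)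
  then have "\<sigma> \<in> Sym n" using sigma_Sym by (auto simp: Nrm_def)
  then show ?thesis
    unfolding hom_def using assms(1) \<sigma>(2) S_mult S_PT n0 by (auto simp: conj_by_mult phi0_mult phi0_PT)
qed

lemma image_nonunits: "\<phi> ` I_set (n - 1) S = {f} \<Longrightarrow> s \<in> S \<Longrightarrow> s \<notin> Sym n \<Longrightarrow> \<phi> s = f"
  unfolding I_set_eq by blast

lemma endo3_hom:
  assumes "\<phi> \<in> S \<rightarrow> S" "endo3 n S \<phi>" shows "\<phi> \<in> hom (Mon n S) (Mon n S)"
proof -
  obtain e f where ef: "e \<Zsemi> e = e" "f \<Zsemi> f = f" "e \<Zsemi> f = f" "f \<Zsemi> e = f"
    "\<phi> ` J_set n S = {e}" "\<phi> ` I_set (n - 1) S = {f}"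
    using assms(2) unfolding endo3_def idempotents_def Mon_simps by blast
  have u: "\<phi> s = e" if "s \<in> S" "s \<in> Sym n" for s using ef(5) that unfolding J_set_eq by blast
  show ?thesis
    by (rule hom_constI[OF assms(1) image_nonunits[OF ef(6)] ef(2)]) (simp_all add: u ef Sym_mult S_mult)
qed

lemma endo4_hom:
  assumes "\<phi> \<in> S \<rightarrow> S" "endo4 n S \<phi>" shows "\<phi> \<in> hom (Mon n S) (Mon n S)"
proof -
  obtain p g0 G e where S: "S \<in> {POPI n, POP n}" and p: "p dvd n" "p > 1" and
    max: "maximal_subgroup_of S G e" and g0: "g0 \<in> G" and ord: "group.ord (comp_structure G e) g0 = p"
    and val: "\<And>i. i < n \<Longrightarrow> \<phi> (gperm n [^]\<^bsub>Mon n S\<^esub> i) = g0 [^]\<^bsub>Mon n S\<^esub> (i + p)"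
    and I: "\<phi> ` I_set (n - 1) S = {Map.empty}"
    using assms(2) n0 unfolding endo4_def group_element_of_order_def by (auto simp: less_iff_atMost)
  let ?G = "comp_structure G e"
  have grp: "group ?G" and GS: "G \<subseteq> S" using max by (auto simp: maximal_subgroup_of_def subgroup_of_def)
  interpret group ?G by (rule grp)
  have pw: "g0 [^]\<^bsub>?G\<^esub> (i mod n) = g0 [^]\<^bsub>?G\<^esub> i" for i
  proof -
    have "g0 [^]\<^bsub>?G\<^esub> n = e" using pow_eq_id[of g0 n] g0 ord p by simp
    then have "g0 [^]\<^bsub>?G\<^esub> (n * (i div n)) = e" using g0 nat_pow_pow[of g0 n "i div n"] nat_pow_one[of "i div n"] by simp
    then have "g0 [^]\<^bsub>?G\<^esub> (n * (i div n) + i mod n) = g0 [^]\<^bsub>?G\<^esub> (i mod n)"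
      using g0 nat_pow_mult[of g0 "n * (i div n)" "i mod n"] l_one[of "g0 [^]\<^bsub>?G\<^esub> (i mod n)"] nat_pow_closed[of g0 "i mod n"] by simp
    then show ?thesis by simp
  qed
  have rot: "\<phi> (rot n i) = g0 [^]\<^bsub>?G\<^esub> i" if "i < n" for i
  proof -
    have "\<phi> (rot n i) = ppow g0 (i + p)"
      using val[OF that] Mon_pow[of g0 n "i + p" S] S_PT GS g0 p by (auto simp: gperm_pow)
    also have "\<dots> = g0 [^]\<^bsub>?G\<^esub> (i + p)" using group_pow_ppow[OF grp g0] p by simp
    also have "\<dots> = g0 [^]\<^bsub>?G\<^esub> i"
      using g0 nat_pow_mult[of g0 i p] pow_ord_eq_1[of g0] ord r_one[of "g0 [^]\<^bsub>?G\<^esub> i"] nat_pow_closed[of g0 i] by simp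
    finally show ?thesis .
  qed
  show ?thesis
  proof (rule hom_constI[OF assms(1) image_nonunits[OF I]])
    show "\<phi> (s \<Zsemi> t) = \<phi> s \<Zsemi> \<phi> t" if st: "s \<in> S" "t \<in> S" "s \<in> Sym n" "t \<in> Sym n" for s t
    proof -
      obtain i where i: "i < n" "s = rot n i" using POP_Sym_rot[OF S_POP st(3) n0] S st by blast
      obtain j where j: "j < n" "t = rot n j" using POP_Sym_rot[OF S_POP st(4) n0] S st by blast
      have "\<phi> (s \<Zsemi> t) = \<phi> (rot n ((i + j) mod n))" using i j by (simp add: rot_mult rot_mod)
      also have "\<dots> = g0 [^]\<^bsub>?G\<^esub> (i + j)" using rot[of "(i + j) mod n"] n0 pw by simp
      also have "\<dots> = \<phi> s \<Zsemi> \<phi> t" using i j rot g0 nat_pow_mult[of g0 i j] by simp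
      finally show ?thesis .
    qed
  qed (simp_all add: map_comp_def)
qed

lemma endo5_hom:
  assumes "\<phi> \<in> S \<rightarrow> S" "endo5 n S \<phi>" shows "\<phi> \<in> hom (Mon n S) (Mon n S)"
proof -
  obtain p g0 h0 G e where p: "p dvd n" "p > 1" and
    max: "maximal_subgroup_of S G e" and gh: "g0 \<in> G" "h0 \<in> G" and
    ord: "group.ord (comp_structure G e) h0 = 2" "group.ord (comp_structure G e) g0 = p" and
    dih: "dihedral_of_order_2times p (subgroup_generated (comp_structure G e) {g0, h0})"
    and val: "\<And>i. i < n \<Longrightarrow> \<phi> (gperm n [^]\<^bsub>Mon n S\<^esub> i) = g0 [^]\<^bsub>Mon n S\<^esub> (i + p)"
      "\<And>i. i < n \<Longrightarrow> \<phi> (hperm n \<otimes>\<^bsub>Mon n S\<^esub> gperm n [^]\<^bsub>Mon n S\<^esub> i) = h0 \<otimes>\<^bsub>Mon n S\<^esub> g0 [^]\<^bsub>Mon n S\<^esub> (i + p)"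
    and I: "\<phi> ` I_set (n - 1) S = {Map.empty}"
    using assms(2) n0 unfolding endo5_def by (auto simp: less_iff_atMost)
  let ?G = "comp_structure G e"
  have grp: "group ?G" and GS: "G \<subseteq> S" using max by (auto simp: maximal_subgroup_of_def subgroup_of_def)
  interpret group ?G by (rule grp)
  have P: "dihedral_pair ?G g0 h0 n"
  proof (intro dihedral_pair.intro grp dihedral_pair_axioms.intro)
    show "g0 [^]\<^bsub>?G\<^esub> n = \<one>\<^bsub>?G\<^esub>" using pow_eq_id[of g0 n] gh ord p by simp
    show "h0 \<otimes>\<^bsub>?G\<^esub> h0 = \<one>\<^bsub>?G\<^esub>" using pow_ord_eq_1[of h0] l_one[of h0] gh ord by (simp add: numeral_2_eq_2)
    show "h0 \<otimes>\<^bsub>?G\<^esub> g0 \<otimes>\<^bsub>?G\<^esub> h0 = inv\<^bsub>?G\<^esub> g0"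
      using dihedral_order_2timesD[OF grp _ _ ord(2,1) _ dih] gh p by simp
  qed (use gh n0 in simp_all)
  have pw: "g0 [^]\<^bsub>Mon n S\<^esub> (i + p) = g0 [^]\<^bsub>?G\<^esub> i" for i
  proof -
    have "g0 [^]\<^bsub>Mon n S\<^esub> (i + p) = ppow g0 (i + p)" using Mon_pow[of g0 n "i + p" S] S_PT GS gh p by auto
    also have "\<dots> = g0 [^]\<^bsub>?G\<^esub> (i + p)" using group_pow_ppow[OF grp gh(1)] p by simp
    also have "\<dots> = g0 [^]\<^bsub>?G\<^esub> i"
      using gh nat_pow_mult[of g0 i p] pow_ord_eq_1[of g0] ord r_one[of "g0 [^]\<^bsub>?G\<^esub> i"] nat_pow_closed[of g0 i] by simp
    finally show ?thesis .
  qed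
  show ?thesis
  proof (rule hom_dihI[OF assms(1) image_nonunits[OF I] _ P])
    show "\<phi> (rot n i) = g0 [^]\<^bsub>?G\<^esub> i" if "i < n" for i using val(1)[OF that] by (simp add: pw gperm_pow)
    show "\<phi> (hperm n \<Zsemi> rot n i) = h0 \<Zsemi> g0 [^]\<^bsub>?G\<^esub> i" if "i < n" for i
      using val(2)[OF that] by (simp add: pw gperm_pow)
  qed (simp_all add: map_comp_def)
qed

lemma endo6_hom:
  assumes "\<phi> \<in> S \<rightarrow> S" "endo6 n S \<phi>" shows "\<phi> \<in> hom (Mon n S) (Mon n S)"
proof -
  obtain h0 f G e where 
    max: "maximal_subgroup_of S G e" and h0: "h0 \<in> G" and ord: "group.ord (comp_structure G e) h0 = 2"
    and f: "f \<Zsemi> f = f" "h0 \<Zsemi> f = f" "f \<Zsemi> h0 = f" and I: "\<phi> ` I_set (n - 1) S = {f}"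
    and val: "(\<forall>i<n. \<phi> (rot n i) = h0 [^]\<^bsub>Mon n S\<^esub> (2::nat) \<and> \<phi> (hperm n \<Zsemi> rot n i) = h0) \<or>
      (even n \<and> (\<forall>i<n. \<phi> (rot n i) = h0 [^]\<^bsub>Mon n S\<^esub> (i + 2) \<and> \<phi> (hperm n \<Zsemi> rot n i) = h0 [^]\<^bsub>Mon n S\<^esub> (i + 2))) \<or>
      (even n \<and> (\<forall>i<n. \<phi> (rot n i) = h0 [^]\<^bsub>Mon n S\<^esub> (i + 2) \<and> \<phi> (hperm n \<Zsemi> rot n i) = h0 [^]\<^bsub>Mon n S\<^esub> (i + 1)))"
    using assms(2) unfolding endo6_def group_element_of_order_def idempotents_def Mon_simps gperm_pow Ball_def less_iff_atMost[OF n0]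
    by blast
  let ?G = "comp_structure G e"
  have grp: "group ?G" and GS: "G \<subseteq> S" using max by (auto simp: maximal_subgroup_of_def subgroup_of_def)
  interpret group ?G by (rule grp)
  have hh: "h0 \<Zsemi> h0 = e" using pow_ord_eq_1[of h0] l_one[of h0] h0 ord by (simp add: numeral_2_eq_2)
  have e: "e \<in> G" "e \<Zsemi> e = e" "e \<Zsemi> h0 = h0" "h0 \<Zsemi> e = h0" using one_closed l_one[of e] l_one[of h0] r_one[of h0] h0 by simp_all
  have ef: "e \<Zsemi> f = f" "f \<Zsemi> e = f"
    using f unfolding hh[symmetric] by (simp_all only: pmult_assoc, simp flip: pmult_assoc)
  have M: "h0 [^]\<^bsub>Mon n S\<^esub> k = h0 [^]\<^bsub>?G\<^esub> k" if "k > 0" for k :: nat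
    using Mon_pow[of h0 n k S] group_pow_ppow[OF grp h0, of k] S_PT GS h0 that by auto
  have two: "h0 [^]\<^bsub>?G\<^esub> (i + 2) = h0 [^]\<^bsub>?G\<^esub> i" for i :: nat
    using h0 nat_pow_mult[of h0 i 2] pow_ord_eq_1[of h0] ord r_one[of "h0 [^]\<^bsub>?G\<^esub> i"] nat_pow_closed[of h0 i] by simp
  have M2: "h0 [^]\<^bsub>Mon n S\<^esub> (i + 2) = h0 [^]\<^bsub>?G\<^esub> i" for i :: nat
    using M[of "i + 2"] unfolding two by simp
  have M1: "h0 [^]\<^bsub>Mon n S\<^esub> (i + 1) = h0 [^]\<^bsub>?G\<^esub> (i + 1)" for i :: nat
    by (rule M) simp
  have even_pow: "h0 [^]\<^bsub>?G\<^esub> n = e" if "even n" using pow_eq_id[of h0 n] h0 ord that by simp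
  have inv: "inv\<^bsub>?G\<^esub> e = e" "inv\<^bsub>?G\<^esub> h0 = h0" using inv_one inv_equality[of h0 h0] hh h0 by simp_all
  \<comment> \<open>The variants of type 6 are the degenerate pairs e, h0 and h0, e and h0, h0. The
    last two need h0 to the power n to be e, hence n even.\<close>
  have P1: "dihedral_pair ?G e h0 n" 
    by (intro dihedral_pair.intro grp dihedral_pair_axioms.intro) (use h0 n0 hh e inv nat_pow_one[of n] in simp_all)
  have P2: "dihedral_pair ?G h0 e n" if "even n"
    by (intro dihedral_pair.intro grp dihedral_pair_axioms.intro) (use h0 n0 hh e inv even_pow[OF that] in simp_all)
  have P3: "dihedral_pair ?G h0 h0 n" if "even n"
    by (intro dihedral_pair.intro grp dihedral_pair_axioms.intro) (use h0 n0 hh e inv even_pow[OF that] in simp_all)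
  from val show ?thesis
  proof (elim disjE conjE)
    assume v: "\<forall>i<n. \<phi> (rot n i) = h0 [^]\<^bsub>Mon n S\<^esub> (2::nat) \<and> \<phi> (hperm n \<Zsemi> rot n i) = h0"
    have "e [^]\<^bsub>?G\<^esub> i = e" for i :: nat using nat_pow_one[of i] by simp
    moreover have "h0 [^]\<^bsub>?G\<^esub> (2::nat) = e" using two[of 0] by (simp only: add_0 nat_pow_0 comp_structure_simps)
    ultimately show ?thesis
      using v M[of 2] by (intro hom_dihI[OF assms(1) image_nonunits[OF I] f(1) P1]) (simp_all add: e f ef)
  next
    assume "even n" and v: "\<forall>i<n. \<phi> (rot n i) = h0 [^]\<^bsub>Mon n S\<^esub> (i + 2) \<and> \<phi> (hperm n \<Zsemi> rot n i) = h0 [^]\<^bsub>Mon n S\<^esub> (i + 2)"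
    have "e \<Zsemi> h0 [^]\<^bsub>?G\<^esub> i = h0 [^]\<^bsub>?G\<^esub> i" for i :: nat using l_one[of "h0 [^]\<^bsub>?G\<^esub> i"] nat_pow_closed[of h0 i] h0 by simp
    then show ?thesis
      using v[unfolded M2] by (intro hom_dihI[OF assms(1) image_nonunits[OF I] f(1) P2[OF \<open>even n\<close>]]) (simp_all add: e f ef)
  next
    assume "even n" and v: "\<forall>i<n. \<phi> (rot n i) = h0 [^]\<^bsub>Mon n S\<^esub> (i + 2) \<and> \<phi> (hperm n \<Zsemi> rot n i) = h0 [^]\<^bsub>Mon n S\<^esub> (i + 1)"
    have "h0 \<Zsemi> h0 [^]\<^bsub>?G\<^esub> i = h0 [^]\<^bsub>?G\<^esub> (i + 1)" for i :: nat using nat_pow_Suc2[of h0 i] h0 by simp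
    then show ?thesis
      using v[unfolded M2 M1] by (intro hom_dihI[OF assms(1) image_nonunits[OF I] f(1) P3[OF \<open>even n\<close>]]) (simp_all add: e f ef)
  qed
qed

lemma endo7_hom: "\<phi> \<in> S \<rightarrow> S \<Longrightarrow> endo7 S \<phi> \<Longrightarrow> \<phi> \<in> hom (Mon n S) (Mon n S)"
  unfolding hom_def endo7_def idempotents_def using S_mult by auto

end

subsection \<open>Endomorphisms that are constant on the non-units\<close>

text \<open>A reversing map reverses the cyclic order of three points with distinct images, which is
  impossible if it fixes them.\<close>

lemma three_fixpoints_POP:
  assumes y: "y \<in> POR n" and abc: "y a = Some a" "y b = Some b" "y c = Some c" "a \<noteq> b" "b \<noteq> c" "a \<noteq> c"
  shows "y \<in> POP n"
proof (rule ccontr)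
  assume "y \<notin> POP n"
  then have P: "y \<Zsemi> hperm n \<in> POP n" using y POR_iff by blast
  have n: "a \<in> \<Omega> n" "b \<in> \<Omega> n" "c \<in> \<Omega> n" using abc PT_D[OF POR_PT[OF y]] by blast+
  have no: "\<not> cyc3 u v w" if "y u = Some u" "y v = Some v" "y w = Some w" "u \<noteq> v" "v \<noteq> w" "u \<noteq> w" "u \<in> \<Omega> n" "v \<in> \<Omega> n" "w \<in> \<Omega> n" for u v w
  proof
    assume c: "cyc3 u v w"
    have "cyc3 (n + 1 - u) (n + 1 - v) (n + 1 - w)"
      by (rule POP_cyc3[OF P _ _ _ c]) (use that in \<open>auto simp: \<Omega>_def\<close>)
    then have "cyc3 w v u" using that(7-9) by (auto simp: cyc3_def \<Omega>_def)
    then show False using c cyc3_asym by blast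
  qed
  show False using cyc3_total[OF abc(4,5,6)] no[OF abc(1,2,3)] no[OF abc(2,1,3)] abc n by blast
qed

context oriented_endo
begin

lemma phi_pid_idem: "\<phi> (pid n) \<Zsemi> \<phi> (pid n) = \<phi> (pid n)"
  using phi_pid_mult(1)[OF pid_S] .

lemma unit_image_group: "subgroup_of S (\<phi> ` (S \<inter> Sym n)) (\<phi> (pid n))"
  unfolding subgroup_of_def
proof
  show "\<phi> ` (S \<inter> Sym n) \<subseteq> S" using phi_S by blast
  show "group (comp_structure (\<phi> ` (S \<inter> Sym n)) (\<phi> (pid n)))"
  proof (rule groupI, simp_all only: comp_structure_simps)
    fix x y assume "x \<in> \<phi> ` (S \<inter> Sym n)" "y \<in> \<phi> ` (S \<inter> Sym n)"
    then obtain s t where st: "s \<in> S \<inter> Sym n" "t \<in> S \<inter> Sym n" "x = \<phi> s" "y = \<phi> t" by blast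
    then have "x \<Zsemi> y = \<phi> (s \<Zsemi> t)" by (simp add: phi_mult)
    then show "x \<Zsemi> y \<in> \<phi> ` (S \<inter> Sym n)" using st S_mult Sym_mult by blast
  next
    show "\<phi> (pid n) \<in> \<phi> ` (S \<inter> Sym n)" using pid_S pid_Sym by blast
  next
    fix x y z show "x \<Zsemi> y \<Zsemi> z = x \<Zsemi> (y \<Zsemi> z)" by (rule pmult_assoc)
  next
    fix x assume "x \<in> \<phi> ` (S \<inter> Sym n)"
    then obtain s where s: "s \<in> S" "s \<in> Sym n" "x = \<phi> s" by blast
    show "\<phi> (pid n) \<Zsemi> x = x" using phi_pid_mult(1)[OF s(1)] s by simp
    have "\<phi> (pinv s) \<Zsemi> x = \<phi> (pid n)"
      unfolding s(3) phi_mult[OF unit_pinv[OF s(1,2)] s(1), symmetric] pinv_Sym_left[OF s(2)] ..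
    then show "\<exists>y \<in> \<phi> ` (S \<inter> Sym n). y \<Zsemi> x = \<phi> (pid n)" using unit_pinv s(1,2) pinv_Sym by blast
  qed
qed

text \<open>Some power of s is the identity, so the image of s satisfies the periodicity asked for
  in \<open>POP_fixpoint_idempotent\<close>. An idempotent with a power equal to
  \<open>\<phi> (pid n)\<close> is \<open>\<phi> (pid n)\<close>.\<close>

lemma unit_fixpoint:
  assumes s: "s \<in> S" "s \<in> Sym n" and "\<phi> s \<in> POP n" "\<phi> s a = Some a"
  shows "\<phi> s = \<phi> (pid n)"
proof -
  obtain k where k: "k > 0" "ppow s k = pid n" using Sym_pow s(2) by blast
  have in_S: "ppow s (Suc j) \<in> S" for j by (induction j) (use s S_mult in auto)
  have "ppow (\<phi> s) (Suc j) = \<phi> (ppow s (Suc j))" for j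
  proof (induction j)
    case (Suc j)
    have "ppow (\<phi> s) (Suc (Suc j)) = ppow (\<phi> s) (Suc j) \<Zsemi> \<phi> s" by (rule ppow.simps(2))
    also have "\<dots> = \<phi> (ppow s (Suc j)) \<Zsemi> \<phi> s" unfolding Suc ..
    also have "\<dots> = \<phi> (ppow s (Suc (Suc j)))" unfolding phi_mult[OF in_S s(1), symmetric] by (simp only: ppow.simps(2))
    finally show ?case .
  qed simp
  then have p: "ppow (\<phi> s) k = \<phi> (pid n)" using k by (metis gr0_conv_Suc)
  then have "\<phi> s \<Zsemi> ppow (\<phi> s) k = \<phi> s" using phi_pid_mult(2)[OF s(1)] by simp
  from POP_fixpoint_idempotent[OF assms(3,4) this k(1)] have idem: "\<phi> s \<Zsemi> \<phi> s = \<phi> s" .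
  have "ppow (\<phi> s) (Suc j) = \<phi> s" for j
  proof (induction j)
    case (Suc j)
    have "ppow (\<phi> s) (Suc (Suc j)) = ppow (\<phi> s) (Suc j) \<Zsemi> \<phi> s" by (rule ppow.simps(2))
    then show ?case using Suc idem by simp
  qed simp
  then show ?thesis using p k(1) by (metis gr0_conv_Suc)
qed

text \<open>With x and y the images of g and h, the split is by the image of the unit group: trivial
  (types 3 and 7), nontrivial cyclic unit group (type 4), and for a dihedral unit group x trivial
  (6a), y a power of x (6b and 6c), or a faithful dihedral image (type 5).\<close>

lemma const_cases:
  assumes const: "\<And>s. s \<in> S \<Longrightarrow> s \<notin> Sym n \<Longrightarrow> \<phi> s = f"
  shows "endo3 n S \<phi> \<or> endo4 n S \<phi> \<or> endo5 n S \<phi> \<or> endo6 n S \<phi> \<or> endo7 S \<phi>"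
proof -
  define e where "e = \<phi> (pid n)"
  define x where "x = \<phi> (rot n 1)"
  obtain w where w: "w \<in> S" "w \<notin> Sym n" using nonunit_ex by blast
  have fS: "f \<in> S" using phi_S[OF w(1)] const[OF w] by simp
  have I: "\<phi> ` I_set (n - 1) S = {f}" unfolding I_set_eq using const w by blast
  have wm: "s \<Zsemi> w \<notin> Sym n" "w \<Zsemi> s \<notin> Sym n" if "s \<in> S" for s using Sym_mult_iff w that by blast+
  have absorb: "\<phi> s \<Zsemi> f = f" "f \<Zsemi> \<phi> s = f" if "s \<in> S" for s
    using phi_mult[OF that w(1)] phi_mult[OF w(1) that] const[OF w] const[OF S_mult wm(1)] const[OF S_mult wm(2)] that w(1) by simp_all
  have ff: "f \<Zsemi> f = f" using absorb(1)[OF w(1)] const[OF w] by simp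
  have f_idem: "f \<in> idempotents S" using fS ff by (simp add: idempotents_def)
  have e_idem: "e \<in> idempotents S" using phi_S[OF pid_S] phi_pid_idem by (simp add: idempotents_def e_def)
  obtain G where max: "maximal_subgroup_of S G e" and sub: "\<phi> ` (S \<inter> Sym n) \<subseteq> G"
    using maximal_subgroup_ex[OF unit_image_group] unfolding e_def by blast
  let ?G = "comp_structure G e"
  have grp: "group ?G" and GS: "G \<subseteq> S" using max by (auto simp: maximal_subgroup_of_def subgroup_of_def)
  interpret group ?G by (rule grp)
  have inG: "\<phi> s \<in> G" if "s \<in> S" "s \<in> Sym n" for s using sub that by blast
  have xG: "x \<in> G" using inG rot_S rot_Sym by (simp add: x_def)
  have fixf: "\<phi> s a = Some a" if "s \<in> S" "a \<in> ran f" for s a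
  proof -
    obtain b where b: "f b = Some a" using \<open>a \<in> ran f\<close> unfolding ran_def by blast
    have "(f \<Zsemi> \<phi> s) b = Some a" using absorb(2)[OF \<open>s \<in> S\<close>] b by simp
    then show ?thesis using b by simp
  qed
  have xpow: "x [^]\<^bsub>?G\<^esub> i = \<phi> (rot n i)" for i :: nat
  proof (induction i)
    case 0
    then show ?case by (simp add: nat_pow_def e_def)
  next
    case (Suc i)
    then show ?case by (simp add: x_def phi_rot)
  qed
  define p where "p = ord x"
  have pn: "p dvd n" using pow_eq_id[of x n] xG xpow[of n] by (simp add: p_def e_def)
  have p0: "p > 0" using pn n0 by (rule dvd_pos_nat[rotated])
  have p1: "p > 1" if "x \<noteq> e"
    using ord_eq_1[of x] xG that p0 by (simp add: p_def nat_neq_iff) 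
  have Mx: "x [^]\<^bsub>Mon n S\<^esub> (i + p) = \<phi> (rot n i)" for i
  proof -
    have "x [^]\<^bsub>Mon n S\<^esub> (i + p) = ppow x (i + p)" using Mon_pow[of x n "i + p" S] S_PT GS xG p0 by auto
    also have "\<dots> = x [^]\<^bsub>?G\<^esub> (i + p)" using group_pow_ppow[OF grp xG] p0 by simp
    also have "\<dots> = x [^]\<^bsub>?G\<^esub> i"
      using xG nat_pow_mult[of x i p] pow_ord_eq_1[of x] r_one[of "x [^]\<^bsub>?G\<^esub> i"] nat_pow_closed[of x i] by (simp add: p_def)
    finally show ?thesis by (simp add: xpow)
  qed
  have f_empty: "f = Map.empty" if "ran f = {}"
    using that by (auto simp: ran_def fun_eq_iff) (metis not_None_eq)
  have not_full: "S \<notin> {OP n, OR n}" if "f = Map.empty"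
  proof
    assume "S \<in> {OP n, OR n}"
    then have "f \<in> FT n" using S_full fS by blast
    then have "\<Omega> n = {}" using that by (simp add: FT_def)
    then show False using n3 by (simp add: \<Omega>_def)
  qed
  show ?thesis
  proof (cases "\<forall>s \<in> S. s \<in> Sym n \<longrightarrow> \<phi> s = e")
    case True
    show ?thesis
    proof (cases "e = f")
      case True
      then have "endo7 S \<phi>" using \<open>\<forall>s \<in> S. s \<in> Sym n \<longrightarrow> \<phi> s = e\<close> const f_idem unfolding endo7_def by metis
      then show ?thesis by blast
    next
      case False
      have "\<phi> ` J_set n S = {e}" unfolding J_set_eq using True pid_S pid_Sym by blast
      then have "endo3 n S \<phi>"
        unfolding endo3_def using False e_idem f_idem I absorb[OF pid_S] by (auto simp: e_def)
      then show ?thesis by blast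
    qed
  next
    case nontrivial: False
    show ?thesis
    proof (cases "S \<in> {OP n, POPI n, POP n}")
      case True
      have xe: "x \<noteq> e"
      proof
        assume "x = e"
        have "\<phi> s = e" if st: "s \<in> S" "s \<in> Sym n" for s
        proof -
          obtain i where "s = rot n i" using POP_Sym_rot[OF S_POP[OF True] _ n0] st by blast
          then show ?thesis using xpow[of i] nat_pow_one[of i] \<open>x = e\<close> by simp
        qed
        then show False using nontrivial by blast
      qed
      \<comment> \<open>A point in the image of f would be fixed by x, which preserves orientation
        here, and x would be trivial.\<close>
      have "ran f = {}"
      proof (rule ccontr)
        assume "ran f \<noteq> {}"
        then obtain a where "a \<in> ran f" by blast
        then show False using unit_fixpoint[OF rot_S rot_Sym, of 1 a] S_POP[OF True phi_S[OF rot_S]] fixf[OF rot_S] xe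
          by (simp add: x_def e_def)
      qed
      then have fe: "f = Map.empty" by (rule f_empty)
      have "group_element_of_order S p x"
        unfolding group_element_of_order_def using max xG p_def by blast
      moreover have "S \<in> {POPI n, POP n}" using True not_full[OF fe] by blast
      moreover have "\<forall>i \<in> {0..n - 1}. \<phi> (rot n i) = x [^]\<^bsub>Mon n S\<^esub> (i + p)" using Mx by metis
      ultimately have "endo4 n S \<phi>"
        unfolding endo4_def gperm_pow using pn p1[OF xe] I[unfolded fe] by blast
      then show ?thesis by blast
    next
      case False
      then have S6: "S \<in> {OR n, PORI n, POR n}" using S_cases by blast
      then have hS: "hperm n \<in> S" by (rule hperm_S)
      define y where "y = \<phi> (hperm n)"
      have yG: "y \<in> G" using inG hS hperm_Sym by (simp add: y_def)
      have yy: "y \<Zsemi> y = e" using phi_mult[OF hS hS] by (simp add: y_def e_def)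
      have hrot: "\<phi> (hperm n \<Zsemi> rot n i) = y \<Zsemi> \<phi> (rot n i)" for i
        using phi_mult[OF hS rot_S] by (simp add: y_def)
      have conj: "y \<Zsemi> x \<Zsemi> y = inv\<^bsub>?G\<^esub> x"
      proof -
        obtain j where j: "(1 + j) mod n = 0" using rot_inverse[OF n0, of 1] by (rule exE)
        have "y \<Zsemi> x \<Zsemi> y = \<phi> (hperm n \<Zsemi> rot n 1 \<Zsemi> hperm n)"
          unfolding x_def y_def using phi_mult[OF hS rot_S] phi_mult[OF S_mult[OF hS rot_S] hS] by simp
        also have "\<dots> = \<phi> (rot n j)" by (simp only: hperm_rot_hperm[OF j])
        finally have yxy: "y \<Zsemi> x \<Zsemi> y = \<phi> (rot n j)" .
        have "rot n (j + 1) = rot n 0" using j by (intro rot_cong) (simp add: add.commute)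
        then have "\<phi> (rot n j) \<Zsemi> x = e" unfolding x_def phi_rot by (simp add: e_def)
        then have "inv\<^bsub>?G\<^esub> x = \<phi> (rot n j)" using inv_equality[of "\<phi> (rot n j)" x] xG inG[OF rot_S rot_Sym] by simp
        then show ?thesis using yxy by simp
      qed
      have P: "dihedral_pair ?G x y n"
        by (intro dihedral_pair.intro grp dihedral_pair_axioms.intro)
          (use xG yG n0 yy conj xpow[of n] in \<open>simp_all add: e_def\<close>)
      have ord2: "ord u = 2" if u: "u \<in> G" "u \<Zsemi> u = e" "u \<noteq> e" for u
      proof -
        have "u [^]\<^bsub>?G\<^esub> (2::nat) = e" using u l_one[of u] by (simp add: numeral_2_eq_2)
        then have "ord u dvd 2" using pow_eq_id[of u 2] u by simp
        moreover have "ord u \<noteq> 1" using ord_eq_1[of u] u by simp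
        ultimately show ?thesis using prime_nat_iff[of 2] two_is_prime_nat by blast
      qed
      have ge: "group_element_of_order S 2 u" if u: "u \<in> G" "u \<Zsemi> u = e" "u \<noteq> e" for u
        unfolding group_element_of_order_def using max u(1) ord2[OF u] by blast
      \<comment> \<open>Image points of f are fixed by \<open>\<phi> s\<close>; three of them would
        make it orientation-preserving and hence trivial.\<close>
      have frank: "rank f \<le> 2" if s: "s \<in> S" "s \<in> Sym n" "\<phi> s \<noteq> e" for s
      proof (rule ccontr)
        assume "\<not> rank f \<le> 2"
        then have "3 \<le> card (ran f)" by (simp add: rank_def)
        then obtain A where A: "A \<subseteq> ran f" "card A = 3" by (rule obtain_subset_with_card_n) blast
        then obtain a b c where abc: "A = {a, b, c}" "a \<noteq> b" "b \<noteq> c" "a \<noteq> c" by (auto simp: card_3_iff)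
        have fx: "\<phi> s a = Some a" "\<phi> s b = Some b" "\<phi> s c = Some c" using fixf[OF s(1)] A abc by auto
        have "\<phi> s \<in> POP n" using three_fixpoints_POP[OF S_POR[OF phi_S[OF s(1)]] fx abc(2,3,4)] .
        then show False using unit_fixpoint[OF s(1,2) _ fx(1)] s(3) by (simp add: e_def)
      qed
      have Mon2: "u [^]\<^bsub>Mon n S\<^esub> (k::nat) = u [^]\<^bsub>?G\<^esub> k" if "u \<in> G" "k > 0" for u k
        using Mon_pow[of u n k S] group_pow_ppow[OF grp that] S_PT GS that by auto
      show ?thesis
      proof (cases "x = e")
        case True
        have r: "\<phi> (rot n i) = e" for i using xpow[of i] nat_pow_one[of i] True by simp
        have "y \<noteq> e"
        proof
          assume "y = e"
          have "\<phi> s = e" if "s \<in> S" "s \<in> Sym n" for s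
          proof -
            obtain i where "s = rot n i \<or> s = hperm n \<Zsemi> rot n i" using S_Sym_cases[OF \<open>s \<in> S\<close> \<open>s \<in> Sym n\<close>] by blast
            then show ?thesis using r hrot \<open>y = e\<close> yy by auto
          qed
          then show False using nontrivial by blast
        qed
        have "y [^]\<^bsub>Mon n S\<^esub> (2::nat) = e" using Mon2[OF yG, of 2] yG yy l_one[of y] by (simp add: numeral_2_eq_2)
        moreover have "y \<Zsemi> e = y" using r_one[of y] yG by simp
        ultimately have v: "\<forall>i \<in> {0..n - 1}. \<phi> (rot n i) = y [^]\<^bsub>Mon n S\<^esub> (2::nat) \<and> \<phi> (hperm n \<Zsemi> rot n i) = y"
          using r hrot by simp
        have "group_element_of_order S 2 y" by (rule ge[OF yG yy \<open>y \<noteq> e\<close>])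
        moreover have "rank f \<le> 2" using frank[OF hS hperm_Sym] \<open>y \<noteq> e\<close> by (simp add: y_def)
        moreover have "y \<Zsemi> f = f" "f \<Zsemi> y = f" using absorb[OF hS] by (simp_all add: y_def)
        ultimately have "endo6 n S \<phi>"
          unfolding endo6_def gperm_pow Mon_simps using S6 f_idem I v by blast
        then show ?thesis by blast
      next
        case xe: False
        show ?thesis
        proof (cases "\<exists>i. y = x [^]\<^bsub>?G\<^esub> (i::nat)")
          case True
          then obtain i where i: "y = x [^]\<^bsub>?G\<^esub> (i::nat)" by blast
          \<comment> \<open>As a power of x, y commutes with x, so the dihedral relation says that x
            is its own inverse. Then x has order 2, which divides n, and y is \<open>e\<close> or
            x.\<close>
          have xy: "y \<Zsemi> x = x \<Zsemi> y" using nat_pow_comm[of x i 1] nat_pow_eone[of x] xG unfolding i by (simp only: comp_structure_simps)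
          have "inv\<^bsub>?G\<^esub> x = x" using conj xy yy r_one[of x] xG by (simp add: pmult_assoc)
          then have xx: "x \<Zsemi> x = e" using r_inv[of x] xG by simp
          have p2: "p = 2" unfolding p_def by (rule ord2[OF xG xx xe])
          then have ev: "even n" using pn by simp
          have "y = e \<or> y = x"
          proof -
            have ev_pow: "x [^]\<^bsub>?G\<^esub> j = e" if "even j" for j :: nat
              using pow_eq_id[of x j] xG p2 that by (simp add: p_def)
            show ?thesis
            proof (cases "even i")
              case True
              then show ?thesis using ev_pow i by simp
            next
              case False
              then obtain j where "i = Suc j" "even j" by (metis even_Suc not0_implies_Suc odd_pos gr_implies_not0)
              then show ?thesis using ev_pow[of j] i l_one[of x] xG by simp
            qed
          qed
          have Mx2: "x [^]\<^bsub>Mon n S\<^esub> (i + 2) = \<phi> (rot n i)" for i using Mx[of i] unfolding p2 .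
          have "\<phi> (hperm n \<Zsemi> rot n i) = x [^]\<^bsub>Mon n S\<^esub> (i + 2)" if "y = e" for i
            unfolding hrot that Mx2 using phi_pid_mult(1)[OF rot_S] by (simp add: e_def)
          moreover have "\<phi> (hperm n \<Zsemi> rot n i) = x [^]\<^bsub>Mon n S\<^esub> (i + 1)" if "y = x" for i
          proof -
            have "x [^]\<^bsub>Mon n S\<^esub> (i + 1) = x [^]\<^bsub>?G\<^esub> (i + 1)" by (rule Mon2[OF xG]) simp
            also have "\<dots> = \<phi> (rot n (i + 1))" by (rule xpow)
            also have "\<dots> = \<phi> (rot n 1) \<Zsemi> \<phi> (rot n i)" unfolding phi_rot by (simp add: add.commute)
            finally show ?thesis unfolding hrot that by (simp add: x_def)
          qed
          ultimately have "(\<forall>i. \<phi> (hperm n \<Zsemi> rot n i) = x [^]\<^bsub>Mon n S\<^esub> (i + 2)) \<or> (\<forall>i. \<phi> (hperm n \<Zsemi> rot n i) = x [^]\<^bsub>Mon n S\<^esub> (i + 1))"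
            using \<open>y = e \<or> y = x\<close> by blast
          moreover have "group_element_of_order S 2 x" by (rule ge[OF xG xx xe])
          moreover have "rank f \<le> 2" using frank[OF rot_S rot_Sym, of 1] xe by (simp add: x_def)
          moreover have "x \<Zsemi> f = f" "f \<Zsemi> x = f" using absorb[OF rot_S] by (simp_all add: x_def)
          ultimately have "endo6 n S \<phi>"
            unfolding endo6_def gperm_pow Mon_simps using S6 f_idem I ev Mx2 by metis
          then show ?thesis by blast
        next
          case False
          then have notin: "\<And>i. y \<noteq> x [^]\<^bsub>?G\<^esub> (i::nat)" by blast
          have ye: "y \<noteq> e" using notin[of 0] by (simp add: nat_pow_def)
          \<comment> \<open>With a common fixed point neither x nor y preserves orientation, as both
            are nontrivial. Their product does, so it is trivial, and y becomes a power of
            x.\<close>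
          have "ran f = {}"
          proof (rule ccontr)
            assume "ran f \<noteq> {}"
            then obtain a where a: "a \<in> ran f" by blast
            have "x \<notin> POP n" using unit_fixpoint[OF rot_S rot_Sym, of 1 a] fixf[OF rot_S a] xe by (auto simp: x_def e_def)
            moreover have "y \<notin> POP n" using unit_fixpoint[OF hS hperm_Sym, of a] fixf[OF hS a] ye by (auto simp: y_def e_def)
            moreover have PR: "x \<in> POR n" "y \<in> POR n" using S_POR GS xG yG by blast+
            ultimately have "y \<Zsemi> x \<in> POP n" using POR_rev_mult POR_iff by blast
            moreover have "y \<Zsemi> x = \<phi> (hperm n \<Zsemi> rot n 1)" using hrot by (simp add: x_def)
            ultimately have "y \<Zsemi> x = e"
              using unit_fixpoint[OF S_mult[OF hS rot_S] Sym_mult[OF hperm_Sym rot_Sym], of 1 a] fixf[OF S_mult[OF hS rot_S] a]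
              by (simp add: e_def)
            then have "y = inv\<^bsub>?G\<^esub> x" using inv_equality[of y x] xG yG by simp
            then show False using notin dihedral_pair.inv_a[OF P] by blast
          qed
          then have fe: "f = Map.empty" by (rule f_empty)
          have "dihedral_of_order_2times p (subgroup_generated ?G {x, y})"
          proof (rule dihedral_order_2timesI[OF _ _ notin])
            show "dihedral_pair ?G x y p"
              by (intro dihedral_pair.intro grp dihedral_pair_axioms.intro)
                (use xG yG p0 yy conj pow_ord_eq_1[of x] in \<open>simp_all add: p_def\<close>)
            show "ord x = p" by (simp add: p_def)
            show "2 \<le> p" using p1[OF xe] by simp
          qed
          moreover have "S \<in> {PORI n, POR n}" using S6 not_full[OF fe] by blast
          moreover have "\<forall>i \<in> {0..n - 1}. \<phi> (rot n i) = x [^]\<^bsub>Mon n S\<^esub> (i + p) \<and>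
              \<phi> (hperm n \<Zsemi> rot n i) = y \<Zsemi> x [^]\<^bsub>Mon n S\<^esub> (i + p)"
            unfolding Mx using hrot by blast
          moreover have "ord y = 2" "ord x = p" using ord2[OF yG yy ye] by (simp_all add: p_def)
          ultimately have "endo5 n S \<phi>"
            unfolding endo5_def gperm_pow Mon_simps using pn p1[OF xe] max xG yG I[unfolded fe] by blast
          then show ?thesis by blast
        qed
      qed
    qed
  qed
qed

lemma endo_cases:
  "endo1 n S \<phi> \<or> endo2 n S \<phi> \<or> (\<exists>f. \<forall>s \<in> S. rank s < n \<longrightarrow> \<phi> s = f)"
proof -
  consider "S \<in> {OP n, OR n}" | "S \<in> {POPI n, POP n, PORI n, POR n}" using S_cases by blast
  then show ?thesis
  proof cases
    case 1
    then show ?thesis using full_endo S_full[OF 1] unfolding endo1_def by blast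
  next
    case 2
    then show ?thesis using partial_endo[OF S_partial[OF 2]] unfolding endo1_def endo2_def by blast
  qed
qed

lemma hom_cases:
  "endo1 n S \<phi> \<or> endo2 n S \<phi> \<or> endo3 n S \<phi> \<or> endo4 n S \<phi> \<or> endo5 n S \<phi> \<or> endo6 n S \<phi> \<or> endo7 S \<phi>"
proof (cases "\<exists>f. \<forall>s \<in> S. rank s < n \<longrightarrow> \<phi> s = f")
  case True
  then obtain f where f: "\<And>s. s \<in> S \<Longrightarrow> rank s < n \<Longrightarrow> \<phi> s = f" by blast
  have "\<phi> s = f" if "s \<in> S" "s \<notin> Sym n" for s
    using f[OF that(1)] rank_le[OF S_PT[OF that(1)]] rank_full_iff[OF S_PT[OF that(1)]] that(2) by force
  then show ?thesis using const_cases by blast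
qed (use endo_cases in blast)

text \<open>Type 2 and the maps constant on non-units identify all elements of rank 1: since n - 1 >
  1, \<open>phi0\<close> sends these to the empty map.\<close>

lemma inj_endo1:
  assumes "inj_on \<phi> S" shows "endo1 n S \<phi>"
proof -
  obtain s t where st: "s \<in> S" "t \<in> S" "s \<noteq> t" "rank s = 1" "rank t = 1" by (rule rank_one_pair)
  have ne: "\<phi> s \<noteq> \<phi> t" using assms st inj_onD by metis
  have "\<phi> s = \<phi> t" if "\<forall>s \<in> S. rank s < n \<longrightarrow> \<phi> s = f" for f using that st n3 by auto
  moreover have "phi0 n u = Map.empty" if "u \<in> S" "rank u = 1" for u
  proof -
    have PT: "u \<in> PT n" using S_PT that by blast
    have "u \<notin> Sym n" using rank_full_iff[OF PT] that n3 by auto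
    then have "phi0 n u i \<noteq> Some k" for i k
      using punct_ran(2)[OF PT] phi0_Some_iff[OF PT n0] that n3 by fastforce
    then show ?thesis by (intro ext) (metis not_None_eq)
  qed
  then have "\<not> endo2 n S \<phi>" unfolding endo2_def using st ne by metis
  ultimately show ?thesis using endo_cases ne by blast
qed

end

subsection \<open>Automorphisms\<close>

context oriented_monoid
begin

lemma Dih_pinv: "\<sigma> \<in> Dih n \<Longrightarrow> pinv \<sigma> \<in> Dih n"
  using n0 POR_pinv pinv_Sym Sym_PI by (simp add: Dih_eq)

lemma Dih_mult: "\<sigma> \<in> Dih n \<Longrightarrow> \<tau> \<in> Dih n \<Longrightarrow> \<sigma> \<Zsemi> \<tau> \<in> Dih n"
  using n0 POR_mult Sym_mult by (simp add: Dih_eq)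

lemma pinv_pinv: "\<sigma> \<in> Sym n \<Longrightarrow> pinv (pinv \<sigma>) = \<sigma>"
  using pinv_Some_iff[OF Sym_PI] pinv_Some_iff[OF Sym_PI[OF pinv_Sym]] by (intro pmap_eqI) blast

lemma conj_by_pid: "s \<in> PT n \<Longrightarrow> conj_by n (pid n) s = s"
  by (rule conj_by_eqI[OF pid_Sym]) simp_all

lemma conj_by_bij:
  assumes "\<sigma> \<in> Dih n" shows "bij_betw (conj_by n \<sigma>) S S"
proof (rule bij_betw_byWitness[where f' = "conj_by n (pinv \<sigma>)"])
  have \<sigma>: "\<sigma> \<in> Sym n" "pinv \<sigma> \<in> Sym n" using assms Dih_Sym pinv_Sym by blast+
  show "\<forall>s \<in> S. conj_by n (pinv \<sigma>) (conj_by n \<sigma> s) = s" "\<forall>s \<in> S. conj_by n \<sigma> (conj_by n (pinv \<sigma>) s) = s"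
    using \<sigma> by (simp_all add: conj_by_conj_by pinv_Sym_left pinv_Sym_right conj_by_pid S_PT)
qed (use conj_by_S assms Dih_pinv in auto)

text \<open>Conjugating the constant map with value i, or the partial identity on i, displays the
  image of i under the permutation.\<close>

lemma conj_by_faithful:
  assumes \<sigma>: "\<sigma> \<in> Sym n" "\<tau> \<in> Sym n" and eq: "\<And>s. s \<in> S \<Longrightarrow> conj_by n \<sigma> s = conj_by n \<tau> s"
  shows "\<sigma> = \<tau>"
proof -
  have val: "\<exists>j \<in> \<Omega> n. \<sigma> i = Some j" if "i \<in> \<Omega> n" "\<sigma> \<in> Sym n" for \<sigma> i using FT_D Sym_FT that by blast
  have "\<sigma> i = \<tau> i" if i: "i \<in> \<Omega> n" for i
  proof -
    obtain j k where j: "j \<in> \<Omega> n" "\<sigma> i = Some j" and k: "k \<in> \<Omega> n" "\<tau> i = Some k" using val i \<sigma> by metis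
    consider "S \<in> {OP n, OR n}" | "S \<in> {POPI n, POP n, PORI n, POR n}" using S_cases by blast
    then have "j = k"
    proof cases
      case 1
      have c: "conj_by n \<rho> (cst n i) = cst n l" if "\<rho> \<in> Sym n" "\<rho> i = Some l" "l \<in> \<Omega> n" for \<rho> l
        using that cst_OP[OF that(3)] by (intro conj_by_eqI) (auto simp: cst_mult[of \<rho> i l n] FT_cst Sym_FT OP_def POP_PT)
      have "cst n i \<in> S" using S_full[OF 1] cst_OP i by blast
      then have "cst n j = cst n k" using eq c[OF \<sigma>(1) j(2,1)] c[OF \<sigma>(2) k(2,1)] by simp
      then have "cst n j i = cst n k i" by simp
      then show ?thesis using i by simp
    next
      case 2
      have c: "conj_by n \<rho> (rid {i}) = rid {l}" if \<rho>: "\<rho> \<in> Sym n" "\<rho> i = Some l" "l \<in> \<Omega> n" for \<rho> l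
      proof (rule conj_by_eqI[OF \<rho>(1)])
        show "rid {l} \<in> PT n" using rid_PI[of "{l}" n] PI_PT \<rho> by simp
        show "rid {i} \<Zsemi> \<rho> = \<rho> \<Zsemi> rid {l}"
          using \<rho>(2) Sym_PI[OF \<rho>(1)] by (intro pmap_eqI) (auto simp: map_comp_Some_iff PI_iff)
      qed
      have "rid {i} \<in> S" using S_partial[OF 2] rid_POP[of "{i}" n] rid_PI[of "{i}" n] i by (auto simp: POPI_def)
      then have "rid {j} = rid {k}" using eq c[OF \<sigma>(1) j(2,1)] c[OF \<sigma>(2) k(2,1)] by simp
      then have "rid {j} j = rid {k} j" by simp
      then show ?thesis by (simp add: rid_def split: if_splits)
    qed
    then show ?thesis using j k by simp
  qed
  moreover have "\<sigma> i = None" "\<tau> i = None" if "i \<notin> \<Omega> n" for i using that Sym_dom[OF \<sigma>(1)] Sym_dom[OF \<sigma>(2)] by auto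
  ultimately show ?thesis by (intro ext) metis
qed

lemma Dih_iso_AutoGroup: "Mon n (Dih n) \<cong> AutoGroup (Mon n S)"
proof -
  \<comment> \<open>The inverse corrects the order of factors: products in \<open>Dih n\<close> are
    read from left to right, composition in \<open>BijGroup\<close> from right to left. The
    restriction makes the map extensional, as \<open>Bij S\<close> demands.\<close>
  let ?\<Psi> = "\<lambda>\<sigma>. restrict (conj_by n (pinv \<sigma>)) S"
  have Bij: "?\<Psi> \<sigma> \<in> Bij S" if "\<sigma> \<in> Dih n" for \<sigma>
    unfolding Bij_def using conj_by_bij[OF Dih_pinv[OF that]] by (auto cong: bij_betw_cong)
  have auto: "?\<Psi> \<sigma> \<in> auto (Mon n S)" if \<sigma>: "\<sigma> \<in> Dih n" for \<sigma>
  proof -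
    have P: "pinv \<sigma> \<in> Dih n" by (rule Dih_pinv[OF \<sigma>])
    have "?\<Psi> \<sigma> \<in> hom (Mon n S) (Mon n S)"
      by (rule endo1_hom) (use conj_by_S[OF P] P in \<open>auto simp: endo1_def\<close>)
    then show ?thesis using Bij[OF \<sigma>] by (simp add: auto_def)
  qed
  have mult: "?\<Psi> (\<sigma> \<Zsemi> \<tau>) = compose S (?\<Psi> \<sigma>) (?\<Psi> \<tau>)" if st: "\<sigma> \<in> Dih n" "\<tau> \<in> Dih n" for \<sigma> \<tau>
  proof (rule extensionalityI[of _ S])
    have Y: "\<sigma> \<in> Sym n" "\<tau> \<in> Sym n" using st Dih_Sym by blast+
    have inv: "pinv (\<sigma> \<Zsemi> \<tau>) = pinv \<tau> \<Zsemi> pinv \<sigma>"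
      using pinv_Some_iff[OF Sym_PI[OF Sym_mult[OF Y]]] pinv_Some_iff[OF Sym_PI[OF Y(1)]] pinv_Some_iff[OF Sym_PI[OF Y(2)]]
      by (intro pmap_eqI) (auto simp: map_comp_Some_iff)
    fix s assume s: "s \<in> S"
    have "conj_by n (pinv \<sigma> ) (conj_by n (pinv \<tau>) s) = conj_by n (pinv \<tau> \<Zsemi> pinv \<sigma>) s"
      using Y by (simp add: conj_by_conj_by pinv_Sym)
    then show "?\<Psi> (\<sigma> \<Zsemi> \<tau>) s = compose S (?\<Psi> \<sigma>) (?\<Psi> \<tau>) s"
      using s conj_by_S[OF Dih_pinv[OF st(2)] s] by (simp add: compose_def inv)
  qed (simp_all add: compose_def)
  have hom: "?\<Psi> \<in> hom (Mon n (Dih n)) (AutoGroup (Mon n S))"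
    unfolding hom_def AutoGroup_def BijGroup_def using auto Bij mult Dih_mult by auto
  have inj: "inj_on ?\<Psi> (Dih n)"
  proof (rule inj_onI)
    fix \<sigma> \<tau> assume st: "\<sigma> \<in> Dih n" "\<tau> \<in> Dih n" and eq: "?\<Psi> \<sigma> = ?\<Psi> \<tau>"
    have "pinv \<sigma> = pinv \<tau>"
    proof (rule conj_by_faithful)
      show "pinv \<sigma> \<in> Sym n" "pinv \<tau> \<in> Sym n" using st Dih_pinv Dih_Sym by blast+
      show "conj_by n (pinv \<sigma>) s = conj_by n (pinv \<tau>) s" if "s \<in> S" for s
        using fun_cong[OF eq, of s] that by simp
    qed
    then have "pinv (pinv \<sigma>) = pinv (pinv \<tau>)" by simp
    then show "\<sigma> = \<tau>" using st Dih_Sym pinv_pinv by simp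
  qed
  have surj: "?\<Psi> ` Dih n = auto (Mon n S)"
  proof
    show "?\<Psi> ` Dih n \<subseteq> auto (Mon n S)" using auto by blast
    show "auto (Mon n S) \<subseteq> ?\<Psi> ` Dih n"
    proof
      fix \<theta> assume "\<theta> \<in> auto (Mon n S)"
      then have \<theta>: "\<theta> \<in> hom (Mon n S) (Mon n S)" "\<theta> \<in> Bij S" by (auto simp: auto_def)
      interpret E: oriented_endo n S \<theta> by unfold_locales (rule \<theta>(1))
      have "inj_on \<theta> S" using \<theta>(2) by (simp add: Bij_def bij_betw_def)
      then obtain \<sigma> where \<sigma>: "\<sigma> \<in> Dih n" "\<forall>s \<in> S. \<theta> s = conj_by n \<sigma> s" using E.inj_endo1 unfolding endo1_def by blast
      have "\<theta> = ?\<Psi> (pinv \<sigma>)"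
      proof (rule extensionalityI[of _ S])
        show "\<theta> \<in> extensional S" using \<theta>(2) by (simp add: Bij_def)
      qed (use \<sigma> pinv_pinv[OF Dih_Sym] in simp_all)
      then show "\<theta> \<in> ?\<Psi> ` Dih n" using Dih_pinv[OF \<sigma>(1)] by blast
    qed
  qed
  have "?\<Psi> \<in> iso (Mon n (Dih n)) (AutoGroup (Mon n S))"
    unfolding iso_def bij_betw_def using hom inj surj by (simp add: AutoGroup_def)
  then show ?thesis unfolding is_iso_def by blast
qed

lemma endo1_iso:
  assumes "\<phi> \<in> S \<rightarrow> S" "endo1 n S \<phi>" shows "\<phi> \<in> iso (Mon n S) (Mon n S)"
proof -
  obtain \<sigma> where \<sigma>: "\<sigma> \<in> Dih n" "\<And>s. s \<in> S \<Longrightarrow> \<phi> s = conj_by n \<sigma> s" using assms(2) by (auto simp: endo1_def)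
  have "bij_betw \<phi> S S" using conj_by_bij[OF \<sigma>(1)] bij_betw_cong[of S \<phi> "conj_by n \<sigma>" S] \<sigma>(2) by blast
  then show ?thesis using endo1_hom[OF assms] by (simp add: iso_def)
qed

end

theorem theorem2p12:
  fixes n :: nat and S :: "pmap set" and \<phi> :: "pmap \<Rightarrow> pmap"
  assumes "n \<ge> 3"
    and "S \<in> {OP n, POPI n, POP n, OR n, PORI n, POR n}"
    and "\<phi> \<in> S \<rightarrow> S"
  shows
    "(\<phi> \<in> hom (Mon n S) (Mon n S) \<longleftrightarrow>
       (\<comment> \<open>1\<close>
        (\<exists>\<sigma> \<in> Dih n. \<forall>s \<in> S. \<phi> s = conj_by n \<sigma> s) \<or>
        \<comment> \<open>2\<close>
        (S \<in> {POPI n, POP n, PORI n, POR n} \<and>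
          (\<exists>\<sigma> \<in> Nrm n. \<forall>s \<in> S. \<phi> s = conj_by n \<sigma> (phi0 n s))) \<or>
        \<comment> \<open>3\<close>
        (\<exists>e \<in> idempotents S. \<exists>f \<in> idempotents S. e \<noteq> f \<and>
          e \<otimes>\<^bsub>Mon n S\<^esub> f = f \<and> f \<otimes>\<^bsub>Mon n S\<^esub> e = f \<and>
          \<phi> ` J_set n S = {e} \<and> \<phi> ` I_set (n - 1) S = {f}) \<or>
        \<comment> \<open>4\<close>
        (S \<in> {POPI n, POP n} \<and>
          (\<exists>p g0. p dvd n \<and> p > 1 \<and> group_element_of_order S p g0 \<and>
            (\<forall>i \<in> {0..n - 1}. \<phi> (gperm n [^]\<^bsub>Mon n S\<^esub> i) = g0 [^]\<^bsub>Mon n S\<^esub> (i + p)) \<and>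
            \<phi> ` I_set (n - 1) S = {Map.empty})) \<or>
        \<comment> \<open>5\<close>
        (S \<in> {PORI n, POR n} \<and>
          (\<exists>p g0 h0 G e. p dvd n \<and> p > 1 \<and>
            maximal_subgroup_of S G e \<and> g0 \<in> G \<and> h0 \<in> G \<and>
            group.ord (comp_structure G e) h0 = 2 \<and>
            group.ord (comp_structure G e) g0 = p \<and>
            dihedral_of_order_2times p (subgroup_generated (comp_structure G e) {g0, h0}) \<and>
            (\<forall>i \<in> {0..n - 1}.
              \<phi> (gperm n [^]\<^bsub>Mon n S\<^esub> i) = g0 [^]\<^bsub>Mon n S\<^esub> (i + p) \<and>
              \<phi> (hperm n \<otimes>\<^bsub>Mon n S\<^esub> gperm n [^]\<^bsub>Mon n S\<^esub> i) =
                h0 \<otimes>\<^bsub>Mon n S\<^esub> g0 [^]\<^bsub>Mon n S\<^esub> (i + p)) \<and>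
            \<phi> ` I_set (n - 1) S = {Map.empty})) \<or>
        \<comment> \<open>6\<close>
        (S \<in> {OR n, PORI n, POR n} \<and>
          (\<exists>h0 f. group_element_of_order S 2 h0 \<and> f \<in> idempotents S \<and> rank f \<le> 2 \<and>
            h0 \<otimes>\<^bsub>Mon n S\<^esub> f = f \<and> f \<otimes>\<^bsub>Mon n S\<^esub> h0 = f \<and>
            \<phi> ` I_set (n - 1) S = {f} \<and>
            ((\<forall>i \<in> {0..n - 1}.
                \<phi> (gperm n [^]\<^bsub>Mon n S\<^esub> i) = h0 [^]\<^bsub>Mon n S\<^esub> (2::nat) \<and>
                \<phi> (hperm n \<otimes>\<^bsub>Mon n S\<^esub> gperm n [^]\<^bsub>Mon n S\<^esub> i) = h0) \<or>
             (even n \<and> (\<forall>i \<in> {0..n - 1}.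
                \<phi> (gperm n [^]\<^bsub>Mon n S\<^esub> i) = h0 [^]\<^bsub>Mon n S\<^esub> (i + 2) \<and>
                \<phi> (hperm n \<otimes>\<^bsub>Mon n S\<^esub> gperm n [^]\<^bsub>Mon n S\<^esub> i) = h0 [^]\<^bsub>Mon n S\<^esub> (i + 2))) \<or>
             (even n \<and> (\<forall>i \<in> {0..n - 1}.
                \<phi> (gperm n [^]\<^bsub>Mon n S\<^esub> i) = h0 [^]\<^bsub>Mon n S\<^esub> (i + 2) \<and>
                \<phi> (hperm n \<otimes>\<^bsub>Mon n S\<^esub> gperm n [^]\<^bsub>Mon n S\<^esub> i) = h0 [^]\<^bsub>Mon n S\<^esub> (i + 1)))))) \<or>
        \<comment> \<open>7\<close>
        (\<exists>f \<in> idempotents S. \<forall>s \<in> S. \<phi> s = f))) \<and>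
     Mon n (Dih n) \<cong> AutoGroup (Mon n S) \<and>
     ((\<exists>\<sigma> \<in> Dih n. \<forall>s \<in> S. \<phi> s = conj_by n \<sigma> s) \<longrightarrow> \<phi> \<in> iso (Mon n S) (Mon n S))"
proof -
  interpret oriented_monoid n S using assms(1,2) by unfold_locales
  have "\<phi> \<in> hom (Mon n S) (Mon n S) \<longleftrightarrow>
    endo1 n S \<phi> \<or> endo2 n S \<phi> \<or> endo3 n S \<phi> \<or> endo4 n S \<phi> \<or> endo5 n S \<phi> \<or> endo6 n S \<phi> \<or> endo7 S \<phi>"
  proof
    assume "\<phi> \<in> hom (Mon n S) (Mon n S)"
    then interpret oriented_endo n S \<phi> by unfold_locales
    show "endo1 n S \<phi> \<or> endo2 n S \<phi> \<or> endo3 n S \<phi> \<or> endo4 n S \<phi> \<or> endo5 n S \<phi> \<or> endo6 n S \<phi> \<or> endo7 S \<phi>"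
      by (rule hom_cases)
  qed (use assms(3) endo1_hom endo2_hom endo3_hom endo4_hom endo5_hom endo6_hom endo7_hom in blast)
  moreover have "endo1 n S \<phi> \<longrightarrow> \<phi> \<in> iso (Mon n S) (Mon n S)" using endo1_iso assms(3) by blast
  ultimately show ?thesis
    using Dih_iso_AutoGroup
    unfolding endo1_def endo2_def endo3_def endo4_def endo5_def endo6_def endo7_def by blast
qed

end
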